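(* Let $\mu\subset\lambda$ be partitions, let $L_1,\dots,L_k$ be the Kreiman outer decomposition of $\lambda/\mu$, and let $P$ be the poset on $\{L_1,\dots,L_k\}$ with the relation $<$ ("strictly below"). Suppose that: (i) $P$ is a ranked poset; (ii) if $L_i<L_j$, then in $L_j$ the first step is an up step, the last step is a down step and every peak is a $\lambda$-high peak. Let $s_i$ (resp. $t_i$) be the first (resp. last) cell in $L_i$ and let $r_i$ be the rank of $L_i$ in $P$. Then \[ p(\lambda/\mu) = 2^{\sum_{i=1}^k r_i} \det \left( p(L_\lambda(s_i,t_j))\right)_{i,j=1}^k, \] where $p(L_\lambda(s_i,t_j))$ is understood to be $0$ when there is no $\lambda$-Dyck path from $s_i$ to $t_j$.
   Context: Partitions are identified with Young diagrams; $(i,j)\in\lambda$ is the cell in row $i$ (from the top), column $j$ (from the left). $\lambda/\mu$ is the set difference of diagrams. Excited diagrams: for a set $D$ of cells of $\lambda$, if $(i,j)\in D$, $(i+1,j),(i,j+1),(i+1,j+1)\notin D$ and $(i+1,j+1)\in\lambda$, then replacing $(i,j)$ by $(i+1,j+1)$ is an excited move; an excited diagram of $\lambda/\mu$ is a set obtained from $\mu$ by a sequence of excited moves. A pleasant diagram of $\lambda/\mu$ is a subset of $\lambda\setminus D$ for some excited diagram $D$ of $\lambda/\mu$. $p(\lambda/\mu)$ is the number of pleasant diagrams of $\lambda/\mu$. A $\lambda$-Dyck path is a sequence $(u_0,\dots,u_m)$ of cells of $\lambda$ such that each step $(u_{i-1},u_i)$ is an up step ($u_i-u_{i-1}=(-1,0)$)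 or a down step ($u_i-u_{i-1}=(0,1)$). $\mathrm{Dyck}_\lambda(s,t)$ is the set of $\lambda$-Dyck paths starting at cell $s$ and ending at cell $t$. If $s$ is the southmost cell of a column of $\lambda$ and $t$ the eastmost cell of a row of $\lambda$, $L_\lambda(s,t)$ is the lowest path in $\mathrm{Dyck}_\lambda(s,t)$ (on every diagonal it is as far southeast as possible); its set of cells is a skew shape (border strip), and $p(L_\lambda(s,t))$ is the number of pleasant diagrams of that skew shape. Paths are also regarded as sets of cells. For a $\lambda$-Dyck path $D=(u_0,\dots,u_m)$ and $1\le i\le m-1$: $u_i$ is a peak if $(u_{i-1},u_i)$ is an up step and $(u_i,u_{i+1})$ is a down step; a valley if $(u_{i-1},u_i)$ is a down step and $(u_i,u_{i+1})$ is an up step. A peak $u_i$ is a $\lambda$-high peak if $u_i+(1,1)\in\lambda$. For $\lambda$-Dyck paths, $D_1\le D_2$ ("weakly below") means: for every cell $u\in D_1$ there is an integer $k\ge0$ with $u-(k,k)\in D_2$; and every $u\in D_1\cap D_2$ is a peak of $D_1$ and a valley of $D_2$. $D_1<D_2$ ("strictly below") means $D_1\le D_2$ and $D_1\cap D_2=\emptyset$. The Kreiman outer decomposition of $\lambda/\mu$ is the (unique up to permutation) sequence $L_1,\dots,L_k$ of mutually disjoint nonempty $\lambda$-Dyck paths such that each $L_i$ starts at the southmost cell of a column of $\lambda$ and ends at the eastmost cell of a row of $\lambda$, and $L_1\cup\dots\cup L_k=\lambda/\mu$. A poset $P$ is ranked if there is a (necessarily unique) function $r:P\to\{0,1,2,\dots\}$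 with $r(x)=0$ for every minimal $x$ and $r(y)=r(x)+1$ whenever $y$ covers $x$; $r(x)$ is the rank of $x$. *)

theory Defs
  imports "HOL-Library.Product_Plus" "Jordan_Normal_Form.Determinant"
begin

(* (i, j) is the cell in row i (from the top) and column j (from the left), both counted from 1.
   Cells are integer pairs so that u - (k, k) is not truncated. *)
type_synonym cell = "int \<times> int"

definition is_partition :: "nat list \<Rightarrow> bool" where
  "is_partition la \<longleftrightarrow> sorted_wrt (\<ge>) la \<and> (\<forall>a \<in> set la. 0 < a)"

definition cells :: "nat list \<Rightarrow> cell set" where
  "cells la = {(i, j). 1 \<le> i \<and> i \<le> int (length la) \<and> 1 \<le> j \<and> j \<le> int (la ! nat (i - 1))}"

(* From here on, Y and M are sets of cells, intended to be Young diagrams with M a subset of Y. *)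

definition excited_move :: "cell set \<Rightarrow> cell set \<Rightarrow> cell set \<Rightarrow> bool" where
  "excited_move Y D D' \<longleftrightarrow> (\<exists>i j. (i, j) \<in> D \<and> (i + 1, j) \<notin> D \<and> (i, j + 1) \<notin> D \<and>
     (i + 1, j + 1) \<notin> D \<and> (i + 1, j + 1) \<in> Y \<and>
     D' = insert (i + 1, j + 1) (D - {(i, j)}))"

definition excited_diagrams :: "cell set \<Rightarrow> cell set \<Rightarrow> cell set set" where
  "excited_diagrams Y M = {D. (excited_move Y)\<^sup>*\<^sup>* M D}"

definition pleasant_diagrams :: "cell set \<Rightarrow> cell set \<Rightarrow> cell set set" where
  "pleasant_diagrams Y M = {B. \<exists>D \<in> excited_diagrams Y M. B \<subseteq> Y - D}"

definition num_pleasant :: "cell set \<Rightarrow> cell set \<Rightarrow> nat" where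
  "num_pleasant Y M = card (pleasant_diagrams Y M)"

definition up_step :: "cell \<Rightarrow> cell \<Rightarrow> bool" where
  "up_step u v \<longleftrightarrow> v - u = (-1, 0)"

definition down_step :: "cell \<Rightarrow> cell \<Rightarrow> bool" where
  "down_step u v \<longleftrightarrow> v - u = (0, 1)"

definition dyck_path :: "cell set \<Rightarrow> cell list \<Rightarrow> bool" where
  "dyck_path Y p \<longleftrightarrow> p \<noteq> [] \<and> set p \<subseteq> Y \<and>
     (\<forall>i. i + 1 < length p \<longrightarrow> up_step (p ! i) (p ! (i + 1)) \<or> down_step (p ! i) (p ! (i + 1)))"

definition Dyck :: "cell set \<Rightarrow> cell \<Rightarrow> cell \<Rightarrow> cell list set" where
  "Dyck Y s t = {p. dyck_path Y p \<and> hd p = s \<and> last p = t}"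

definition southmost_in_column :: "cell set \<Rightarrow> cell \<Rightarrow> bool" where
  "southmost_in_column Y s \<longleftrightarrow> s \<in> Y \<and> (\<forall>i. (i, snd s) \<in> Y \<longrightarrow> i \<le> fst s)"

definition eastmost_in_row :: "cell set \<Rightarrow> cell \<Rightarrow> bool" where
  "eastmost_in_row Y t \<longleftrightarrow> t \<in> Y \<and> (\<forall>j. (fst t, j) \<in> Y \<longrightarrow> j \<le> snd t)"

(* All paths from s to t cross the same diagonals, each exactly once; the lowest path is the one
   that is furthest southeast on each of them. It is meaningful only if Dyck Y s t is nonempty. *)
definition lowest_path :: "cell set \<Rightarrow> cell \<Rightarrow> cell \<Rightarrow> cell list" where
  "lowest_path Y s t = (THE p. p \<in> Dyck Y s t \<and>
     (\<forall>q \<in> Dyck Y s t. \<forall>u \<in> set q. \<exists>k\<ge>0. u + (k, k) \<in> set p))"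

(* If s is southmost in its column and t is eastmost in its row, the lowest path L is the part of
   the southeast rim of Y from s to t. So Y - L is again a Young diagram, and L is the skew shape
   Y / (Y - L). Any other way of writing L as a difference of two nested Young diagrams has the
   same pleasant diagrams, since excited moves only ever enter cells of L. *)
definition num_pleasant_lowest :: "cell set \<Rightarrow> cell \<Rightarrow> cell \<Rightarrow> nat" where
  "num_pleasant_lowest Y s t =
     (if Dyck Y s t = {} then 0 else num_pleasant Y (Y - set (lowest_path Y s t)))"

definition is_peak :: "cell list \<Rightarrow> cell \<Rightarrow> bool" where
  "is_peak p u \<longleftrightarrow> (\<exists>i. 1 \<le> i \<and> i + 1 < length p \<and> p ! i = u \<and>
     up_step (p ! (i - 1)) (p ! i) \<and> down_step (p ! i) (p ! (i + 1)))"

definition is_valley :: "cell list \<Rightarrow> cell \<Rightarrow> bool" where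
  "is_valley p u \<longleftrightarrow> (\<exists>i. 1 \<le> i \<and> i + 1 < length p \<and> p ! i = u \<and>
     down_step (p ! (i - 1)) (p ! i) \<and> up_step (p ! i) (p ! (i + 1)))"

definition is_high_peak :: "cell set \<Rightarrow> cell list \<Rightarrow> cell \<Rightarrow> bool" where
  "is_high_peak Y p u \<longleftrightarrow> is_peak p u \<and> u + (1, 1) \<in> Y"

definition first_step_up :: "cell list \<Rightarrow> bool" where
  "first_step_up p \<longleftrightarrow> 2 \<le> length p \<and> up_step (p ! 0) (p ! 1)"

definition last_step_down :: "cell list \<Rightarrow> bool" where
  "last_step_down p \<longleftrightarrow> 2 \<le> length p \<and> down_step (p ! (length p - 2)) (p ! (length p - 1))"

definition weakly_below :: "cell list \<Rightarrow> cell list \<Rightarrow> bool" where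
  "weakly_below p q \<longleftrightarrow> (\<forall>u \<in> set p. \<exists>k\<ge>0. u - (k, k) \<in> set q) \<and>
     (\<forall>u \<in> set p \<inter> set q. is_peak p u \<and> is_valley q u)"

definition strictly_below :: "cell list \<Rightarrow> cell list \<Rightarrow> bool" where
  "strictly_below p q \<longleftrightarrow> weakly_below p q \<and> set p \<inter> set q = {}"

definition kreiman_decomposition :: "cell set \<Rightarrow> cell set \<Rightarrow> cell list list \<Rightarrow> bool" where
  "kreiman_decomposition Y M Ls \<longleftrightarrow>
     (\<forall>p \<in> set Ls. dyck_path Y p \<and> southmost_in_column Y (hd p) \<and> eastmost_in_row Y (last p)) \<and>
     (\<forall>i < length Ls. \<forall>j < length Ls. i \<noteq> j \<longrightarrow> set (Ls ! i) \<inter> set (Ls ! j) = {}) \<and>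
     (\<Union>p \<in> set Ls. set p) = Y - M"

(* A poset is given by its carrier A and its strict order lt. *)

definition minimal_in :: "'a set \<Rightarrow> ('a \<Rightarrow> 'a \<Rightarrow> bool) \<Rightarrow> 'a \<Rightarrow> bool" where
  "minimal_in A lt x \<longleftrightarrow> x \<in> A \<and> \<not> (\<exists>z \<in> A. lt z x)"

definition covered_by :: "'a set \<Rightarrow> ('a \<Rightarrow> 'a \<Rightarrow> bool) \<Rightarrow> 'a \<Rightarrow> 'a \<Rightarrow> bool" where
  "covered_by A lt x y \<longleftrightarrow> x \<in> A \<and> y \<in> A \<and> lt x y \<and> \<not> (\<exists>z \<in> A. lt x z \<and> lt z y)"

definition rank_function :: "'a set \<Rightarrow> ('a \<Rightarrow> 'a \<Rightarrow> bool) \<Rightarrow> ('a \<Rightarrow> nat) \<Rightarrow> bool" where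
  "rank_function A lt r \<longleftrightarrow> (\<forall>x. minimal_in A lt x \<longrightarrow> r x = 0) \<and>
     (\<forall>x y. covered_by A lt x y \<longrightarrow> r y = r x + 1)"

definition ranked :: "'a set \<Rightarrow> ('a \<Rightarrow> 'a \<Rightarrow> bool) \<Rightarrow> bool" where
  "ranked A lt \<longleftrightarrow> (\<exists>r. rank_function A lt r)"

(* Rank functions are unique on A but arbitrary outside it, hence the description of the value
   rather than of the function. *)
definition poset_rank :: "'a set \<Rightarrow> ('a \<Rightarrow> 'a \<Rightarrow> bool) \<Rightarrow> 'a \<Rightarrow> nat" where
  "poset_rank A lt x = (THE n. \<exists>r. rank_function A lt r \<and> r x = n)"

end

theory Submission
  imports Defs
begin

text \<open>The proof compares sums over families of disjoint lattice paths that join the ends of the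
  paths \<open>L\<^sub>1, \<dots>, L\<^sub>k\<close> of the decomposition.

  \<^emph>\<open>Pleasant diagrams.\<close> The complements of the excited diagrams are the unions of disjoint
  Dyck paths with these ends, and an excited move raises a valley of one of the paths. Among
  the families that cover a pleasant diagram there is a highest one; it is the only one all of
  whose valleys belong to the pleasant diagram. Hence \<open>p(\<lambda>/\<mu>)\<close> is the sum, over all disjoint
  families of Dyck paths, of \<open>2\<close> to the number of cells that are not valleys
  (\<open>num_pleasant_eq_families\<close>). For a single path this computes the entries of the matrix.

  \<^emph>\<open>The determinant.\<close> Write the factor \<open>1/2\<close> of a valley as \<open>1 - 1/2\<close>, and read the second
  summand as a diagonal step in place of the valley. This turns the weight of a Dyck path into
  a sum over Delannoy paths with weight \<open>2\<close> for every cell and \<open>-1\<close> for every diagonal step.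
  These weights are multiplicative, and two Delannoy paths that change sides have a common vertex.
  So the method of Lindstrom, Gessel and Viennot applies: the determinant is the sum over all
  disjoint families of Delannoy paths (\<open>det_eq_disjoint_delannoy\<close>).

  \<^emph>\<open>Comparison.\<close> Both sums have the same weights, but turning diagonal steps back into valleys
  may destroy disjointness: a valley can run into a peak of the path below. Such contacts carry
  a sign, since the diagonal step is then prescribed. Now diagonal steps may be turned into
  peaks as well. Peaks can only touch the path above, at a valley, and with the same sign; so
  instead of accepting the contacts one may turn valleys of the path above into diagonal
  steps. In this way the diagonal steps of all paths of rank \<open>r\<close> move to the paths of rank
  \<open>r + 1\<close>; that \<open>P\<close> is ranked ensures that all paths directly inside a given one take part at
  the same time. Each move costs a factor \<open>2\<close> for every path of rank \<open>r\<close>, because a path that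
  begins with an up step and ends with a down step has one peak more than valleys, and all its
  peaks are high by the hypothesis on \<open>L\<^sub>j\<close>. From the highest rank the diagonal steps
  disappear. A path of rank \<open>r\<close> is passed by the diagonal steps of the ranks \<open>1, \<dots>, r\<close>, which
  gives \<open>r\<close> factors \<open>2\<close> (\<open>mixed_sum_all\<close>). A path of rank \<open>0\<close> has nothing below, so that its
  own diagonal steps can be turned into valleys.\<close>

section \<open>Vertex-disjoint families of layered paths\<close>

text \<open>A path is recorded by its position on each layer. All positions are nonzero, and the value
  \<open>0\<close> marks the layers that the path does not reach.\<close>

type_synonym path = "int \<Rightarrow> int"

definition supp :: "path \<Rightarrow> int set" where
  "supp f = {c. f c \<noteq> 0}"

definition disjoint_paths :: "path \<Rightarrow> path \<Rightarrow> bool" where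
  "disjoint_paths f g \<longleftrightarrow> (\<forall>c. f c = g c \<longrightarrow> f c = 0)"

lemma disjoint_paths_sym: "disjoint_paths f g \<longleftrightarrow> disjoint_paths g f"
  unfolding disjoint_paths_def by metis

definition pairwise_disjoint :: "nat \<Rightarrow> (nat \<Rightarrow> path) \<Rightarrow> bool" where
  "pairwise_disjoint k D \<longleftrightarrow> (\<forall>i<k. \<forall>j<k. i \<noteq> j \<longrightarrow> disjoint_paths (D i) (D j))"

definition layered_paths ::
    "(int \<Rightarrow> int \<Rightarrow> int set) \<Rightarrow> int \<Rightarrow> int \<Rightarrow> int \<Rightarrow> int \<Rightarrow> path set" where
  "layered_paths S a u b v = {f. a \<le> b \<and> f a = u \<and> f b = v \<and>
     (\<forall>c. f c \<noteq> 0 \<longleftrightarrow> a \<le> c \<and> c \<le> b) \<and> (\<forall>c. a \<le> c \<and> c < b \<longrightarrow> f (c + 1) \<in> S c (f c))}"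

definition path_weight :: "(int \<Rightarrow> int) \<Rightarrow> path \<Rightarrow> int" where
  "path_weight q f = (\<Prod>c\<in>supp f. q (f c))"

lemma sum_PiE_coordinate:
  assumes "i \<in> I"
  shows "(\<Sum>D\<in>Pi\<^sub>E I X. F D) = (\<Sum>E\<in>Pi\<^sub>E (I - {i}) X. \<Sum>y\<in>X i. F (E(i := y)))"
proof -
  have I: "I = insert i (I - {i})" using assms by auto
  have inj: "inj_on (\<lambda>(y, g). g(i := y)) (X i \<times> Pi\<^sub>E (I - {i}) X)"
    by (rule inj_combinator) auto
  have "(\<Sum>D\<in>Pi\<^sub>E I X. F D) = (\<Sum>(y, g)\<in>X i \<times> Pi\<^sub>E (I - {i}) X. F (g(i := y)))"
    by (subst I, subst PiE_insert_eq, subst sum.reindex[OF inj])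
       (auto intro: sum.cong simp: case_prod_unfold)
  also have "\<dots> = (\<Sum>y\<in>X i. \<Sum>E\<in>Pi\<^sub>E (I - {i}) X. F (E(i := y)))"
    by (simp add: sum.cartesian_product)
  also have "\<dots> = (\<Sum>E\<in>Pi\<^sub>E (I - {i}) X. \<Sum>y\<in>X i. F (E(i := y)))"
    by (rule sum.swap)
  finally show ?thesis .
qed

lemma layered_pathsD:
  assumes "f \<in> layered_paths S a u b v"
  shows "a \<le> b" "f a = u" "f b = v" "f c \<noteq> 0 \<longleftrightarrow> a \<le> c \<and> c \<le> b"
    "a \<le> c \<Longrightarrow> c < b \<Longrightarrow> f (c + 1) \<in> S c (f c)"
  using assms by (auto simp: layered_paths_def)

lemma supp_layered: "f \<in> layered_paths S a u b v \<Longrightarrow> supp f = {a..b}"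
  by (auto simp: supp_def layered_pathsD(4))

type_synonym state = "(int \<times> int) + nat"

locale layered_graph =
  fixes S :: "int \<Rightarrow> int \<Rightarrow> int set" and b v :: "nat \<Rightarrow> int" and q :: "int \<Rightarrow> int" and k :: nat
  assumes S_nonzero: "0 \<notin> S c x" and finite_S: "finite (S c x)"
begin

lemma layered_paths_Cons:
  assumes u: "u \<noteq> 0"
  shows "layered_paths S a u z w = (if a = z \<and> u = w then {(\<lambda>_. 0)(a := u)} else {}) \<union>
     (\<Union>u'\<in>S a u. (\<lambda>g. g(a := u)) ` layered_paths S (a + 1) u' z w)" (is "?L = ?R1 \<union> ?R2")
proof (intro equalityI subsetI)
  fix f assume f: "f \<in> ?L"
  note D = layered_pathsD[OF f]
  show "f \<in> ?R1 \<union> ?R2"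
  proof (cases "a = z")
    case True
    have "f = (\<lambda>_. 0)(a := u)" using D(2) D(4) True by (intro ext) (metis fun_upd_apply order.antisym)
    then show ?thesis using D(2,3) True by simp
  next
    case False
    then have "f (a + 1) \<in> S a u" using D(1,2) D(5)[of a] by auto
    moreover have "f(a := 0) \<in> layered_paths S (a + 1) (f (a + 1)) z w"
      using D False by (auto simp: layered_paths_def)
    moreover have "f = (f(a := 0))(a := u)" using D(2) by auto
    ultimately have "f \<in> ?R2" by blast
    then show ?thesis ..
  qed
next
  fix f assume "f \<in> ?R1 \<union> ?R2"
  then show "f \<in> ?L"
  proof
    assume "f \<in> ?R1"
    then show ?thesis using u by (auto simp: layered_paths_def split: if_splits)
  next
    assume "f \<in> ?R2"
    then obtain u' g where u': "u' \<in> S a u" and g: "g \<in> layered_paths S (a + 1) u' z w"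
      and f: "f = g(a := u)" by auto
    note D = layered_pathsD[OF g]
    have supp': "(g(a := u)) c \<noteq> 0 \<longleftrightarrow> a \<le> c \<and> c \<le> z" for c
      using D(1) D(4)[of c] u by auto
    have steps: "(g(a := u)) (c + 1) \<in> S c ((g(a := u)) c)" if "a \<le> c" "c < z" for c
    proof (cases "c = a")
      case True
      then show ?thesis using u' D(2) by simp
    next
      case False
      then show ?thesis using D(5)[of c] that by simp
    qed
    have "(g(a := u)) z = w" using D(1,3) by simp
    then show ?thesis unfolding layered_paths_def f using D(1) supp' steps by simp
  qed
qed

lemma finite_layered_paths:
  assumes "u \<noteq> 0"
  shows "finite (layered_paths S a u z w)"
  using assms
proof (induction "nat (z - a + 1)" arbitrary: a u)
  case 0
  then have "layered_paths S a u z w = {}" by (auto simp: layered_paths_def)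
  then show ?case by simp
next
  case (Suc n)
  have "finite (layered_paths S (a + 1) u' z w)" if "u' \<in> S a u" for u'
  proof (rule Suc(1))
    show "n = nat (z - (a + 1) + 1)" using Suc(2) by linarith
    show "u' \<noteq> 0" using that S_nonzero by metis
  qed
  then show ?case using finite_S by (subst layered_paths_Cons) (use Suc.prems in auto)
qed

text \<open>In the induction that proves the determinant formula a path is consumed from its start. A
  state is either the part that remains, given by its current vertex, or the number of the target
  that has been reached.\<close>

fun state_paths :: "state \<Rightarrow> nat \<Rightarrow> path set" where
  "state_paths (Inl (a, u)) j = layered_paths S a u (b j) (v j)"
| "state_paths (Inr m) j = (if m = j then {\<lambda>_. 0} else {})"

definition next_states :: "int \<Rightarrow> int \<Rightarrow> state set" where
  "next_states a u =
     (\<lambda>u'. Inl (a + 1, u')) ` S a u \<union> Inr ` {m. m < k \<and> b m = a \<and> v m = u}"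

lemma sum_layered_paths_first_step:
  assumes u: "u \<noteq> 0" and j: "j < k"
  shows "(\<Sum>f\<in>layered_paths S a u (b j) (v j). G f) =
    (\<Sum>y\<in>next_states a u. \<Sum>g\<in>state_paths y j. (G (g(a := u)) :: int))"
proof -
  let ?P = "\<lambda>y. state_paths y j" and ?N = "next_states a u"
  have fin: "finite ?N" using finite_S by (auto simp: next_states_def)
  have finP: "\<forall>y\<in>?N. finite (?P y)"
  proof
    fix y assume "y \<in> ?N"
    then consider u' where "y = Inl (a + 1, u')" "u' \<in> S a u" | m where "y = Inr m"
      by (auto simp: next_states_def)
    then show "finite (?P y)"
    proof cases
      case 1
      then have "u' \<noteq> 0" using S_nonzero by metis
      then show ?thesis using 1 finite_layered_paths by simp
    qed simp
  qed
  have g0: "g a = 0" if "y \<in> ?N" "g \<in> ?P y" for y g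
    using that by (auto simp: next_states_def split: if_splits)
      (metis add_le_same_cancel1 layered_pathsD(4) not_one_le_zero)
  have inN: "g(a := u) \<in> layered_paths S a u (b j) (v j)" if y: "y \<in> ?N" and g: "g \<in> ?P y" for y g
  proof -
    note C = layered_paths_Cons[OF u, of a "b j" "v j"]
    consider u' where "y = Inl (a + 1, u')" "u' \<in> S a u" | m where "y = Inr m" "b m = a" "v m = u"
      using y by (auto simp: next_states_def)
    then show ?thesis
    proof cases
      case 1
      then show ?thesis using g unfolding C by auto
    next
      case 2
      then show ?thesis using g unfolding C by (auto split: if_splits)
    qed
  qed
  show ?thesis
    unfolding sum.Sigma[OF fin finP]
  proof (rule sum.reindex_bij_witness[where i = "\<lambda>(y, g). g(a := u)" and
        j = "\<lambda>f. (if b j = a then Inr j else Inl (a + 1, f (a + 1)), f(a := 0))"])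
    fix f assume f: "f \<in> layered_paths S a u (b j) (v j)"
    note D = layered_pathsD[OF f]
    show "(case (if b j = a then Inr j else Inl (a + 1, f (a + 1)), f(a := 0)) of (y, g) \<Rightarrow> g(a := u)) = f"
      using D(2) by auto
    show "(if b j = a then Inr j else Inl (a + 1, f (a + 1)), f(a := 0)) \<in> Sigma ?N ?P"
    proof (cases "b j = a")
      case True
      have "f(a := 0) = (\<lambda>_. 0)" using D(4) True by (intro ext) (metis fun_upd_apply order.antisym)
      then show ?thesis using True D(2,3) j by (auto simp: next_states_def)
    next
      case False
      then have "f (a + 1) \<in> S a u" using D(1,2) D(5)[of a] by auto
      moreover have "f(a := 0) \<in> layered_paths S (a + 1) (f (a + 1)) (b j) (v j)"
        using D False by (auto simp: layered_paths_def)
      ultimately show ?thesis using False by (auto simp: next_states_def)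
    qed
    show "(case (if b j = a then Inr j else Inl (a + 1, f (a + 1)), f(a := 0)) of
        (y, g) \<Rightarrow> G (g(a := u))) = G f"
      using D(2) by (auto intro!: arg_cong[of _ _ G])
  next
    fix z assume "z \<in> Sigma ?N ?P"
    then obtain y g where z: "z = (y, g)" and y: "y \<in> ?N" and g: "g \<in> ?P y" by auto
    have "(if b j = a then Inr j else Inl (a + 1, g (a + 1))) = y"
    proof -
      consider u' where "y = Inl (a + 1, u')" "u' \<in> S a u" | m where "y = Inr m" "b m = a"
        using y by (auto simp: next_states_def)
      then show ?thesis
      proof cases
        case 1
        then have "g (a + 1) = u'" "a + 1 \<le> b j" using g layered_pathsD(1,2) by auto
        then show ?thesis using 1 by auto
      next
        case 2
        then have "m = j" using g by (auto split: if_splits)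
        then show ?thesis using 2 by simp
      qed
    qed
    moreover have "(g(a := u))(a := 0) = g" using g0[OF y g] by auto
    ultimately show "(if b j = a then Inr j else Inl (a + 1, (case z of (y, g) \<Rightarrow> g(a := u)) (a + 1)),
       (case z of (y, g) \<Rightarrow> g(a := u))(a := 0)) = z"
      by (cases "b j = a") (auto simp: z)
    show "(case z of (y, g) \<Rightarrow> g(a := u)) \<in> layered_paths S a u (b j) (v j)"
      using inN[OF y g] by (simp add: z)
  qed
qed

abbreviation state_families :: "(nat \<Rightarrow> state) \<Rightarrow> (nat \<Rightarrow> nat) \<Rightarrow> (nat \<Rightarrow> path) set" where
  "state_families st \<sigma> \<equiv> (\<Pi>\<^sub>E i\<in>{..<k}. state_paths (st i) (\<sigma> i))"

lemma path_weight_upd: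
  assumes "g a = 0" "u \<noteq> 0" "finite (supp g)"
  shows "path_weight q (g(a := u)) = q u * path_weight q g"
proof -
  have "supp (g(a := u)) = insert a (supp g)" "a \<notin> supp g"
    using assms by (auto simp: supp_def)
  then show ?thesis unfolding path_weight_def using assms(3)
    by (auto intro!: prod.cong)
qed

text \<open>The two sides of the determinant formula: the same signed sum, over all families of paths or
  over the families accepted by \<open>ok\<close>.\<close>

definition signed_family_sum where
  "signed_family_sum ok st =
     (\<Sum>\<sigma> | \<sigma> permutes {..<k}. signof \<sigma> *
        (\<Sum>D\<in>state_families st \<sigma>.
           if ok D then \<Prod>i<k. path_weight q (D i) else (0::int)))"

lemma finite_supp_state_paths:
  "g \<in> state_paths y j \<Longrightarrow> finite (supp g)"
  by (cases y) (auto simp: supp_layered split: if_splits, simp add: supp_def)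

lemma state_paths_before:
  assumes "y \<in> next_states a u" "g \<in> state_paths y j"
  shows "g a = 0"
  using assms by (auto simp: next_states_def split: if_splits)
    (metis add_le_same_cancel1 layered_pathsD(4) not_one_le_zero)

text \<open>Splitting off the first step of one path is linear in the successors, both for all families and
  for the accepted ones, as long as acceptance does not depend on the vertex that is removed.\<close>

lemma signed_family_sum_first_step:
  assumes i: "i < k" "st i = Inl (a, u)" and u: "u \<noteq> 0"
    and ok: "\<And>\<sigma> D y. \<lbrakk>\<sigma> permutes {..<k}; y \<in> next_states a u;
        D \<in> state_families (st(i := y)) \<sigma>\<rbrakk> \<Longrightarrow>
        ok (D(i := (D i)(a := u))) = ok D"
  shows "signed_family_sum ok st =
    q u * (\<Sum>y\<in>next_states a u. signed_family_sum ok (st(i := y)))"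
proof -
  let ?N = "next_states a u"
  let ?w = "\<lambda>D. if ok D then \<Prod>i<k. path_weight q (D i) else (0::int)"
  have inner: "(\<Sum>D\<in>state_families st \<sigma>. ?w D) =
      q u * (\<Sum>y\<in>?N. \<Sum>D\<in>state_families (st(i := y)) \<sigma>. ?w D)"
    if \<sigma>: "\<sigma> permutes {..<k}" for \<sigma>
  proof -
    let ?E = "\<Pi>\<^sub>E j\<in>{..<k} - {i}. state_paths (st j) (\<sigma> j)"
    have \<sigma>i: "\<sigma> i < k" using permutes_in_image[OF \<sigma>] i(1) by auto
    have E: "(\<Pi>\<^sub>E j\<in>{..<k} - {i}. state_paths ((st(i := y)) j) (\<sigma> j)) = ?E" for y
      by (rule PiE_cong) auto
    have "(\<Sum>D\<in>state_families st \<sigma>. ?w D) =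
        (\<Sum>E\<in>?E. \<Sum>f\<in>layered_paths S a u (b (\<sigma> i)) (v (\<sigma> i)). ?w (E(i := f)))"
      by (subst sum_PiE_coordinate[of i]) (use i in simp_all)
    also have "\<dots> = (\<Sum>E\<in>?E. \<Sum>y\<in>?N. \<Sum>g\<in>state_paths y (\<sigma> i). ?w (E(i := g(a := u))))"
      by (rule sum.cong[OF refl], rule sum_layered_paths_first_step) (use u \<sigma>i in auto)
    also have "\<dots> = (\<Sum>E\<in>?E. \<Sum>y\<in>?N. \<Sum>g\<in>state_paths y (\<sigma> i). q u * ?w (E(i := g)))"
    proof (intro sum.cong refl)
      fix E y g assume E': "E \<in> ?E" and y: "y \<in> ?N" and g: "g \<in> state_paths y (\<sigma> i)"
      have D: "E(i := g) \<in> state_families (st(i := y)) \<sigma>"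
        using E' g i(1) by (auto simp: PiE_iff extensional_def)
      have "ok (E(i := g(a := u))) = ok (E(i := g))"
        using ok[OF \<sigma> y D] by simp
      moreover have "(\<Prod>j<k. path_weight q ((E(i := g(a := u))) j)) =
          q u * (\<Prod>j<k. path_weight q ((E(i := g)) j))"
        using i(1) path_weight_upd[OF state_paths_before[OF y g] u finite_supp_state_paths[OF g]]
        by (simp add: prod.remove[of "{..<k}" i] mult.assoc)
      ultimately show "?w (E(i := g(a := u))) = q u * ?w (E(i := g))" by simp
    qed
    also have "\<dots> = (\<Sum>y\<in>?N. \<Sum>E\<in>?E. \<Sum>g\<in>state_paths y (\<sigma> i). q u * ?w (E(i := g)))"
      by (rule sum.swap)
    also have "\<dots> = (\<Sum>y\<in>?N. q u * (\<Sum>D\<in>state_families (st(i := y)) \<sigma>. ?w D))"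
    proof (rule sum.cong[OF refl])
      fix y
      have "(\<Sum>D\<in>state_families (st(i := y)) \<sigma>. ?w D) =
          (\<Sum>E\<in>?E. \<Sum>g\<in>state_paths y (\<sigma> i). ?w (E(i := g)))"
        by (subst sum_PiE_coordinate[of i]) (use i(1) in \<open>simp_all add: E del: fun_upd_apply\<close>, simp)
      then show "(\<Sum>E\<in>?E. \<Sum>g\<in>state_paths y (\<sigma> i). q u * ?w (E(i := g))) =
          q u * (\<Sum>D\<in>state_families (st(i := y)) \<sigma>. ?w D)"
        by (simp add: sum_distrib_left)
    qed
    finally show ?thesis by (simp add: sum_distrib_left)
  qed
  have "signed_family_sum ok st = (\<Sum>\<sigma> | \<sigma> permutes {..<k}. \<Sum>y\<in>?N. q u * (signof \<sigma> *
      (\<Sum>D\<in>state_families (st(i := y)) \<sigma>. ?w D)))"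
    unfolding signed_family_sum_def
    by (intro sum.cong refl) (simp only: inner mem_Collect_eq sum_distrib_left mult_ac)
  also have "\<dots> = q u * (\<Sum>y\<in>?N. signed_family_sum ok (st(i := y)))"
    unfolding signed_family_sum_def by (subst sum.swap) (simp add: sum_distrib_left)
  finally show ?thesis .
qed

lemma signed_family_sum_eq_det:
  assumes nz: "\<And>i a u. i < k \<Longrightarrow> st i = Inl (a, u) \<Longrightarrow> u \<noteq> 0"
  shows "signed_family_sum (\<lambda>_. True) st =
    det (mat k k (\<lambda>(i, j). \<Sum>f\<in>state_paths (st i) j. path_weight q f))"
proof -
  have fin: "finite (state_paths (st i) j)" if "i < k" for i j
    using nz[OF that] finite_layered_paths by (cases "st i") auto
  show ?thesis
    unfolding signed_family_sum_def det_def'[OF mat_carrier] lessThan_atLeast0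
  proof (rule sum.cong[OF refl])
    fix \<sigma> assume "\<sigma> \<in> {\<sigma>. \<sigma> permutes {0..<k}}"
    then have \<sigma>: "\<sigma> i < k" if "i < k" for i using that permutes_in_image[of \<sigma> "{0..<k}" i] by auto
    have "(\<Prod>i = 0..<k. \<Sum>f\<in>state_paths (st i) (\<sigma> i). path_weight q f) =
        (\<Sum>D\<in>(\<Pi>\<^sub>E i\<in>{0..<k}. state_paths (st i) (\<sigma> i)). \<Prod>i = 0..<k. path_weight q (D i))"
      by (rule prod_sum_PiE) (auto intro: fin)
    then show "signof \<sigma> * (\<Sum>D\<in>(\<Pi>\<^sub>E i\<in>{0..<k}. state_paths (st i) (\<sigma> i)).
          if True then \<Prod>i = 0..<k. path_weight q (D i) else 0) =
        signof \<sigma> * (\<Prod>i = 0..<k.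
          mat k k (\<lambda>(i, j). \<Sum>f\<in>state_paths (st i) j. path_weight q f) $$ (i, \<sigma> i))"
      using \<sigma> by simp
  qed
qed

text \<open>The determinant formula of Lindstrom, Gessel and Viennot. Instead of exchanging tails of
  crossing paths, both sides are expanded along the first step of a path that starts earliest:
  they satisfy the same recursion. If two paths come to start at the same vertex, the determinant
  has two equal rows, and no family is disjoint.\<close>

lemma signed_family_sum_disjoint:
  assumes nz: "\<And>i a u. i < k \<Longrightarrow> st i = Inl (a, u) \<Longrightarrow> u \<noteq> 0"
    and bd: "\<And>j. j < k \<Longrightarrow> b j \<le> T"
  shows "signed_family_sum (pairwise_disjoint k) st =
    signed_family_sum (\<lambda>_. True) st"
  using nz
proof (induction "\<Sum>i<k. case st i of Inl (a, u) \<Rightarrow> nat (T + 1 - a) | Inr _ \<Rightarrow> 0" arbitrary: st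
    rule: less_induct)
  case less
  let ?N = "\<lambda>st. signed_family_sum (pairwise_disjoint k) st"
  let ?F = "\<lambda>st. signed_family_sum (\<lambda>_. True) st"
  define start where "start i = (case st i of Inl (a, u) \<Rightarrow> a | Inr _ \<Rightarrow> T + 1)" for i
  let ?I = "{i. i < k \<and> isl (st i)}"
  consider (fin) "?I = {}" | (same) i j a u where "i < k" "j < k" "i \<noteq> j" "st i = Inl (a, u)" "st j = Inl (a, u)"
    | (step) "?I \<noteq> {}" "\<And>i j a u. \<lbrakk>i < k; j < k; i \<noteq> j; st i = Inl (a, u)\<rbrakk> \<Longrightarrow> st j \<noteq> Inl (a, u)"
    by blast
  then show ?case
  proof cases
    case fin
    have Inr: "\<exists>m. st i = Inr m" if "i < k" for i using fin that by (cases "st i") auto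
    have "pairwise_disjoint k D" if D: "D \<in> state_families st \<sigma>" for D \<sigma>
    proof -
      have "D i = (\<lambda>_. 0)" if i: "i < k" for i
      proof -
        obtain m where "st i = Inr m" using Inr[OF i] by blast
        moreover have "D i \<in> state_paths (st i) (\<sigma> i)" using D i by auto
        ultimately show ?thesis by (simp split: if_splits)
      qed
      then show ?thesis by (simp add: pairwise_disjoint_def disjoint_paths_def)
    qed
    then show ?thesis unfolding signed_family_sum_def by (auto intro!: sum.cong arg_cong2[of _ _ _ _ "(*)"])
  next
    case same
    let ?M = "mat k k (\<lambda>(i, j). \<Sum>f\<in>state_paths (st i) j. path_weight q f)"
    have "det ?M = 0"
      by (rule det_identical_rows[of _ k i j]) (use same in \<open>auto intro!: eq_vecI\<close>)
    then have "?F st = 0" using signed_family_sum_eq_det[OF less.prems] by simp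
    moreover have "\<not> pairwise_disjoint k D" if "D \<in> state_families st \<sigma>" for D \<sigma>
    proof -
      have "D i \<in> state_paths (st i) (\<sigma> i)" "D j \<in> state_paths (st j) (\<sigma> j)"
        using that same(1,2) by auto
      then have "D i a = u" "D j a = u" using same(4,5) by (auto dest: layered_pathsD(2))
      moreover have "u \<noteq> 0" using less.prems same by auto
      ultimately show ?thesis using same(1-3) by (auto simp: pairwise_disjoint_def disjoint_paths_def)
    qed
    then have "?N st = 0" unfolding signed_family_sum_def by (auto intro!: sum.neutral)
    ultimately show ?thesis by simp
  next
    case step
    \<comment> \<open>No other path can reach the first vertex of a path that starts earliest.\<close>
    obtain i where i: "i < k" "isl (st i)" and least: "\<And>j. j < k \<Longrightarrow> isl (st j) \<Longrightarrow> start i \<le> start j"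
    proof -
      have fin: "finite (start ` ?I)" by simp
      then have "Min (start ` ?I) \<in> start ` ?I" using step(1) by (intro Min_in) auto
      then obtain i where i: "i \<in> ?I" "start i = Min (start ` ?I)" by auto
      have "start i \<le> start j" if "j < k" "isl (st j)" for j
        unfolding i(2) using that by (intro Min_le[OF fin]) auto
      then show ?thesis using that i(1) by blast
    qed
    obtain a u where st: "st i = Inl (a, u)" using i(2) by (cases "st i") auto
    have u: "u \<noteq> 0" using less.prems i(1) st by auto
    show ?thesis
    proof (cases "a \<le> T")
      case False
      have "state_paths (st i) (\<sigma> i) = {}" if "\<sigma> permutes {..<k}" for \<sigma>
        using st bd[of "\<sigma> i"] False permutes_in_image[OF that, of i] i(1) by (force simp: layered_paths_def)
      then have "state_families st \<sigma> = {}" if "\<sigma> permutes {..<k}" for \<sigma>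
        using that i(1) by (auto simp: PiE_eq_empty_iff)
      then show ?thesis unfolding signed_family_sum_def by (auto intro!: sum.cong)
    next
      case True
      have IH: "?N (st(i := y)) = ?F (st(i := y))" if y: "y \<in> next_states a u" for y
      proof (rule less.hyps)
        have "(case y of Inl (a, u) \<Rightarrow> nat (T + 1 - a) | Inr _ \<Rightarrow> 0) < nat (T + 1 - a)"
          using y True by (auto simp: next_states_def)
        then show "(\<Sum>j<k. case (st(i := y)) j of Inl (a, u) \<Rightarrow> nat (T + 1 - a) | Inr _ \<Rightarrow> 0)
            < (\<Sum>j<k. case st j of Inl (a, u) \<Rightarrow> nat (T + 1 - a) | Inr _ \<Rightarrow> 0)"
          using i(1) st by (intro sum_strict_mono_ex1) auto
        show "u' \<noteq> 0" if "j < k" "(st(i := y)) j = Inl (a', u')" for j a' u'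
          using that y S_nonzero less.prems by (auto simp: next_states_def split: if_splits)
      qed
      have ok: "pairwise_disjoint k (D(i := (D i)(a := u))) = pairwise_disjoint k D"
        if y: "y \<in> next_states a u"
          and D: "D \<in> state_families (st(i := y)) \<sigma>" for y D \<sigma>
      proof -
        have Di: "D i a = 0" using PiE_mem[OF D, of i] i(1) by (intro state_paths_before[OF y, of _ "\<sigma> i"]) simp
        have Dj: "D j a \<noteq> u" if j: "j < k" "j \<noteq> i" for j
        proof (cases "st j")
          case (Inl z)
          obtain a' u' where z: "z = (a', u')" by force
          have P: "D j \<in> layered_paths S a' u' (b (\<sigma> j)) (v (\<sigma> j))"
            using PiE_mem[OF D, of j] j Inl z by simp
          have "a \<le> a'" using least[OF j(1)] Inl z st by (simp add: start_def)
          then show ?thesis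
            using layered_pathsD(2,4)[OF P] step(2)[OF i(1) j(1) _ st] Inl z j(2) u
            by (cases "a = a'") auto
        next
          case (Inr m)
          then show ?thesis using PiE_mem[OF D, of j] j u by (auto split: if_splits)
        qed
        have "disjoint_paths ((D i)(a := u)) (D j) = disjoint_paths (D i) (D j)"
          "disjoint_paths (D j) ((D i)(a := u)) = disjoint_paths (D j) (D i)" if "j < k" "j \<noteq> i" for j
          using Di Dj[OF that] unfolding disjoint_paths_def by (metis fun_upd_apply)+
        then show ?thesis unfolding pairwise_disjoint_def by (auto simp: fun_upd_apply)
      qed
      have "?N st = q u * (\<Sum>y\<in>next_states a u. ?N (st(i := y)))"
        by (rule signed_family_sum_first_step) (use i st u ok in auto)
      also have "\<dots> = q u * (\<Sum>y\<in>next_states a u. ?F (st(i := y)))"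
        by (simp add: IH)
      also have "\<dots> = ?F st"
        by (rule signed_family_sum_first_step[symmetric]) (use i st u in auto)
      finally show ?thesis .
    qed
  qed
qed

lemma lindstrom_gessel_viennot:
  assumes "\<And>i. i < k \<Longrightarrow> u i \<noteq> 0"
  shows "det (mat k k (\<lambda>(i, j). \<Sum>f\<in>layered_paths S (a i) (u i) (b j) (v j). path_weight q f)) =
    (\<Sum>\<sigma> | \<sigma> permutes {..<k}. signof \<sigma> *
        (\<Sum>D\<in>(\<Pi>\<^sub>E i\<in>{..<k}. layered_paths S (a i) (u i) (b (\<sigma> i)) (v (\<sigma> i))).
           if pairwise_disjoint k D then \<Prod>i<k. path_weight q (D i) else 0))"
proof -
  define st where "st i = (Inl (a i, u i) :: state)" for i
  define T where "T = Max (insert 0 (b ` {..<k}))"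
  have "b j \<le> T" if "j < k" for j unfolding T_def using that by (intro Max_ge) auto
  then have "signed_family_sum (pairwise_disjoint k) st =
      signed_family_sum (\<lambda>_. True) st"
    by (intro signed_family_sum_disjoint) (use assms in \<open>auto simp: st_def\<close>)
  also have "\<dots> = det (mat k k (\<lambda>(i, j). \<Sum>f\<in>state_paths (st i) j. path_weight q f))"
    by (rule signed_family_sum_eq_det) (use assms in \<open>auto simp: st_def\<close>)
  finally show ?thesis by (simp add: signed_family_sum_def st_def)
qed

end

section \<open>Delannoy and Dyck paths in a Young diagram\<close>

text \<open>A path is a function on the contents \<open>j - i\<close> of the cells: every step raises the content
  by one. The value \<open>2 * r\<close> at content \<open>c\<close> stands for the cell \<open>(r, r + c)\<close>, and \<open>0\<close> is the value
  outside of the path. An odd value \<open>2 * r - 1\<close> is the middle of a diagonal step from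
  \<open>(r, r + c - 1)\<close> to \<open>(r - 1, r + c)\<close>, which replaces either the valley \<open>(r, r + c)\<close> or the peak
  \<open>(r - 1, r + c - 1)\<close>. Diagonal steps are allowed only if the valley belongs to the diagram; then
  so does the peak.\<close>

definition half_step :: "int \<Rightarrow> int \<Rightarrow> bool" where
  "half_step x y \<longleftrightarrow> y = x - 1 \<or> even x \<and> (y = x \<or> y = x - 2)"

definition peaks :: "path \<Rightarrow> int set" where
  "peaks f = {c. f c \<noteq> 0 \<and> f (c - 1) = f c + 2 \<and> f (c + 1) = f c}"

definition valleys :: "path \<Rightarrow> int set" where
  "valleys f = {c. f c \<noteq> 0 \<and> f (c + 1) \<noteq> 0 \<and> f (c - 1) = f c \<and> f (c + 1) = f c - 2}"

definition weight :: "path \<Rightarrow> int" where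
  "weight = path_weight (\<lambda>x. if even x then 2 else -1)"

text \<open>The number of sets of cells of a Dyck path that contain all its valleys.\<close>

definition dyck_weight :: "path \<Rightarrow> int" where
  "dyck_weight f = 2 ^ (card (supp f) - card (valleys f))"

locale young_diagram =
  fixes Y :: "cell set"
  assumes finite_Y: "finite Y"
    and pos_Y: "(i, j) \<in> Y \<Longrightarrow> 1 \<le> i \<and> 1 \<le> j"
    and down_Y: "(i, j) \<in> Y \<Longrightarrow> 1 \<le> i' \<Longrightarrow> i' \<le> i \<Longrightarrow> 1 \<le> j' \<Longrightarrow> j' \<le> j \<Longrightarrow> (i', j') \<in> Y"
begin

definition vertex :: "int \<Rightarrow> int \<Rightarrow> bool" where
  "vertex c x \<longleftrightarrow> 0 < x \<and> ((x + 1) div 2, (x + 1) div 2 + c) \<in> Y"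

definition delannoy_paths :: "int \<Rightarrow> int \<Rightarrow> int \<Rightarrow> int \<Rightarrow> path set" where
  "delannoy_paths a u b v = {f. a \<le> b \<and> f a = u \<and> f b = v \<and> even u \<and> even v \<and>
     (\<forall>c. f c \<noteq> 0 \<longleftrightarrow> a \<le> c \<and> c \<le> b) \<and> (\<forall>c. a \<le> c \<and> c \<le> b \<longrightarrow> vertex c (f c)) \<and>
     (\<forall>c. a \<le> c \<and> c < b \<longrightarrow> half_step (f c) (f (c + 1)))}"

definition dyck_paths :: "int \<Rightarrow> int \<Rightarrow> int \<Rightarrow> int \<Rightarrow> path set" where
  "dyck_paths a u b v = {f \<in> delannoy_paths a u b v. \<forall>c. even (f c)}"

definition high_peaks :: "path \<Rightarrow> int set" where
  "high_peaks f = {c \<in> peaks f. vertex c (f c + 2)}"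

text \<open>The lowest vertex of a diagonal.\<close>

definition rim :: "int \<Rightarrow> int \<Rightarrow> bool" where
  "rim c x \<longleftrightarrow> vertex c x \<and> even x \<and> \<not> vertex c (x + 1)"

lemma vertex_pos: "vertex c x \<Longrightarrow> 0 < x"
  by (simp add: vertex_def)

lemma vertex_even: "vertex c (2 * r) \<longleftrightarrow> (r, r + c) \<in> Y"
  using pos_Y[of r "r + c"] by (auto simp: vertex_def)

lemma vertex_between:
  assumes "vertex c x" "vertex c z" "x \<le> y" "y \<le> z"
  shows "vertex c y"
proof -
  have 1: "((z + 1) div 2, (z + 1) div 2 + c) \<in> Y" "((x + 1) div 2, (x + 1) div 2 + c) \<in> Y" "0 < x"
    using assms by (auto simp: vertex_def)
  have 2: "(x + 1) div 2 \<le> (y + 1) div 2" "(y + 1) div 2 \<le> (z + 1) div 2" using assms(3,4) by auto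
  have "((y + 1) div 2, (y + 1) div 2 + c) \<in> Y"
    by (rule down_Y[OF 1(1)]) (use 2 pos_Y[OF 1(2)] in auto)
  then show ?thesis using 1(3) assms(3) by (simp add: vertex_def)
qed

lemma rim_max:
  assumes "rim c x" "vertex c y"
  shows "y \<le> x"
  using assms vertex_between[of c x y "x + 1"] unfolding rim_def by force

lemma vertex_bounded: "\<exists>N. \<forall>c x. vertex c x \<longrightarrow> x \<le> N"
proof -
  define N where "N = Max (insert 0 (fst ` Y))"
  have N: "fst p \<le> N" if "p \<in> Y" for p unfolding N_def using finite_Y that by (intro Max_ge) auto
  have "x \<le> 2 * N" if "vertex c x" for c x
  proof -
    have "(x + 1) div 2 \<le> N" using that N[of "((x + 1) div 2, (x + 1) div 2 + c)"] by (simp add: vertex_def)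
    then show ?thesis by linarith
  qed
  then show ?thesis by blast
qed

lemma delannoyD:
  assumes "f \<in> delannoy_paths a u b v"
  shows "a \<le> b" "f a = u" "f b = v" "even u" "even v" "f c \<noteq> 0 \<longleftrightarrow> a \<le> c \<and> c \<le> b"
    "a \<le> c \<Longrightarrow> c \<le> b \<Longrightarrow> vertex c (f c)" "a \<le> c \<Longrightarrow> c \<le> b \<Longrightarrow> 0 < f c"
    "a \<le> c \<Longrightarrow> c < b \<Longrightarrow> half_step (f c) (f (c + 1))"
  using assms vertex_pos by (auto simp: delannoy_paths_def)

lemma dyckD:
  assumes "f \<in> dyck_paths a u b v"
  shows "f \<in> delannoy_paths a u b v" "even (f c)"
    "a \<le> c \<Longrightarrow> c < b \<Longrightarrow> f (c + 1) = f c \<or> f (c + 1) = f c - 2"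
proof -
  show 1: "f \<in> delannoy_paths a u b v" and 2: "even (f c)" for c
    using assms by (auto simp: dyck_paths_def)
  show "a \<le> c \<Longrightarrow> c < b \<Longrightarrow> f (c + 1) = f c \<or> f (c + 1) = f c - 2"
    using delannoyD(9)[OF 1, of c] 2[of c] 2[of "c + 1"] by (auto simp: half_step_def)
qed

lemma dyckI:
  assumes "a \<le> b" "f a = u" "f b = v" "\<And>c. even (f c)" "\<And>c. f c \<noteq> 0 \<longleftrightarrow> a \<le> c \<and> c \<le> b"
    "\<And>c. a \<le> c \<Longrightarrow> c \<le> b \<Longrightarrow> vertex c (f c)"
    "\<And>c. a \<le> c \<Longrightarrow> c < b \<Longrightarrow> f (c + 1) = f c \<or> f (c + 1) = f c - 2"
  shows "f \<in> dyck_paths a u b v"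
  unfolding dyck_paths_def delannoy_paths_def half_step_def using assms by auto

lemma supp_delannoy: "f \<in> delannoy_paths a u b v \<Longrightarrow> supp f = {a..b}"
  by (auto simp: supp_def delannoyD(6))

lemma finite_supp_delannoy: "f \<in> delannoy_paths a u b v \<Longrightarrow> finite (supp f)"
  by (simp add: supp_delannoy)

lemma delannoy_pos: "f \<in> delannoy_paths a u b v \<Longrightarrow> f c \<noteq> 0 \<Longrightarrow> 0 < f c"
  using delannoyD(6,8) by blast

lemma delannoy_vertex: "f \<in> delannoy_paths a u b v \<Longrightarrow> f c \<noteq> 0 \<Longrightarrow> vertex c (f c)"
  using delannoyD(6,7) by blast

lemma delannoy_nonneg: "f \<in> delannoy_paths a u b v \<Longrightarrow> 0 \<le> f c"
  using delannoy_pos[of f a u b v c] by linarith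

lemma delannoy_odd:
  assumes f: "f \<in> delannoy_paths a u b v" and odd: "odd (f c)"
  shows "a < c" "c < b" "f (c - 1) = f c + 1" "f (c + 1) = f c - 1"
    "even (f (c - 1))" "even (f (c + 1))" "f (c - 1) \<noteq> 0" "f (c + 1) \<noteq> 0"
proof -
  note D = delannoyD[OF f]
  have c: "a \<le> c" "c \<le> b" using D(6)[of c] odd by auto
  show ab: "a < c" "c < b" using c D(2-5) odd by (metis order_le_less)+
  show 1: "f (c - 1) = f c + 1"
    using D(9)[of "c - 1"] ab odd by (auto simp: half_step_def)
  show 2: "f (c + 1) = f c - 1"
    using D(9)[of c] ab odd by (auto simp: half_step_def)
  show "even (f (c - 1))" "even (f (c + 1))" using 1 2 odd by auto
  show "f (c - 1) \<noteq> 0" "f (c + 1) \<noteq> 0" using D(6)[of "c - 1"] D(6)[of "c + 1"] ab by auto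
qed

lemma delannoy_odd_step:
  assumes f: "f \<in> delannoy_paths a u b v" and c: "f c \<noteq> 0" "f (c + 1) \<noteq> 0"
  shows "f (c + 1) \<le> f c" "f c - 2 \<le> f (c + 1)" "odd (f c) \<Longrightarrow> f (c + 1) = f c - 1"
proof -
  note D = delannoyD[OF f]
  have "half_step (f c) (f (c + 1))" using D(6)[of c] D(6)[of "c + 1"] c D(9)[of c] by auto
  then show "f (c + 1) \<le> f c" "f c - 2 \<le> f (c + 1)" "odd (f c) \<Longrightarrow> f (c + 1) = f c - 1"
    by (auto simp: half_step_def)
qed

text \<open>To change sides, two paths would have to meet: a step lowers the position by at most two, and
  by exactly one if it is odd.\<close>

lemma delannoy_noncrossing_forward:
  assumes f: "f \<in> delannoy_paths a u b v" and g: "g \<in> delannoy_paths a' u' b' v'"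
    and dj: "disjoint_paths f g" and c: "f c < g c" "f c \<noteq> 0" and "c \<le> c'" "f c' \<noteq> 0" "g c' \<noteq> 0"
  shows "f c' < g c'"
  using \<open>c \<le> c'\<close> \<open>f c' \<noteq> 0\<close> \<open>g c' \<noteq> 0\<close>
proof (induction c' rule: int_ge_induct)
  case base
  then show ?case using c by simp
next
  case (step d)
  have gc: "g c \<noteq> 0" using c delannoy_pos[OF f, of c] by linarith
  have d: "f d \<noteq> 0" "g d \<noteq> 0"
    using step(1,3,4) c(2) gc delannoyD(6)[OF f, of d] delannoyD(6)[OF f, of c] delannoyD(6)[OF f, of "d + 1"]
      delannoyD(6)[OF g, of d] delannoyD(6)[OF g, of c] delannoyD(6)[OF g, of "d + 1"] by auto
  have less: "f d < g d" using step d by auto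
  have "f (d + 1) \<noteq> g (d + 1)" using dj step(3) by (auto simp: disjoint_paths_def)
  moreover have "f (d + 1) \<le> g (d + 1)"
  proof (cases "g d = f d + 1")
    case True
    then show ?thesis
      using delannoy_odd_step[OF f d(1) step(3)] delannoy_odd_step[OF g d(2) step(4)] by (cases "even (f d)") auto
  next
    case False
    then show ?thesis
      using less delannoy_odd_step[OF f d(1) step(3)] delannoy_odd_step[OF g d(2) step(4)] by auto
  qed
  ultimately show ?case by simp
qed

lemma delannoy_noncrossing:
  assumes f: "f \<in> delannoy_paths a u b v" and g: "g \<in> delannoy_paths a' u' b' v'"
    and dj: "disjoint_paths f g" and c: "f c < g c" "f c \<noteq> 0" and c': "f c' \<noteq> 0" "g c' \<noteq> 0"
  shows "f c' < g c'"
proof (cases "c \<le> c'")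
  case True
  then show ?thesis using delannoy_noncrossing_forward[OF f g dj c] c' by simp
next
  case False
  have gc: "g c \<noteq> 0" using c delannoy_pos[OF f, of c] by linarith
  have "\<not> g c' < f c'"
    using delannoy_noncrossing_forward[OF g f, of c' c] dj c gc c' False disjoint_paths_sym by fastforce
  then show ?thesis using dj c' by (force simp: disjoint_paths_def)
qed

text \<open>A path that starts on the rim while another one passes the same diagonal starts below it, and
  stays there. So it cannot be present where the other one reaches the rim at its end.\<close>

lemma disjoint_rim_paths_nested:
  assumes f: "f \<in> delannoy_paths a u b v" and g: "g \<in> delannoy_paths a' u' b' v'"
    and dj: "disjoint_paths f g" and rim: "rim a' u'" "rim b v" and less: "a < a'" "a' \<le> b"
  shows "b' < b" "g c \<noteq> 0 \<Longrightarrow> f c < g c"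
proof -
  have nz: "f a' \<noteq> 0" "g a' \<noteq> 0" "f a' \<noteq> g a'"
    using delannoyD(6)[OF f, of a'] delannoyD(6)[OF g, of a'] delannoyD(1)[OF g] less dj
    by (auto simp: disjoint_paths_def)
  have start: "f a' < g a'"
    using rim_max[OF rim(1) delannoy_vertex[OF f nz(1)]] delannoyD(2)[OF g] nz by auto
  note all = delannoy_noncrossing[OF f g dj start nz(1)]
  show "b' < b"
  proof (rule ccontr)
    assume "\<not> b' < b"
    then have b: "g b \<noteq> 0" "f b \<noteq> 0"
      using delannoyD(1)[OF f] delannoyD(6)[OF g, of b] delannoyD(6)[OF f, of b] less by auto
    then have "f b < g b" using all by blast
    then show False using rim_max[OF rim(2) delannoy_vertex[OF g b(1)]] delannoyD(3)[OF f] by simp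
  qed
  then show "f c < g c" if "g c \<noteq> 0"
    using all[of c] that delannoyD(6)[OF g, of c] delannoyD(6)[OF f, of c] less by auto
qed

lemma disjoint_rim_paths_starts:
  assumes f: "f \<in> delannoy_paths a u b v" and g: "g \<in> delannoy_paths a' u' b' v'"
    and dj: "disjoint_paths f g" and rim: "rim a u" "rim a' u'"
  shows "a \<noteq> a'"
proof
  assume a: "a = a'"
  then have "u = u'" using rim rim_max unfolding rim_def by (metis order.antisym)
  then show False
    using a dj delannoyD(1,2)[OF f] delannoyD(6)[OF f, of a] delannoyD(2)[OF g]
      dj[unfolded disjoint_paths_def, rule_format, of a] by auto
qed

lemma finite_delannoy: "finite (delannoy_paths a u b v)"
proof -
  obtain N where N: "\<And>c x. vertex c x \<Longrightarrow> x \<le> N" using vertex_bounded by blast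
  have "delannoy_paths a u b v \<subseteq> {f. \<forall>c. (c \<in> {a..b} \<longrightarrow> f c \<in> {0..N}) \<and> (c \<notin> {a..b} \<longrightarrow> f c = 0)}"
    using delannoyD(6) N delannoyD(7) delannoy_nonneg by fastforce
  moreover have "finite \<dots>" by (rule finite_set_of_finite_funs) auto
  ultimately show ?thesis by (rule finite_subset)
qed

lemma finite_dyck: "finite (dyck_paths a u b v)"
  by (rule finite_subset[OF _ finite_delannoy[of a u b v]]) (auto simp: dyck_paths_def)

lemma delannoy_eq_layered:
  assumes "even u" "even v" "vertex a u"
  shows "delannoy_paths a u b v = layered_paths (\<lambda>c x. {y. half_step x y \<and> vertex (c + 1) y}) a u b v"
proof (intro equalityI subsetI)
  fix f assume "f \<in> delannoy_paths a u b v"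
  then show "f \<in> layered_paths (\<lambda>c x. {y. half_step x y \<and> vertex (c + 1) y}) a u b v"
    by (auto simp: delannoy_paths_def layered_paths_def)
next
  fix f assume f: "f \<in> layered_paths (\<lambda>c x. {y. half_step x y \<and> vertex (c + 1) y}) a u b v"
  note D = layered_pathsD[OF f]
  have "vertex c (f c)" if "a \<le> c" "c \<le> b" for c
    using D(2) D(5)[of "c - 1"] assms(3) that by (cases "c = a") auto
  then show "f \<in> delannoy_paths a u b v"
    using D assms by (auto simp: delannoy_paths_def)
qed

end

section \<open>Replacing diagonal steps by corners\<close>

definition round_up :: "path \<Rightarrow> path" where
  "round_up f c = (if odd (f c) then f c + 1 else f c)"

definition round_down :: "path \<Rightarrow> path" where
  "round_down f c = (if odd (f c) then f c - 1 else f c)"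

definition odds :: "path \<Rightarrow> int set" where
  "odds f = {c. odd (f c)}"

lemma odd_neq_0: "odd (x::int) \<Longrightarrow> x \<noteq> 0"
  by auto

text \<open>The inverse operations, which replace the valleys or the peaks in \<open>S\<close> by diagonal steps.\<close>

definition dip :: "path \<Rightarrow> int set \<Rightarrow> path" where
  "dip y S c = (if c \<in> S then y c - 1 else y c)"

definition lift :: "path \<Rightarrow> int set \<Rightarrow> path" where
  "lift y S c = (if c \<in> S then y c + 1 else y c)"

lemma dip_odds: "dip (round_up f) (odds f) = f"
  and lift_odds: "lift (round_down f) (odds f) = f"
  by (auto simp: round_up_def round_down_def dip_def lift_def odds_def)

lemma alternating_subset_sum:
  assumes "finite V" "card V \<le> m"
  shows "(\<Sum>S\<in>Pow V. (-1) ^ card S * 2 ^ (m - card S)) = (2::int) ^ (m - card V)"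
  using assms
proof (induction V arbitrary: m rule: finite_induct)
  case empty
  then show ?case by simp
next
  case (insert x V)
  then obtain m' where m: "m = Suc m'" "card V \<le> m'" by (cases m) auto
  have inj: "inj_on (insert x) (Pow V)" using insert(2) by (auto simp: inj_on_def)
  have "(\<Sum>S\<in>insert x ` Pow V. (-1) ^ card S * 2 ^ (m - card S)) =
      (\<Sum>S\<in>Pow V. - ((-1) ^ card S * (2::int) ^ (m' - card S)))"
  proof (subst sum.reindex[OF inj], rule sum.cong)
    fix S assume "S \<in> Pow V"
    then have "card (insert x S) = Suc (card S)"
      using insert(1,2) by (subst card_insert_disjoint) (auto intro: finite_subset)
    then show "((\<lambda>S. (-1) ^ card S * 2 ^ (m - card S)) \<circ> insert x) S = - ((-1) ^ card S * (2::int) ^ (m' - card S))"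
      by (simp add: m)
  qed simp
  also have "\<dots> = - (2 ^ (m' - card V))" by (simp add: sum_negf insert(3)[OF m(2)])
  finally have 1: "(\<Sum>S\<in>insert x ` Pow V. (-1) ^ card S * 2 ^ (m - card S)) = - ((2::int) ^ (m' - card V))" .
  have 2: "(\<Sum>S\<in>Pow V. (-1) ^ card S * 2 ^ (m - card S)) = (2::int) ^ (m - card V)"
    by (rule insert(3)) (use m in simp)
  have "(\<Sum>S\<in>Pow (insert x V). (-1) ^ card S * 2 ^ (m - card S)) = (2::int) ^ (m - card V) - 2 ^ (m' - card V)"
    unfolding Pow_insert using insert(1,2) 1 2 by (subst sum.union_disjoint) auto
  also have "m - card V = Suc (m' - card V)" using m by auto
  finally show ?case using insert(1,2) m by simp
qed

lemma alternating_superset_sum: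
  assumes V: "finite V" "card V \<le> n" and T: "T \<subseteq> V"
  shows "(\<Sum>S | T \<subseteq> S \<and> S \<subseteq> V. (-1) ^ card S * 2 ^ (n - card S)) = (-1) ^ card T * (2::int) ^ (n - card V)"
proof -
  have fT: "finite T" using V T finite_subset by auto
  have cV: "card (V - T) = card V - card T" "card T \<le> card V"
    using card_Diff_subset[OF fT T] card_mono[OF V(1) T] by auto
  have "(\<Sum>S | T \<subseteq> S \<and> S \<subseteq> V. (-1) ^ card S * 2 ^ (n - card S)) =
      (\<Sum>R\<in>Pow (V - T). (-1) ^ card T * ((-1) ^ card R * (2::int) ^ ((n - card T) - card R)))"
  proof (rule sum.reindex_bij_witness[where i = "\<lambda>R. R \<union> T" and j = "\<lambda>S. S - T"])
    fix S assume S: "S \<in> {S. T \<subseteq> S \<and> S \<subseteq> V}"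
    then have "finite S" using V finite_subset by auto
    then have "card S = card T + card (S - T)"
      using card_Diff_subset[OF fT, of S] card_mono[of S T] S by auto
    then show "(-1) ^ card T * ((-1) ^ card (S - T) * (2::int) ^ (n - card T - card (S - T))) =
        (-1) ^ card S * 2 ^ (n - card S)"
      by (simp add: power_add)
  qed (use T in auto)
  also have "\<dots> = (-1) ^ card T * (2::int) ^ (n - card T - card (V - T))"
    by (simp only: sum_distrib_left[symmetric], subst alternating_subset_sum) (use V cV in auto)
  also have "n - card T - card (V - T) = n - card V" using cV by simp
  finally show ?thesis .
qed

lemma card_subset_interval:
  fixes a b :: int
  assumes "S \<subseteq> {a..b}"
  shows "finite S" "card S \<le> card {a..b}"
  using assms finite_subset[of S "{a..b}"] card_mono[of "{a..b}" S] by auto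

context young_diagram
begin

lemma vertex_odd: "odd x \<Longrightarrow> vertex c x \<longleftrightarrow> 0 < x \<and> vertex c (x + 1)"
  by (elim oddE) (auto simp: vertex_def add.commute)

lemma delannoyI:
  assumes "a \<le> b" "f a = u" "f b = v" "even u" "even v" "\<And>c. f c \<noteq> 0 \<longleftrightarrow> a \<le> c \<and> c \<le> b"
    "\<And>c. a \<le> c \<Longrightarrow> c \<le> b \<Longrightarrow> vertex c (f c)"
    "\<And>c. a \<le> c \<Longrightarrow> c < b \<Longrightarrow> half_step (f c) (f (c + 1))"
  shows "f \<in> delannoy_paths a u b v"
  unfolding delannoy_paths_def using assms by auto

lemma round_up_dyck:
  assumes f: "f \<in> delannoy_paths a u b v"
  shows "round_up f \<in> dyck_paths a u b v"
proof (rule dyckI)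
  note D = delannoyD[OF f]
  show "a \<le> b" "round_up f a = u" "round_up f b = v" using D(1-5) by (auto simp: round_up_def)
  show "even (round_up f c)" for c by (simp add: round_up_def)
  show "round_up f c \<noteq> 0 \<longleftrightarrow> a \<le> c \<and> c \<le> b" for c
    using D(6)[of c] delannoy_nonneg[OF f, of c] by (auto simp: round_up_def)
  show "vertex c (round_up f c)" if "a \<le> c" "c \<le> b" for c
    using D(7)[OF that] vertex_odd by (auto simp: round_up_def)
  show "round_up f (c + 1) = round_up f c \<or> round_up f (c + 1) = round_up f c - 2" if "a \<le> c" "c < b" for c
    using D(9)[OF that] delannoy_odd(4)[OF f, of c] by (auto simp: round_up_def half_step_def)
qed

lemma round_down_vertex:
  assumes f: "f \<in> delannoy_paths a u b v" and odd: "odd (f c)"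
  shows "vertex c (f c - 1)"
proof -
  note O = delannoy_odd[OF f odd]
  obtain r where r: "f c = 2 * r + 1" using odd by (elim oddE)
  have "vertex (c - 1) (2 * (r + 1))" "vertex (c + 1) (2 * r)" "vertex c (2 * (r + 1))"
    using delannoy_vertex[OF f O(7)] delannoy_vertex[OF f O(8)] O(3,4) r
      delannoy_vertex[OF f odd_neq_0[OF odd]] odd vertex_odd[OF odd, of c] by (auto simp: algebra_simps)
  then have "(r + 1, r + 1 + (c - 1)) \<in> Y" "(r, r + (c + 1)) \<in> Y" "(r + 1, r + 1 + c) \<in> Y"
    by (simp_all only: vertex_even)
  then have "(r, r + c) \<in> Y" using pos_Y down_Y[of "r + 1" "r + 1 + c" r "r + c"] by force
  then show ?thesis using r vertex_even[of c r] by simp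
qed

lemma round_down_dyck:
  assumes f: "f \<in> delannoy_paths a u b v"
  shows "round_down f \<in> dyck_paths a u b v"
proof (rule dyckI)
  note D = delannoyD[OF f]
  show "a \<le> b" "round_down f a = u" "round_down f b = v" using D(1-5) by (auto simp: round_down_def)
  show "even (round_down f c)" for c by (simp add: round_down_def)
  show "round_down f c \<noteq> 0 \<longleftrightarrow> a \<le> c \<and> c \<le> b" for c
    using D(6)[of c] delannoy_odd(4,8)[OF f, of c] by (auto simp: round_down_def)
  show "vertex c (round_down f c)" if "a \<le> c" "c \<le> b" for c
    using D(7)[OF that] round_down_vertex[OF f] by (auto simp: round_down_def)
  show "round_down f (c + 1) = round_down f c \<or> round_down f (c + 1) = round_down f c - 2" if "a \<le> c" "c < b" for c
    using D(9)[OF that] delannoy_odd(4)[OF f, of c] by (auto simp: round_down_def half_step_def)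
qed

lemma odds_round_up:
  assumes f: "f \<in> delannoy_paths a u b v"
  shows "odds f \<subseteq> valleys (round_up f)"
proof
  fix c assume "c \<in> odds f"
  then have odd: "odd (f c)" by (simp add: odds_def)
  note O = delannoy_odd[OF f odd]
  show "c \<in> valleys (round_up f)"
    using O odd delannoy_nonneg[OF f, of c] by (auto simp: valleys_def round_up_def)
qed

lemma odds_round_down:
  assumes f: "f \<in> delannoy_paths a u b v"
  shows "odds f \<subseteq> high_peaks (round_down f)"
proof
  fix c assume "c \<in> odds f"
  then have odd: "odd (f c)" by (simp add: odds_def)
  note O = delannoy_odd[OF f odd]
  have "vertex c (f c + 1)" using delannoy_vertex[OF f odd_neq_0[OF odd]] odd vertex_odd[OF odd, of c] by auto
  then show "c \<in> high_peaks (round_down f)"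
    using O odd by (auto simp: high_peaks_def peaks_def round_down_def add.commute)
qed

lemma dip_delannoy:
  assumes y: "y \<in> dyck_paths a u b v" and S: "S \<subseteq> valleys y"
  shows "dip y S \<in> delannoy_paths a u b v"
proof (rule delannoyI)
  note D = delannoyD[OF dyckD(1)[OF y]]
  have V: "c \<in> S \<Longrightarrow> y c \<noteq> 0 \<and> y (c - 1) = y c \<and> y (c + 1) = y c - 2 \<and> y (c + 1) \<noteq> 0" for c
    using S by (auto simp: valleys_def)
  have S': "c \<in> S \<Longrightarrow> a < c \<and> c < b" for c
    using V[of c] D(6)[of "c - 1"] D(6)[of "c + 1"] by auto
  have pos: "c \<in> S \<Longrightarrow> 2 < y c" for c
    using V[of c] delannoy_pos[OF dyckD(1)[OF y], of "c + 1"] by auto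
  show "a \<le> b" "dip y S a = u" "dip y S b = v" "even u" "even v"
    using D(1-5) S' by (auto simp: dip_def)
  show "dip y S c \<noteq> 0 \<longleftrightarrow> a \<le> c \<and> c \<le> b" for c
    using D(6)[of c] pos[of c] by (auto simp: dip_def)
  show "vertex c (dip y S c)" if "a \<le> c" "c \<le> b" for c
    using D(7)[OF that] vertex_odd[of "y c - 1" c] dyckD(2)[OF y, of c] pos[of c] by (auto simp: dip_def)
  show "half_step (dip y S c) (dip y S (c + 1))" if "a \<le> c" "c < b" for c
  proof -
    have "c \<in> S \<Longrightarrow> c + 1 \<notin> S" using V[of c] V[of "c + 1"] by auto
    then consider "c \<in> S" "c + 1 \<notin> S" | "c \<notin> S" "c + 1 \<in> S" | "c \<notin> S" "c + 1 \<notin> S" by blast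
    then show ?thesis
    proof cases
      case 1
      then show ?thesis using V[of c] by (simp add: dip_def half_step_def)
    next
      case 2
      then show ?thesis using V[of "c + 1"] dyckD(2)[OF y, of c] by (simp add: dip_def half_step_def)
    next
      case 3
      then show ?thesis using dyckD(3)[OF y that] dyckD(2)[OF y, of c] by (auto simp: dip_def half_step_def)
    qed
  qed
qed

lemma lift_delannoy:
  assumes y: "y \<in> dyck_paths a u b v" and S: "S \<subseteq> high_peaks y"
  shows "lift y S \<in> delannoy_paths a u b v"
proof (rule delannoyI)
  note D = delannoyD[OF dyckD(1)[OF y]]
  have V: "c \<in> S \<Longrightarrow> y c \<noteq> 0 \<and> y (c - 1) = y c + 2 \<and> y (c + 1) = y c \<and> vertex c (y c + 2)" for c
    using S by (auto simp: high_peaks_def peaks_def)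
  have pos: "0 \<le> y c" for c using delannoy_nonneg[OF dyckD(1)[OF y]] .
  have S': "c \<in> S \<Longrightarrow> a < c \<and> c < b" for c
    using V[of c] D(6)[of "c - 1"] D(6)[of "c + 1"] pos[of c] by auto
  show "a \<le> b" "lift y S a = u" "lift y S b = v" "even u" "even v"
    using D(1-5) S' by (auto simp: lift_def)
  show "lift y S c \<noteq> 0 \<longleftrightarrow> a \<le> c \<and> c \<le> b" for c
    using D(6)[of c] pos[of c] V[of c] by (auto simp: lift_def)
  show "vertex c (lift y S c)" if "a \<le> c" "c \<le> b" for c
    using D(7)[OF that] vertex_odd[of "y c + 1" c] dyckD(2)[OF y, of c] V[of c] pos[of c]
    by (auto simp: lift_def add.commute)
  show "half_step (lift y S c) (lift y S (c + 1))" if "a \<le> c" "c < b" for c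
  proof -
    have "c \<in> S \<Longrightarrow> c + 1 \<notin> S" using V[of c] V[of "c + 1"] by auto
    then consider "c \<in> S" "c + 1 \<notin> S" | "c \<notin> S" "c + 1 \<in> S" | "c \<notin> S" "c + 1 \<notin> S" by blast
    then show ?thesis
    proof cases
      case 1
      then show ?thesis using V[of c] by (simp add: lift_def half_step_def)
    next
      case 2
      then show ?thesis using V[of "c + 1"] dyckD(2)[OF y, of c] by (simp add: lift_def half_step_def)
    next
      case 3
      then show ?thesis using dyckD(3)[OF y that] dyckD(2)[OF y, of c] by (auto simp: lift_def half_step_def)
    qed
  qed
qed

lemma odds_dip: "y \<in> dyck_paths a u b v \<Longrightarrow> odds (dip y S) = S"
  and odds_lift: "y \<in> dyck_paths a u b v \<Longrightarrow> odds (lift y S) = S"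
  by (auto simp: odds_def dip_def lift_def dyckD(2))

lemma round_up_dip: "y \<in> dyck_paths a u b v \<Longrightarrow> round_up (dip y S) = y"
  and round_down_lift: "y \<in> dyck_paths a u b v \<Longrightarrow> round_down (lift y S) = y"
  by (auto simp: round_up_def round_down_def dip_def lift_def dyckD(2))

lemma weight_eq:
  assumes f: "f \<in> delannoy_paths a u b v"
  shows "weight f = (-1) ^ card (odds f) * 2 ^ (card {a..b} - card (odds f))"
proof -
  have sub: "odds f \<subseteq> {a..b}" using delannoyD(6)[OF f] by (force simp: odds_def)
  have "weight f = (\<Prod>c\<in>{a..b}. if c \<in> odds f then -1 else 2)"
    unfolding weight_def path_weight_def supp_delannoy[OF f] by (rule prod.cong) (auto simp: odds_def)
  also have "\<dots> = (\<Prod>c\<in>{a..b} \<inter> {c. c \<in> odds f}. -1) * (\<Prod>c\<in>{a..b} \<inter> - {c. c \<in> odds f}. 2)"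
    by (subst prod.If_cases) auto
  also have "{a..b} \<inter> {c. c \<in> odds f} = odds f" using sub by auto
  also have "{a..b} \<inter> - {c. c \<in> odds f} = {a..b} - odds f" by auto
  finally show ?thesis by (simp add: card_Diff_subset[OF finite_subset[OF sub] sub])
qed

lemma valleys_subset: "y \<in> dyck_paths a u b v \<Longrightarrow> valleys y \<subseteq> {a..b}"
  and peaks_subset: "y \<in> dyck_paths a u b v \<Longrightarrow> peaks y \<subseteq> {a..b}"
  using delannoyD(6)[OF dyckD(1)] by (auto simp: valleys_def peaks_def)

text \<open>A Dyck path is the sum of the Delannoy paths that round to it, for both ways of rounding. If
  diagonal steps are prescribed at \<open>T\<close>, each of them contributes a sign, while the other corners
  still cancel a factor 2 each.\<close>

lemma sum_weight_round_up:
  assumes y: "y \<in> dyck_paths a u b v"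
  shows "(\<Sum>f | f \<in> delannoy_paths a u b v \<and> round_up f = y \<and> T \<subseteq> odds f. weight f) =
    (if T \<subseteq> valleys y then (-1) ^ card T * dyck_weight y else 0)"
proof (cases "T \<subseteq> valleys y")
  case True
  have "(\<Sum>f | f \<in> delannoy_paths a u b v \<and> round_up f = y \<and> T \<subseteq> odds f. weight f) =
      (\<Sum>S | T \<subseteq> S \<and> S \<subseteq> valleys y. (-1) ^ card S * 2 ^ (card {a..b} - card S))"
    by (rule sum.reindex_bij_witness[where i = "dip y" and j = odds])
       (use y in \<open>auto simp: dip_odds odds_dip round_up_dip dip_delannoy weight_eq dest: odds_round_up\<close>)
  also have "\<dots> = (-1) ^ card T * dyck_weight y"
    unfolding dyck_weight_def supp_delannoy[OF dyckD(1)[OF y]]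
    by (rule alternating_superset_sum) (use True card_subset_interval[OF valleys_subset[OF y]] in auto)
  finally show ?thesis using True by simp
next
  case False
  then have none: "{f. f \<in> delannoy_paths a u b v \<and> round_up f = y \<and> T \<subseteq> odds f} = {}"
    using odds_round_up by blast
  show ?thesis unfolding none using False by simp
qed

lemma sum_weight_round_down:
  assumes y: "y \<in> dyck_paths a u b v"
  shows "(\<Sum>f | f \<in> delannoy_paths a u b v \<and> round_down f = y \<and> T \<subseteq> odds f. weight f) =
    (if T \<subseteq> high_peaks y then (-1) ^ card T * 2 ^ (card (supp y) - card (high_peaks y)) else 0)"
proof (cases "T \<subseteq> high_peaks y")
  case True
  have hp: "high_peaks y \<subseteq> {a..b}" using peaks_subset[OF y] by (auto simp: high_peaks_def)
  have "(\<Sum>f | f \<in> delannoy_paths a u b v \<and> round_down f = y \<and> T \<subseteq> odds f. weight f) =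
      (\<Sum>S | T \<subseteq> S \<and> S \<subseteq> high_peaks y. (-1) ^ card S * 2 ^ (card {a..b} - card S))"
    by (rule sum.reindex_bij_witness[where i = "lift y" and j = odds])
       (use y in \<open>auto simp: lift_odds odds_lift round_down_lift lift_delannoy weight_eq dest: odds_round_down\<close>)
  also have "\<dots> = (-1) ^ card T * 2 ^ (card (supp y) - card (high_peaks y))"
    unfolding supp_delannoy[OF dyckD(1)[OF y]]
    by (rule alternating_superset_sum) (use True card_subset_interval[OF hp] in auto)
  finally show ?thesis using True by simp
next
  case False
  then have none: "{f. f \<in> delannoy_paths a u b v \<and> round_down f = y \<and> T \<subseteq> odds f} = {}"
    using odds_round_down by blast
  show ?thesis unfolding none using False by simp
qed

lemma sum_dyck_weight: "(\<Sum>y\<in>dyck_paths a u b v. dyck_weight y) = (\<Sum>f\<in>delannoy_paths a u b v. weight f)"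
proof -
  have "(\<Sum>f\<in>delannoy_paths a u b v. weight f) =
      (\<Sum>y\<in>dyck_paths a u b v. \<Sum>f | f \<in> delannoy_paths a u b v \<and> round_up f = y. weight f)"
    using round_up_dyck by (intro sum.group[symmetric] finite_delannoy finite_dyck) auto
  also have "\<dots> = (\<Sum>y\<in>dyck_paths a u b v. dyck_weight y)"
    by (rule sum.cong[OF refl]) (use sum_weight_round_up[where T = "{}"] in simp)
  finally show ?thesis ..
qed

end

section \<open>Pleasant diagrams as unions of disjoint Dyck paths\<close>

lemma card_between:
  assumes "finite U" "V \<subseteq> U"
  shows "card {B. V \<subseteq> B \<and> B \<subseteq> U} = 2 ^ (card U - card V)"
proof -
  have "bij_betw (\<lambda>R. R \<union> V) (Pow (U - V)) {B. V \<subseteq> B \<and> B \<subseteq> U}"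
    by (rule bij_betw_byWitness[where f' = "\<lambda>B. B - V"]) (use assms in auto)
  then have "card {B. V \<subseteq> B \<and> B \<subseteq> U} = card (Pow (U - V))" by (simp add: bij_betw_same_card)
  also have "\<dots> = 2 ^ (card U - card V)"
    using assms finite_subset[OF assms(2,1)] by (simp add: card_Pow card_Diff_subset)
  finally show ?thesis .
qed

context young_diagram
begin

lemma raise_valley_dyck:
  assumes f: "f \<in> dyck_paths a u b v" and c: "c \<in> valleys f"
  shows "f(c := f c - 2) \<in> dyck_paths a u b v"
proof -
  have "f(c := f c - 2) = round_down (dip f {c})"
    using dyckD(2)[OF f] by (auto simp: round_down_def dip_def)
  then show ?thesis using round_down_dyck[OF dip_delannoy[OF f, of "{c}"]] c by simp
qed

lemma lower_peak_dyck:
  assumes f: "f \<in> dyck_paths a u b v" and c: "c \<in> high_peaks f"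
  shows "f(c := f c + 2) \<in> dyck_paths a u b v"
proof -
  have "f(c := f c + 2) = round_up (lift f {c})"
    using dyckD(2)[OF f] by (auto simp: round_up_def lift_def)
  then show ?thesis using round_up_dyck[OF lift_delannoy[OF f, of "{c}"]] c by simp
qed

text \<open>Where one of two Dyck paths with the same ends leaves the other one upwards, it has to come
  down again, and the lower one has to come up.\<close>

lemma crossing_corners:
  assumes f: "f \<in> dyck_paths a u b v" and g: "g \<in> dyck_paths a u b v" and less: "f c < g c"
  shows "\<exists>c\<in>peaks f. f c < g c" "\<exists>c\<in>valleys g. f c < g c"
proof -
  note F = delannoyD[OF dyckD(1)[OF f]] and G = delannoyD[OF dyckD(1)[OF g]]
  define B where "B = {d. f d < g d}"
  have ab: "a < d \<and> d < b" if "d \<in> B" for d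
    using F(2,3) F(6)[of d] G(2,3) G(6)[of d] that by (cases "d = a"; cases "d = b") (auto simp: B_def)
  have steps: "f (d + 1) = f d \<or> f (d + 1) = f d - 2" "g (d + 1) = g d \<or> g (d + 1) = g d - 2"
    if "d \<in> B \<or> d + 1 \<in> B" for d
    using dyckD(3)[OF f, of d] dyckD(3)[OF g, of d] ab[of d] ab[of "d + 1"] that by auto
  have finB: "finite B" by (rule finite_subset[of _ "{a..b}"]) (auto dest: ab)
  have "B \<noteq> {}" using less by (auto simp: B_def)
  then have m: "Min B \<in> B" "Min B - 1 \<notin> B"
    using finB Min_in Min_le[OF finB, of "Min B - 1"] by auto
  have start: "f (Min B - 1) = f (Min B) + 2 \<and> g (Min B - 1) = g (Min B)"
    using steps[of "Min B - 1"] m by (auto simp: B_def)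
  have last: "\<exists>d\<in>B. Q d \<and> \<not> (d + 1 \<in> B \<and> Q (d + 1))" if "Q (Min B)" for Q
  proof -
    let ?M = "Max {d \<in> B. Q d}"
    have fin: "finite {d \<in> B. Q d}" using finB by simp
    have "?M \<in> {d \<in> B. Q d}" using m(1) that by (intro Max_in[OF fin]) auto
    moreover have "?M + 1 \<notin> {d \<in> B. Q d}" using Max_ge[OF fin, of "?M + 1"] by auto
    ultimately show ?thesis by blast
  qed
  obtain d where d: "d \<in> B" "f (d - 1) = f d + 2" "\<not> (d + 1 \<in> B \<and> f d = f (d + 1) + 2)"
    using last[of "\<lambda>d. f (d - 1) = f d + 2"] start by auto
  then have "d \<in> peaks f" using steps[of d] F(6)[of d] ab[of d] by (auto simp: peaks_def B_def)
  then show "\<exists>c\<in>peaks f. f c < g c" using d(1) by (auto simp: B_def)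
  obtain e where e: "e \<in> B" "g (e - 1) = g e" "\<not> (e + 1 \<in> B \<and> g e = g (e + 1))"
    using last[of "\<lambda>d. g (d - 1) = g d"] start by auto
  then have "e \<in> valleys g"
    using steps[of e] G(6)[of e] G(6)[of "e + 1"] ab[of e] by (auto simp: valleys_def B_def)
  then show "\<exists>c\<in>valleys g. f c < g c" using e(1) by (auto simp: B_def)
qed

end

text \<open>A family of disjoint Dyck paths that start at the bottom of a column and end at the end of a
  row, as in the Kreiman decomposition.\<close>

locale rim_family = young_diagram Y for Y +
  fixes k :: nat and a u b v :: "nat \<Rightarrow> int" and L :: "nat \<Rightarrow> path"
  assumes L_dyck: "i < k \<Longrightarrow> L i \<in> dyck_paths (a i) (u i) (b i) (v i)"
    and L_disjoint: "pairwise_disjoint k L"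
    and start_south: "i < k \<Longrightarrow> (u i div 2 + 1, u i div 2 + a i) \<notin> Y"
    and end_east: "i < k \<Longrightarrow> (v i div 2, v i div 2 + b i + 1) \<notin> Y"
begin

abbreviation dyck :: "nat \<Rightarrow> (int \<Rightarrow> int) set" where
  "dyck i \<equiv> dyck_paths (a i) (u i) (b i) (v i)"

abbreviation delannoy :: "nat \<Rightarrow> (int \<Rightarrow> int) set" where
  "delannoy i \<equiv> delannoy_paths (a i) (u i) (b i) (v i)"

definition nest :: "nat \<Rightarrow> nat \<Rightarrow> bool" where
  "nest i j \<longleftrightarrow> a j < a i \<and> b i < b j"

lemma L_delannoy: "i < k \<Longrightarrow> L i \<in> delannoy i"
  using dyckD(1)[OF L_dyck] .

lemma rim_start: "i < k \<Longrightarrow> rim (a i) (u i)"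
proof -
  assume i: "i < k"
  note D = delannoyD[OF L_delannoy[OF i]]
  obtain r where r: "u i = 2 * r" using D(4) by (elim evenE)
  have v: "vertex (a i) (2 * r)" using D(1,2) D(7)[of "a i"] r by auto
  then have Y: "(r, r + a i) \<in> Y" by (simp add: vertex_even)
  have "(r + 1, r + 1 + a i) \<notin> Y"
    using start_south[OF i] r pos_Y[OF Y] down_Y[of "r + 1" "r + 1 + a i" "r + 1" "r + a i"] by auto
  then have "\<not> vertex (a i) (2 * r + 1)" by (simp add: vertex_def add.commute)
  then show ?thesis using v r by (simp add: rim_def)
qed

lemma rim_end: "i < k \<Longrightarrow> rim (b i) (v i)"
proof -
  assume i: "i < k"
  note D = delannoyD[OF L_delannoy[OF i]]
  obtain r where r: "v i = 2 * r" using D(5) by (elim evenE)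
  have v: "vertex (b i) (2 * r)" using D(1,3) D(7)[of "b i"] r by auto
  then have Y: "(r, r + b i) \<in> Y" by (simp add: vertex_even)
  have "(r + 1, r + 1 + b i) \<notin> Y"
    using end_east[OF i] r pos_Y[OF Y] down_Y[of "r + 1" "r + 1 + b i" r "r + b i + 1"] by auto
  then have "\<not> vertex (b i) (2 * r + 1)" by (simp add: vertex_def add.commute)
  then show ?thesis using v r by (simp add: rim_def)
qed

lemma a_le_b: "i < k \<Longrightarrow> a i \<le> b i"
  using delannoyD(1)[OF L_delannoy] .

lemma disjoint_nested:
  assumes ij: "i < k" "j < k" and f: "f \<in> delannoy i" and g: "g \<in> delannoy j"
    and dj: "disjoint_paths f g" and c: "f c \<noteq> 0" "g c \<noteq> 0"
  shows "nest i j \<and> g c < f c \<or> nest j i \<and> f c < g c"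
proof -
  have ab: "a i \<le> c" "c \<le> b i" "a j \<le> c" "c \<le> b j"
    using c delannoyD(6)[OF f] delannoyD(6)[OF g] by auto
  have dj': "disjoint_paths g f" using dj disjoint_paths_sym by blast
  have "a i \<noteq> a j" by (rule disjoint_rim_paths_starts[OF f g dj rim_start[OF ij(1)] rim_start[OF ij(2)]])
  then consider "a i < a j" | "a j < a i" by linarith
  then show ?thesis
  proof cases
    case 1
    then show ?thesis
      using disjoint_rim_paths_nested[OF f g dj rim_start[OF ij(2)] rim_end[OF ij(1)]] ab c
      by (auto simp: nest_def)
  next
    case 2
    then show ?thesis
      using disjoint_rim_paths_nested[OF g f dj' rim_start[OF ij(1)] rim_end[OF ij(2)]] ab c
      by (auto simp: nest_def)
  qed
qed

lemma L_nested:
  assumes "i < k" "j < k" "i \<noteq> j" "L i c \<noteq> 0" "L j c \<noteq> 0"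
  shows "nest i j \<and> L j c < L i c \<or> nest j i \<and> L i c < L j c"
  using disjoint_nested[OF assms(1,2) L_delannoy[OF assms(1)] L_delannoy[OF assms(2)] _ assms(4,5)]
    assms(1-3) L_disjoint by (simp add: pairwise_disjoint_def)

lemma laminar:
  assumes "i < k" "j < k" "i \<noteq> j" "a i \<le> c" "c \<le> b i" "a j \<le> c" "c \<le> b j"
  shows "nest i j \<or> nest j i"
  using L_nested[OF assms(1-3), of c] assms delannoyD(6)[OF L_delannoy] by auto

lemma nest_trans: "nest i j \<Longrightarrow> nest j l \<Longrightarrow> nest i l"
  by (auto simp: nest_def)

lemma nest_irrefl: "\<not> nest i i"
  by (auto simp: nest_def)

lemma nest_asym: "nest i j \<Longrightarrow> \<not> nest j i"
  by (auto simp: nest_def)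

lemma nest_length: "i < k \<Longrightarrow> nest i j \<Longrightarrow> nat (b i - a i) < nat (b j - a j)"
  using a_le_b[of i] by (auto simp: nest_def)

text \<open>Disjointness is a condition on nested pairs only: without nesting, two paths do not even have
  a diagonal in common.\<close>

lemma disjoint_iff_nested_below:
  assumes "\<And>i. i < k \<Longrightarrow> D i \<in> delannoy i"
  shows "pairwise_disjoint k D \<longleftrightarrow>
    (\<forall>i<k. \<forall>j<k. nest i j \<longrightarrow> (\<forall>c. D i c \<noteq> 0 \<longrightarrow> D j c < D i c))" (is "?l \<longleftrightarrow> ?r")
proof
  assume l: ?l
  show ?r
  proof (intro allI impI)
    fix i j c assume *: "i < k" "j < k" "nest i j" "D i c \<noteq> 0"
    then have "D j c \<noteq> 0"
      using delannoyD(6)[OF assms[of i]] delannoyD(6)[OF assms[of j]] by (auto simp: nest_def)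
    moreover have "disjoint_paths (D i) (D j)" using l * nest_irrefl by (auto simp: pairwise_disjoint_def)
    ultimately show "D j c < D i c"
      using disjoint_nested[OF *(1,2) assms assms _ *(4)] * nest_asym by blast
  qed
next
  assume r: ?r
  show ?l unfolding pairwise_disjoint_def disjoint_paths_def
  proof (intro allI impI)
    fix i j c assume *: "i < k" "j < k" "i \<noteq> j" "D i c = D j c"
    show "D i c = 0"
    proof (rule ccontr)
      assume nz: "D i c \<noteq> 0"
      then have "nest i j \<or> nest j i"
        using laminar[OF *(1-3), of c] delannoyD(6)[OF assms[OF *(1)], of c]
          delannoyD(6)[OF assms[OF *(2)], of c] *(4) by metis
      then show False using r * nz by fastforce
    qed
  qed
qed

definition families :: "(nat \<Rightarrow> path) set" where
  "families = {D \<in> (\<Pi>\<^sub>E i\<in>{..<k}. dyck i). pairwise_disjoint k D}"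

definition path_cells :: "(nat \<Rightarrow> path) \<Rightarrow> cell set" where
  "path_cells D = {(p, q). 0 < p \<and> (\<exists>i<k. D i (q - p) = 2 * p)}"

definition valley_cells :: "(nat \<Rightarrow> path) \<Rightarrow> cell set" where
  "valley_cells D = {(p, q). 0 < p \<and> (\<exists>i<k. D i (q - p) = 2 * p \<and> q - p \<in> valleys (D i))}"

text \<open>Rows are counted from the top, so raising a path decreases the depth.\<close>

definition depth :: "(nat \<Rightarrow> path) \<Rightarrow> int" where
  "depth D = (\<Sum>i<k. \<Sum>c=a i..b i. D i c)"

lemma familiesD:
  assumes "D \<in> families" "i < k"
  shows "D i \<in> dyck i" "D i \<in> delannoy i"
  using assms dyckD(1) by (auto simp: families_def PiE_iff)

lemma families_disjoint:
  assumes "D \<in> families" "i < k" "j < k" "D i c = D j c" "D i c \<noteq> 0"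
  shows "i = j"
  using assms by (auto simp: families_def pairwise_disjoint_def disjoint_paths_def)

lemma families_nested:
  assumes "D \<in> families" "i < k" "j < k" "i \<noteq> j" "D i c \<noteq> 0" "D j c \<noteq> 0"
  shows "nest i j \<and> D j c < D i c \<or> nest j i \<and> D i c < D j c"
  using disjoint_nested[OF assms(2,3) familiesD(2)[OF assms(1,2)] familiesD(2)[OF assms(1,3)] _ assms(5,6)]
    assms(1-4) by (auto simp: families_def pairwise_disjoint_def)

lemma families_below:
  assumes "D \<in> families" "i < k" "j < k" "nest i j" "D i c \<noteq> 0"
  shows "D j c < D i c"
proof -
  have "\<And>i. i < k \<Longrightarrow> D i \<in> delannoy i" using familiesD(2)[OF assms(1)] .
  moreover have "pairwise_disjoint k D" using assms(1) by (simp add: families_def)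
  ultimately show ?thesis using disjoint_iff_nested_below[of D] assms by blast
qed

lemma finite_families: "finite families"
proof (rule finite_subset)
  show "families \<subseteq> (\<Pi>\<^sub>E i\<in>{..<k}. dyck i)" by (auto simp: families_def)
  show "finite (\<Pi>\<^sub>E i\<in>{..<k}. dyck i)" by (rule finite_PiE) (auto intro: finite_dyck)
qed

lemma depth_less:
  assumes "\<And>i c. i < k \<Longrightarrow> D' i c \<le> D i c" "i < k" "D' i c < D i c" "D \<in> families" "D i c \<noteq> 0"
  shows "depth D' < depth D"
proof -
  have c: "c \<in> {a i..b i}" using delannoyD(6)[OF familiesD(2)[OF assms(4,2)]] assms(5) by auto
  have "(\<Sum>c=a i..b i. D' i c) < (\<Sum>c=a i..b i. D i c)"
    by (rule sum_strict_mono_ex1) (use assms c in auto)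
  moreover have "(\<Sum>c=a j..b j. D' j c) \<le> (\<Sum>c=a j..b j. D j c)" if "j < k" for j
    by (rule sum_mono) (use assms that in auto)
  ultimately show ?thesis unfolding depth_def using assms(2) by (intro sum_strict_mono_ex1) auto
qed

lemma families_upd:
  assumes D: "D \<in> families" and i: "i < k" and f: "f \<in> dyck i"
    and free: "\<And>j c. j < k \<Longrightarrow> j \<noteq> i \<Longrightarrow> f c = D j c \<Longrightarrow> f c = 0"
  shows "D(i := f) \<in> families"
  unfolding families_def mem_Collect_eq pairwise_disjoint_def disjoint_paths_def
proof (intro conjI allI impI)
  show "D(i := f) \<in> (\<Pi>\<^sub>E i\<in>{..<k}. dyck i)"
    using D i f by (auto simp: families_def PiE_iff extensional_def)
  fix j l c assume *: "j < k" "l < k" "j \<noteq> l" "(D(i := f)) j c = (D(i := f)) l c"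
  show "(D(i := f)) j c = 0"
    using * free[of l c] free[of j c] families_disjoint[OF D *(1,2), of c] by (auto split: if_splits)
qed

lemma path_cells_iff: "(p, q) \<in> path_cells D \<longleftrightarrow> 0 < p \<and> (\<exists>i<k. D i (q - p) = 2 * p)"
  by (simp add: path_cells_def)

lemma path_cells_Y:
  assumes "D \<in> families"
  shows "path_cells D \<subseteq> Y"
proof
  fix x assume "x \<in> path_cells D"
  then obtain p q i where x: "x = (p, q)" "0 < p" "i < k" "D i (q - p) = 2 * p"
    by (auto simp: path_cells_def)
  then have "vertex (q - p) (2 * p)"
    using delannoy_vertex[OF familiesD(2)[OF assms x(3)], of "q - p"] by simp
  then show "x \<in> Y" using x by (simp add: vertex_even)
qed

lemma path_cells_move:
  assumes D: "D \<in> families" and i: "i < k" "D i c = 2 * p" "0 < p" and p': "0 < p'" "p' \<noteq> p"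
  shows "path_cells (D(i := (D i)(c := 2 * p'))) = insert (p', p' + c) (path_cells D - {(p, p + c)})"
proof -
  have uniq: "j = i" if "j < k" "D j c = 2 * p" for j
    using families_disjoint[OF D that(1) i(1), of c] that i by auto
  have "(x, y) \<in> path_cells (D(i := (D i)(c := 2 * p'))) \<longleftrightarrow>
      (x, y) \<in> insert (p', p' + c) (path_cells D - {(p, p + c)})" for x y
  proof (cases "y - x = c")
    case False
    then have "(x, y) \<in> path_cells (D(i := (D i)(c := 2 * p'))) \<longleftrightarrow> (x, y) \<in> path_cells D"
      unfolding path_cells_iff by (metis fun_upd_apply)
    then show ?thesis using False by auto
  next
    case True
    have "(x, y) \<in> path_cells (D(i := (D i)(c := 2 * p'))) \<longleftrightarrow> 0 < x \<and> (x = p' \<or> (\<exists>j<k. j \<noteq> i \<and> D j c = 2 * x))"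
      unfolding path_cells_iff True using i by (auto split: if_splits)
    also have "(\<exists>j<k. j \<noteq> i \<and> D j c = 2 * x) \<longleftrightarrow> x \<noteq> p \<and> (\<exists>j<k. D j c = 2 * x)"
    proof (cases "x = p")
      case True
      then show ?thesis using uniq by auto
    next
      case False
      then have "D i c \<noteq> 2 * x" using i by simp
      then show ?thesis using False by auto
    qed
    finally show ?thesis using True p' by (auto simp: path_cells_iff)
  qed
  then show ?thesis by auto
qed

text \<open>The three cells around the cell that is moved lie on one path: a path cannot end at a cell that has
  a right neighbor, nor start at one that has a lower neighbor. They form a valley, which the
  excited move raises.\<close>

lemma excited_move_raises_valley:
  assumes D: "D \<in> families" and move: "excited_move Y (Y - path_cells D) Z"
  shows "\<exists>D'\<in>families. Z = Y - path_cells D'"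
proof -
  obtain p q where *: "(p, q) \<in> Y" "(p, q) \<notin> path_cells D"
    "(p + 1, q) \<notin> Y - path_cells D" "(p, q + 1) \<notin> Y - path_cells D" "(p + 1, q + 1) \<notin> Y - path_cells D"
    "(p + 1, q + 1) \<in> Y" "Z = insert (p + 1, q + 1) (Y - path_cells D - {(p, q)})"
    using move unfolding excited_move_def by blast
  have pq: "1 \<le> p" "1 \<le> q" using pos_Y[OF *(1)] by auto
  have "(p + 1, q) \<in> Y" "(p, q + 1) \<in> Y" using down_Y[OF *(6)] pq by auto
  then have cov: "(p + 1, q) \<in> path_cells D" "(p, q + 1) \<in> path_cells D" "(p + 1, q + 1) \<in> path_cells D"
    using * by auto
  define c where "c = q - p"
  obtain i where i: "i < k" "D i c = 2 * (p + 1)" using cov(3) by (auto simp: path_cells_iff c_def)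
  obtain l where l: "l < k" "D l (c - 1) = 2 * (p + 1)" using cov(1) by (auto simp: path_cells_iff c_def algebra_simps)
  obtain r where r: "r < k" "D r (c + 1) = 2 * p" using cov(2) by (auto simp: path_cells_iff c_def algebra_simps)
  have free: "D j c \<noteq> 2 * p" if "j < k" for j using *(2) that pq by (auto simp: path_cells_iff c_def)
  note Dl = delannoyD[OF familiesD(2)[OF D l(1)]] and Dr = delannoyD[OF familiesD(2)[OF D r(1)]]
  have li: "l = i"
  proof -
    have "c - 1 \<noteq> b l"
    proof
      assume "c - 1 = b l"
      then have "v l = 2 * (p + 1)" using Dl(3) l by simp
      then show False using end_east[OF l(1)] *(6) \<open>c - 1 = b l\<close> by (simp add: c_def algebra_simps)
    qed
    moreover have "a l \<le> c - 1" "c - 1 \<le> b l" using Dl(6)[of "c - 1"] l(2) pq by auto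
    ultimately have "D l c = 2 * (p + 1) \<or> D l c = 2 * (p + 1) - 2"
      using dyckD(3)[OF familiesD(1)[OF D l(1)], of "c - 1"] l(2) by auto
    then have "D l c = D i c" using free[OF l(1)] i(2) by auto
    then show ?thesis using families_disjoint[OF D l(1) i(1), of c] i(2) pq by auto
  qed
  have ri: "r = i"
  proof -
    have "c + 1 \<noteq> a r"
    proof
      assume "c + 1 = a r"
      then have "u r = 2 * p" using Dr(2) r by simp
      then show False using start_south[OF r(1)] *(6) \<open>c + 1 = a r\<close>
        by (simp add: c_def algebra_simps)
    qed
    moreover have "a r \<le> c + 1" "c + 1 \<le> b r" using Dr(6)[of "c + 1"] r(2) pq by auto
    ultimately have "D r c = 2 * p \<or> D r c = 2 * p + 2"
      using dyckD(3)[OF familiesD(1)[OF D r(1)], of c] r(2) by auto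
    then have "D r c = D i c" using free[OF r(1)] i(2) by auto
    then show ?thesis using families_disjoint[OF D r(1) i(1), of c] i(2) pq by auto
  qed
  have V: "c \<in> valleys (D i)" using i l r li ri pq by (auto simp: valleys_def)
  define D' where "D' = D(i := (D i)(c := D i c - 2))"
  have new: "((D i)(c := D i c - 2)) c = 2 * p" using i by simp
  have D': "D' \<in> families" unfolding D'_def
  proof (rule families_upd[OF D i(1) raise_valley_dyck[OF familiesD(1)[OF D i(1)] V]])
    fix j d assume "j < k" "j \<noteq> i" "((D i)(c := D i c - 2)) d = D j d"
    then show "((D i)(c := D i c - 2)) d = 0"
      using free[of j] i families_disjoint[OF D i(1), of j d] by (auto split: if_splits)
  qed
  have "path_cells D' = insert (p, q) (path_cells D - {(p + 1, q + 1)})"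
    using path_cells_move[OF D i, of p] i(2) pq by (simp add: D'_def c_def algebra_simps)
  then have "Z = Y - path_cells D'" using * by auto
  then show ?thesis using D' by blast
qed

lemma excited_move_lower_peak:
  assumes D: "D \<in> families" and i: "i < k" and c: "c \<in> high_peaks (D i)"
    and free: "\<And>j. j < k \<Longrightarrow> D j c \<noteq> D i c + 2"
  defines "D' \<equiv> D(i := (D i)(c := D i c + 2))"
  shows "D' \<in> families" "excited_move Y (Y - path_cells D') (Y - path_cells D)"
proof -
  have P: "D i c \<noteq> 0" "D i (c - 1) = D i c + 2" "D i (c + 1) = D i c" "vertex c (D i c + 2)"
    using c by (auto simp: high_peaks_def peaks_def)
  obtain p where p: "D i c = 2 * p" using dyckD(2)[OF familiesD(1)[OF D i], of c] by (elim evenE)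
  have p0: "0 < p" using delannoy_pos[OF familiesD(2)[OF D i] P(1)] p by simp
  define q where "q = p + c"
  show D': "D' \<in> families" unfolding D'_def
  proof (rule families_upd[OF D i lower_peak_dyck[OF familiesD(1)[OF D i] c]])
    fix j d assume "j < k" "j \<noteq> i" "((D i)(c := D i c + 2)) d = D j d"
    then show "((D i)(c := D i c + 2)) d = 0"
      using free[of j] families_disjoint[OF D i, of j d] by (auto split: if_splits)
  qed
  have Yq: "(p + 1, q + 1) \<in> Y" using P(4) p vertex_even[of c "p + 1"] by (simp add: q_def algebra_simps)
  have Y0: "(p, q) \<in> Y" using delannoy_vertex[OF familiesD(2)[OF D i] P(1)] p vertex_even[of c p] by (simp add: q_def)
  have "path_cells D' = insert (p + 1, q + 1) (path_cells D - {(p, q)})"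
    using path_cells_move[OF D i p p0, of "p + 1"] p p0 by (simp add: D'_def q_def algebra_simps)
  moreover have "(p + 1, q) \<in> path_cells D" "(p, q + 1) \<in> path_cells D" "(p, q) \<in> path_cells D"
    "(p + 1, q + 1) \<notin> path_cells D"
    using i P p p0 free by (auto simp: path_cells_iff q_def algebra_simps intro!: exI[of _ i])
  ultimately have "(p, q) \<in> Y - path_cells D'" "(p + 1, q) \<notin> Y - path_cells D'" "(p, q + 1) \<notin> Y - path_cells D'"
     "(p + 1, q + 1) \<notin> Y - path_cells D'"
     "Y - path_cells D = insert (p + 1, q + 1) (Y - path_cells D' - {(p, q)})"
    using Y0 Yq by auto
  then show "excited_move Y (Y - path_cells D') (Y - path_cells D)"
    unfolding excited_move_def using Yq by blast
qed

text \<open>A family in which no peak can be lowered.\<close>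

definition lowest :: "(nat \<Rightarrow> path) \<Rightarrow> bool" where
  "lowest D \<longleftrightarrow> (\<forall>i<k. \<forall>c\<in>high_peaks (D i). \<exists>j<k. D j c = D i c + 2)"

text \<open>If another family reached below it, it would do so at a peak, which is blocked by a path
  nested inside; the other family would then reach below that path as well, and so on forever.\<close>

lemma lowest_max:
  assumes D: "D \<in> families" "lowest D" and E: "E \<in> families" and "i < k"
  shows "E i c \<le> D i c"
  using \<open>i < k\<close>
proof (induction "nat (b i - a i)" arbitrary: i c rule: less_induct)
  case less
  show ?case
  proof (rule ccontr)
    assume "\<not> E i c \<le> D i c"
    then obtain d where d: "d \<in> peaks (D i)" "D i d < E i d"
      using crossing_corners(1)[OF familiesD(1)[OF D(1) less(2)] familiesD(1)[OF E less(2)], of c] by auto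
    have nz: "D i d \<noteq> 0" "0 < D i d"
      using d(1) delannoy_pos[OF familiesD(2)[OF D(1) less(2)]] by (auto simp: peaks_def)
    have "even (D i d)" "even (E i d)"
      using dyckD(2) familiesD(1) D(1) E less(2) by blast+
    then have two: "D i d + 2 \<le> E i d" using d(2) by presburger
    have "vertex d (E i d)" using delannoy_vertex[OF familiesD(2)[OF E less(2)]] d(2) nz by auto
    then have "vertex d (D i d + 2)"
      using vertex_between[OF delannoy_vertex[OF familiesD(2)[OF D(1) less(2)] nz(1)]] two by auto
    then have "d \<in> high_peaks (D i)" using d(1) by (simp add: high_peaks_def)
    then obtain j where j: "j < k" "D j d = D i d + 2" using D(2) less(2) by (auto simp: lowest_def)
    have "j \<noteq> i" using j(2) by auto
    then have ji: "nest j i" using families_nested[OF D(1) j(1) less(2), of d] j nz by auto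
    have "E j d \<noteq> 0"
      using delannoyD(6)[OF familiesD(2)[OF E j(1)], of d] delannoyD(6)[OF familiesD(2)[OF D(1) j(1)], of d] j nz by auto
    then have "E i d < E j d" using families_below[OF E j(1) less(2) ji] by blast
    moreover have "E j d \<le> D j d" using less(1)[OF nest_length[OF j(1) ji] j(1)] .
    ultimately show False using j two by simp
  qed
qed

lemma families_extensional: "D \<in> families \<Longrightarrow> E \<in> families \<Longrightarrow> (\<And>i. i < k \<Longrightarrow> D i = E i) \<Longrightarrow> D = E"
  unfolding families_def by (auto intro: PiE_ext)

lemma lowest_unique:
  assumes "D \<in> families" "lowest D" "E \<in> families" "lowest E"
  shows "D = E"
  using lowest_max[OF assms(1,2,3)] lowest_max[OF assms(3,4,1)]
  by (intro families_extensional assms(1,3) ext order.antisym) auto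

text \<open>Lowering peaks as long as possible ends in the lowest family, and every such step is an excited
  move read backwards.\<close>

lemma lowest_reaches_all:
  assumes D: "D \<in> families" "lowest D" and E: "E \<in> families"
  shows "(excited_move Y)\<^sup>*\<^sup>* (Y - path_cells D) (Y - path_cells E)"
proof -
  define N where "N = Max (depth ` families)"
  have N: "depth E \<le> N" if "E \<in> families" for E
    unfolding N_def using that finite_families by (intro Max_ge) auto
  show ?thesis using E
  proof (induction "nat (N - depth E)" arbitrary: E rule: less_induct)
    case less
    show ?case
    proof (cases "lowest E")
      case True
      then show ?thesis using lowest_unique[OF D less(2)] by simp
    next
      case False
      then obtain i c where i: "i < k" "c \<in> high_peaks (E i)" and free: "\<And>j. j < k \<Longrightarrow> E j c \<noteq> E i c + 2"
        unfolding lowest_def by blast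
      define E' where "E' = E(i := (E i)(c := E i c + 2))"
      have E': "E' \<in> families" "excited_move Y (Y - path_cells E') (Y - path_cells E)"
        using excited_move_lower_peak[OF less(2) i free] unfolding E'_def by blast+
      have nz: "0 < E i c"
        using i delannoy_pos[OF familiesD(2)[OF less(2) i(1)]] by (auto simp: high_peaks_def peaks_def)
      have "depth E < depth E'"
        by (rule depth_less[OF _ i(1) _ E'(1), of _ c]) (use nz in \<open>auto simp: E'_def\<close>)
      then have "nat (N - depth E') < nat (N - depth E)" using N[OF E'(1)] by linarith
      from less(1)[OF this E'(1)] show ?thesis using E'(2) by (rule rtranclp.rtrancl_into_rtrancl)
    qed
  qed
qed

lemma excited_diagrams_eq:
  assumes D: "D \<in> families" "lowest D"
  shows "excited_diagrams Y (Y - path_cells D) = (\<lambda>E. Y - path_cells E) ` families"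
proof (intro equalityI subsetI)
  fix Z assume "Z \<in> excited_diagrams Y (Y - path_cells D)"
  then have "(excited_move Y)\<^sup>*\<^sup>* (Y - path_cells D) Z" by (simp add: excited_diagrams_def)
  then show "Z \<in> (\<lambda>E. Y - path_cells E) ` families"
  proof (induction rule: rtranclp_induct)
    case base
    then show ?case using D(1) by blast
  next
    case (step Z Z')
    then show ?case using excited_move_raises_valley by blast
  qed
next
  fix Z assume "Z \<in> (\<lambda>E. Y - path_cells E) ` families"
  then show "Z \<in> excited_diagrams Y (Y - path_cells D)"
    using lowest_reaches_all[OF D] by (auto simp: excited_diagrams_def)
qed

text \<open>A set of cells that is covered by a family is covered by exactly one family whose valleys it
  contains: the highest one. A valley of another such family, strictly below the first, would
  be a cell of a path that is nested inside.\<close>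

lemma highest_unique_aux:
  assumes D: "D \<in> families" "B \<subseteq> path_cells D" and E: "E \<in> families" "valley_cells E \<subseteq> B" and "i < k"
  shows "E i c \<le> D i c"
  using \<open>i < k\<close>
proof (induction "nat (b i - a i)" arbitrary: i c rule: less_induct)
  case less
  show ?case
  proof (rule ccontr)
    assume "\<not> E i c \<le> D i c"
    then obtain d where d: "d \<in> valleys (E i)" "D i d < E i d"
      using crossing_corners(2)[OF familiesD(1)[OF D(1) less(2)] familiesD(1)[OF E(1) less(2)], of c] by auto
    have nz: "E i d \<noteq> 0" using d(1) by (auto simp: valleys_def)
    then have pos: "0 < E i d" using delannoy_pos[OF familiesD(2)[OF E(1) less(2)]] by blast
    obtain p where p: "E i d = 2 * p" using dyckD(2)[OF familiesD(1)[OF E(1) less(2)], of d] by (elim evenE)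
    have "(p, p + d) \<in> valley_cells E"
      using p pos less(2) d(1) by (auto simp: valley_cells_def)
    then have "(p, p + d) \<in> path_cells D" using D(2) E(2) by blast
    then obtain j where j: "j < k" "D j d = E i d" using p by (auto simp: path_cells_iff)
    have "j \<noteq> i" using j(2) d(2) by auto
    moreover have "D i d \<noteq> 0"
      using delannoyD(6)[OF familiesD(2)[OF D(1) less(2)], of d]
        delannoyD(6)[OF familiesD(2)[OF E(1) less(2)], of d] nz by auto
    ultimately have ji: "nest j i" using families_nested[OF D(1) j(1) less(2), of d] j nz d(2) by auto
    have "E j d \<noteq> 0"
      using delannoyD(6)[OF familiesD(2)[OF E(1) j(1)], of d]
        delannoyD(6)[OF familiesD(2)[OF D(1) j(1)], of d] j nz by auto
    then have "E i d < E j d" using families_below[OF E(1) j(1) less(2) ji] by blast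
    moreover have "E j d \<le> D j d" using less(1)[OF nest_length[OF j(1) ji] j(1)] .
    ultimately show False using j by simp
  qed
qed

lemma highest_unique:
  assumes "D \<in> families" "valley_cells D \<subseteq> B" "B \<subseteq> path_cells D"
    and "E \<in> families" "valley_cells E \<subseteq> B" "B \<subseteq> path_cells E"
  shows "D = E"
  using highest_unique_aux[OF assms(1,3,4,5)] highest_unique_aux[OF assms(4,6,1,2)]
  by (intro families_extensional assms(1,4) ext order.antisym) auto

text \<open>If a valley is not in the set, it can be raised. Paths directly above it are raised as well:
  each of them has a valley there, and each takes over the cell that the one above it leaves, so
  that only the original valley ceases to be covered.\<close>

lemma raise_uncovered_valley:
  assumes D: "D \<in> families" "B \<subseteq> path_cells D" and nv: "\<not> valley_cells D \<subseteq> B"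
  shows "\<exists>D'\<in>families. B \<subseteq> path_cells D' \<and> depth D' < depth D"
proof -
  obtain r q i where i: "i < k" "D i (q - r) = 2 * r" "q - r \<in> valleys (D i)" "0 < r" "(r, q) \<notin> B"
    using nv unfolding valley_cells_def by blast
  define c where "c = q - r"
  have ic: "D i c = 2 * r" "c \<in> valleys (D i)" using i by (auto simp: c_def)
  \<comment> \<open>The paths at the first \<open>m\<close> places of the diagonal, counted upwards from the valley, are raised;
    the next place is free.\<close>
  define used where "used x \<longleftrightarrow> (\<exists>j<k. D j c = x \<and> x \<noteq> 0)" for x
  define m where "m = (LEAST m. \<not> used (2 * r - 2 * int m))"
  have "\<not> used (2 * r - 2 * int (nat r))" using i(4) by (simp add: used_def)
  then have m: "\<not> used (2 * r - 2 * int m)" unfolding m_def by (rule LeastI)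
  have below_m: "used (2 * r - 2 * int s)" if "s < m" for s
    using not_less_Least[of s "\<lambda>m. \<not> used (2 * r - 2 * int m)"] that by (auto simp: m_def)
  have valley: "c \<in> valleys (D j)" if "s < m" "j < k" "D j c = 2 * r - 2 * int s" for s j
    using that
  proof (induction s arbitrary: j)
    case 0
    then have "j = i" using families_disjoint[OF D(1) _ i(1), of j c] ic i(4) by simp
    then show ?case using ic by simp
  next
    case (Suc s)
    obtain l where l: "l < k" "D l c = 2 * r - 2 * int s" "D l c \<noteq> 0"
      using below_m[of s] Suc(2) by (auto simp: used_def)
    have Vl: "c \<in> valleys (D l)" using Suc(1)[of l] l Suc(2) by simp
    have nz: "D j c \<noteq> 0" using below_m[OF Suc(2)] Suc(4) by (auto simp: used_def)
    have "j \<noteq> l" using l(2) Suc(4) by auto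
    then have lj: "nest l j" using families_nested[OF D(1) l(1) Suc(3), of c] l nz Suc(4) by auto
    have V: "D l (c - 1) = D l c" "D l (c + 1) = D l c - 2" "D l (c + 1) \<noteq> 0"
      using Vl by (auto simp: valleys_def)
    have less: "D j (c - 1) < D l (c - 1)" "D j (c + 1) < D l (c + 1)"
      using families_below[OF D(1) l(1) Suc(3) lj, of "c - 1"]
        families_below[OF D(1) l(1) Suc(3) lj, of "c + 1"] V l(3) by simp_all
    have "a l \<le> c - 1" "c + 1 \<le> b l"
      using delannoyD(6)[OF familiesD(2)[OF D(1) l(1)], of "c - 1"]
        delannoyD(6)[OF familiesD(2)[OF D(1) l(1)], of "c + 1"] V l(3) by auto
    then have ab: "a j \<le> c - 1" "c - 1 < b j" "a j \<le> c" "c < b j" "c + 1 \<le> b j"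
      using lj by (auto simp: nest_def)
    have "D j (c - 1) = D j c"
      using dyckD(3)[OF familiesD(1)[OF D(1) Suc(3)] ab(1,2)] less(1) V(1) l(2) Suc(4) by auto
    moreover have "D j (c + 1) = D j c - 2"
      using dyckD(3)[OF familiesD(1)[OF D(1) Suc(3)] ab(3,4)] less(2) V(2) l(2) Suc(4) by auto
    moreover have "D j (c + 1) \<noteq> 0"
      using delannoyD(6)[OF familiesD(2)[OF D(1) Suc(3)], of "c + 1"] ab by auto
    ultimately show ?case using nz by (simp add: valleys_def)
  qed
  define J where "J = {j. j < k \<and> (\<exists>s<m. D j c = 2 * r - 2 * int s)}"
  define D' where "D' j = (if j \<in> J then (D j)(c := D j c - 2) else D j)" for j
  have J: "c \<in> valleys (D j)" if "j \<in> J" for j using that valley by (auto simp: J_def)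
  have Jpos: "D j c \<noteq> 0" "D j c \<noteq> 2" if "j \<in> J" for j
    using J[OF that] by (auto simp: valleys_def)
  have next_J: "l \<in> J" if "j \<in> J" "l < k" "D l c = D j c - 2" for j l
  proof -
    from that(1) obtain s where s: "s < m" "D j c = 2 * r - 2 * int s" unfolding J_def by blast
    then have l: "D l c = 2 * r - 2 * int (Suc s)" using that(3) by simp
    then have "used (2 * r - 2 * int (Suc s))"
      using that(2) Jpos(2)[OF that(1)] that(3) by (auto simp: used_def)
    then have "Suc s \<noteq> m" using m by auto
    then show ?thesis using l that(2) s(1) by (auto simp: J_def intro!: exI[of _ "Suc s"])
  qed
  have D': "D' \<in> families"
    unfolding families_def mem_Collect_eq pairwise_disjoint_def disjoint_paths_def
  proof (intro conjI allI impI)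
    have "D' j \<in> dyck j" if "j < k" for j
      using raise_valley_dyck[OF familiesD(1)[OF D(1) that] J[of j]] familiesD(1)[OF D(1) that]
      by (simp add: D'_def)
    moreover have "D' j = undefined" if "\<not> j < k" for j
      using D(1) that by (auto simp: D'_def J_def families_def PiE_iff extensional_def)
    ultimately show "D' \<in> (\<Pi>\<^sub>E i\<in>{..<k}. dyck i)" by (auto simp: PiE_iff extensional_def)
    fix j l d assume *: "j < k" "l < k" "j \<noteq> l" "D' j d = D' l d"
    show "D' j d = 0"
    proof (cases "d = c \<and> (j \<in> J \<or> l \<in> J)")
      case False
      then have "D' j d = D j d" "D' l d = D l d" by (auto simp: D'_def)
      then show ?thesis using families_disjoint[OF D(1) *(1,2), of d] * by auto
    next
      case True
      then consider "j \<in> J" "l \<in> J" "d = c" | "j \<in> J" "l \<notin> J" "d = c" | "j \<notin> J" "l \<in> J" "d = c" by blast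
      then show ?thesis
      proof cases
        case 1
        then have "D j c = D l c" using * by (simp add: D'_def)
        then show ?thesis using families_disjoint[OF D(1) *(1,2)] * Jpos(1)[OF 1(1)] by auto
      next
        case 2
        then show ?thesis using next_J[OF 2(1) *(2)] * by (simp add: D'_def)
      next
        case 3
        then show ?thesis using next_J[OF 3(2) *(1)] * by (simp add: D'_def)
      qed
    qed
  qed
  have "B \<subseteq> path_cells D'"
  proof
    fix x assume x: "x \<in> B"
    obtain p' q' where pq: "x = (p', q')" by force
    then obtain j where j: "0 < p'" "j < k" "D j (q' - p') = 2 * p'"
      using subsetD[OF D(2) x] by (auto simp: path_cells_iff)
    show "x \<in> path_cells D'"
    proof (cases "q' - p' = c \<and> j \<in> J")
      case False
      then have "D' j (q' - p') = 2 * p'" using j by (auto simp: D'_def)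
      then show ?thesis using j pq by (auto simp: path_cells_iff)
    next
      case True
      then obtain s where s: "s < m" "D j c = 2 * r - 2 * int s" unfolding J_def by blast
      have "s \<noteq> 0"
      proof
        assume "s = 0"
        then have "p' = r" "q' = q" using s j True by (auto simp: c_def)
        then show False using x pq i(5) by simp
      qed
      then obtain s' where s': "s = Suc s'" by (cases s) auto
      obtain l where l: "l < k" "D l c = 2 * r - 2 * int s'"
        using below_m[of s'] s s' by (auto simp: used_def)
      then have "l \<in> J" using s s' by (auto simp: J_def intro!: exI[of _ s'])
      then have "D' l (q' - p') = 2 * p'" using True l s s' j by (simp add: D'_def)
      then show ?thesis using j(1) l(1) pq by (auto simp: path_cells_iff)
    qed
  qed
  moreover have "depth D' < depth D"
  proof (rule depth_less[OF _ i(1) _ D(1), of _ c])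
    have "0 < m"
    proof (rule ccontr)
      assume "\<not> 0 < m"
      then show False using m i(1,4) ic by (auto simp: used_def)
    qed
    then have "i \<in> J" using i(1) ic by (auto simp: J_def intro!: exI[of _ 0])
    then show "D' i c < D i c" by (simp add: D'_def)
  qed (use ic i in \<open>auto simp: D'_def\<close>)
  ultimately show ?thesis using D' by blast
qed

lemma highest_exists:
  assumes "D \<in> families" "B \<subseteq> path_cells D"
  shows "\<exists>E\<in>families. valley_cells E \<subseteq> B \<and> B \<subseteq> path_cells E"
  using assms
proof (induction "nat (depth D)" arbitrary: D rule: less_induct)
  case less
  show ?case
  proof (cases "valley_cells D \<subseteq> B")
    case False
    obtain D' where D': "D' \<in> families" "B \<subseteq> path_cells D'" "depth D' < depth D"
      using raise_uncovered_valley[OF less(2,3) False] by blast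
    have "0 \<le> depth D'" unfolding depth_def
      by (intro sum_nonneg) (use delannoy_nonneg[OF familiesD(2)[OF D'(1)]] in auto)
    then have "nat (depth D') < nat (depth D)" using D'(3) by simp
    then show ?thesis using less(1) D'(1,2) by blast
  qed (use less in blast)
qed

lemma card_cells:
  assumes D: "D \<in> families" and S: "\<And>i. i < k \<Longrightarrow> S i \<subseteq> supp (D i)"
  shows "card {(p, q). 0 < p \<and> (\<exists>i<k. D i (q - p) = 2 * p \<and> q - p \<in> S i)} = (\<Sum>i<k. card (S i))"
    and "finite {(p, q). 0 < p \<and> (\<exists>i<k. D i (q - p) = 2 * p \<and> q - p \<in> S i)}"
proof -
  let ?f = "\<lambda>(i, c). (D i c div 2, D i c div 2 + c)"
  have fin: "finite (S i)" if "i < k" for i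
    using finite_subset[OF S[OF that] finite_supp_delannoy[OF familiesD(2)[OF D that]]] .
  have ev: "D i c = 2 * (D i c div 2)" if "i < k" for i c
    using dyckD(2)[OF familiesD(1)[OF D that], of c] by simp
  have bij: "bij_betw ?f (Sigma {..<k} S) {(p, q). 0 < p \<and> (\<exists>i<k. D i (q - p) = 2 * p \<and> q - p \<in> S i)}"
    unfolding bij_betw_def
  proof
    show "inj_on ?f (Sigma {..<k} S)"
    proof (rule inj_onI)
      fix x y assume xy: "x \<in> Sigma {..<k} S" "y \<in> Sigma {..<k} S" "?f x = ?f y"
      obtain i c j d where *: "x = (i, c)" "y = (j, d)" by force
      have ij: "i < k" "c \<in> S i" "j < k" "d \<in> S j" using xy * by auto
      have eq: "D i c div 2 = D j d div 2" "c = d" using xy(3) * by auto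
      then have "D i c = D j c" using ev[OF ij(1), of c] ev[OF ij(3), of c] by simp
      moreover have "D i c \<noteq> 0" using S[OF ij(1)] ij(2) by (auto simp: supp_def)
      ultimately show "x = y" using families_disjoint[OF D ij(1,3)] eq * by blast
    qed
    show "?f ` Sigma {..<k} S = {(p, q). 0 < p \<and> (\<exists>i<k. D i (q - p) = 2 * p \<and> q - p \<in> S i)}" (is "?l = ?r")
    proof (intro equalityI subsetI)
      fix x assume "x \<in> ?l"
      then obtain i c where ic: "i < k" "c \<in> S i" "x = (D i c div 2, D i c div 2 + c)" by auto
      have "D i c \<noteq> 0" using S[OF ic(1)] ic(2) by (auto simp: supp_def)
      then have "0 < D i c" using delannoy_pos[OF familiesD(2)[OF D ic(1)]] by blast
      then show "x \<in> ?r" using ic ev[OF ic(1), of c] by auto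
    next
      fix x assume "x \<in> ?r"
      then obtain p q i where *: "x = (p, q)" "i < k" "D i (q - p) = 2 * p" "q - p \<in> S i" by auto
      then have "x = ?f (i, q - p)" by simp
      then show "x \<in> ?l" using * by blast
    qed
  qed
  show "card {(p, q). 0 < p \<and> (\<exists>i<k. D i (q - p) = 2 * p \<and> q - p \<in> S i)} = (\<Sum>i<k. card (S i))"
    using bij_betw_same_card[OF bij] fin by simp
  show "finite {(p, q). 0 < p \<and> (\<exists>i<k. D i (q - p) = 2 * p \<and> q - p \<in> S i)}"
    using bij_betw_finite[OF bij] fin by auto
qed

lemma num_pleasant_eq_families:
  assumes D: "D \<in> families" "lowest D"
  shows "int (num_pleasant Y (Y - path_cells D)) = (\<Sum>E\<in>families. \<Prod>i<k. dyck_weight (E i))"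
proof -
  define X where "X E = {B. valley_cells E \<subseteq> B \<and> B \<subseteq> path_cells E}" for E
  have P: "pleasant_diagrams Y (Y - path_cells D) = (\<Union>E\<in>families. X E)"
  proof (intro equalityI subsetI)
    fix B assume "B \<in> pleasant_diagrams Y (Y - path_cells D)"
    then obtain E where "E \<in> families" "B \<subseteq> path_cells E"
      unfolding pleasant_diagrams_def excited_diagrams_eq[OF D] by auto
    then obtain F where "F \<in> families" "valley_cells F \<subseteq> B" "B \<subseteq> path_cells F"
      using highest_exists by blast
    then show "B \<in> (\<Union>E\<in>families. X E)" by (auto simp: X_def)
  next
    fix B assume "B \<in> (\<Union>E\<in>families. X E)"
    then obtain E where E: "E \<in> families" "B \<subseteq> path_cells E" by (auto simp: X_def)
    then have "B \<subseteq> Y - (Y - path_cells E)" using path_cells_Y[OF E(1)] by auto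
    then show "B \<in> pleasant_diagrams Y (Y - path_cells D)"
      unfolding pleasant_diagrams_def excited_diagrams_eq[OF D] using E(1) by auto
  qed
  have card_X: "finite (X E) \<and> int (card (X E)) = (\<Prod>i<k. dyck_weight (E i))" if E: "E \<in> families" for E
  proof -
    have pc: "path_cells E = {(p, q). 0 < p \<and> (\<exists>i<k. E i (q - p) = 2 * p \<and> q - p \<in> supp (E i))}"
      by (auto simp: path_cells_def supp_def)
    have V: "valleys (E i) \<subseteq> supp (E i)" for i by (auto simp: valleys_def supp_def)
    have sub: "valley_cells E \<subseteq> path_cells E" by (auto simp: valley_cells_def path_cells_def)
    note cU = card_cells[OF E, of "\<lambda>i. supp (E i)", folded pc]
    note cV = card_cells[OF E, of "\<lambda>i. valleys (E i)", OF V, folded valley_cells_def]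
    have le: "card (valleys (E i)) \<le> card (supp (E i))" if "i < k" for i
      using card_mono[OF finite_supp_delannoy[OF familiesD(2)[OF E that]] V] .
    have "card (X E) = 2 ^ (card (path_cells E) - card (valley_cells E))"
      unfolding X_def by (rule card_between) (use cU sub in auto)
    also have "card (path_cells E) - card (valley_cells E) =
        (\<Sum>i<k. card (supp (E i)) - card (valleys (E i)))"
    proof -
      have "(\<Sum>i<k. card (supp (E i)) - card (valleys (E i))) =
          (\<Sum>i<k. card (supp (E i))) - (\<Sum>i<k. card (valleys (E i)))"
        by (rule sum_subtractf_nat) (use le in auto)
      then show ?thesis using cU(1) cV(1) by simp
    qed
    finally have "int (card (X E)) = (\<Prod>i<k. dyck_weight (E i))"
      by (simp add: dyck_weight_def power_sum)
    moreover have "finite (X E)" unfolding X_def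
      by (rule finite_subset[of _ "Pow (path_cells E)"]) (use cU in auto)
    ultimately show ?thesis by blast
  qed
  have "card (\<Union>E\<in>families. X E) = (\<Sum>E\<in>families. card (X E))"
  proof (rule card_UN_disjoint[OF finite_families])
    show "\<forall>E\<in>families. finite (X E)" using card_X by blast
    show "\<forall>E\<in>families. \<forall>F\<in>families. E \<noteq> F \<longrightarrow> X E \<inter> X F = {}"
      unfolding X_def using highest_unique by blast
  qed
  then show ?thesis unfolding num_pleasant_def P using card_X by simp
qed

end

section \<open>Strict and weak nesting of two paths\<close>

definition strictly_above :: "path \<Rightarrow> path \<Rightarrow> bool" where
  "strictly_above y x \<longleftrightarrow> (\<forall>c. x c \<noteq> 0 \<longrightarrow> y c < x c)"

definition touch :: "path \<Rightarrow> path \<Rightarrow> int set" where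
  "touch y x = {c. x c \<noteq> 0 \<and> y c = x c}"

text \<open>What is left of strict nesting of two paths after the diagonal steps of one of them have been
  turned into corners.\<close>

definition weakly_above :: "path \<Rightarrow> path \<Rightarrow> bool" where
  "weakly_above y x \<longleftrightarrow> (\<forall>c. x c \<noteq> 0 \<longrightarrow> y c \<le> x c) \<and> touch y x \<subseteq> peaks x \<inter> valleys y"

lemma strictly_aboveD: "strictly_above y x \<Longrightarrow> x c \<noteq> 0 \<Longrightarrow> y c < x c"
  by (simp add: strictly_above_def)

lemma sum_telescope_int:
  fixes r :: "int \<Rightarrow> int"
  assumes "a \<le> b"
  shows "(\<Sum>c\<in>{a<..b}. r c - r (c - 1)) = r b - r a"
  using assms
proof (induction b rule: int_ge_induct)
  case base
  then show ?case by simp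
next
  case (step b)
  have "{a<..b + 1} = insert (b + 1) {a<..b}" using step(1) by auto
  then show ?case using step by simp
qed

context young_diagram
begin

text \<open>Peaks and valleys alternate, and the path begins and ends on the side of a peak.\<close>

lemma card_peaks_valleys:
  assumes y: "y \<in> dyck_paths a u b v" and ab: "a < b"
    and first: "y (a + 1) = u - 2" and last: "y (b - 1) = v"
  shows "card (peaks y) = card (valleys y) + 1"
proof -
  note D = delannoyD[OF dyckD(1)[OF y]]
  define r where "r c = (if y (c + 1) = y c then 1 else 0 :: int)" for c
  have sub: "peaks y \<subseteq> {a<..b - 1}" "valleys y \<subseteq> {a<..b - 1}"
  proof -
    have "a < c \<and> c < b" if "c \<in> peaks y \<or> c \<in> valleys y" for c
    proof -
      have "y c \<noteq> 0" "y (c - 1) \<noteq> 0" "y (c + 1) \<noteq> 0"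
        using that delannoy_pos[OF dyckD(1)[OF y], of c] by (auto simp: peaks_def valleys_def)
      then show ?thesis using D(6)[of "c - 1"] D(6)[of "c + 1"] by auto
    qed
    then show "peaks y \<subseteq> {a<..b - 1}" "valleys y \<subseteq> {a<..b - 1}" by force+
  qed
  have step: "r c - r (c - 1) = (if c \<in> peaks y then 1 else 0) - (if c \<in> valleys y then 1 else 0)"
    if "c \<in> {a<..b - 1}" for c
    using dyckD(3)[OF y, of c] dyckD(3)[OF y, of "c - 1"] D(6)[of c] D(6)[of "c + 1"] that
    by (auto simp: r_def peaks_def valleys_def)
  have "r (b - 1) - r a = (\<Sum>c\<in>{a<..b - 1}. r c - r (c - 1))"
    by (rule sum_telescope_int[symmetric]) (use ab in simp)
  also have "\<dots> = (\<Sum>c\<in>{a<..b - 1}. (if c \<in> peaks y then 1 else 0) - (if c \<in> valleys y then 1 else 0))"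
    by (rule sum.cong[OF refl], rule step)
  also have "\<dots> = int (card (peaks y)) - int (card (valleys y))"
    using sub by (simp add: sum_subtractf sum.If_cases Int_absorb1)
  finally show ?thesis using first last D(2,3) by (simp add: r_def)
qed

text \<open>If the inner path touches the outer one after rounding, then it passes the same place by a
  diagonal step, and the outer path has to turn around that step.\<close>

lemma touch_round_down:
  assumes f: "f \<in> delannoy_paths a u b v" and z: "z \<in> dyck_paths a' u' b' v'"
    and nest: "a' < a" "b < b'"
  shows "strictly_above z f \<longleftrightarrow>
    weakly_above z (round_down f) \<and> touch z (round_down f) \<subseteq> odds f"
proof
  note F = delannoyD[OF f] and Z = delannoyD[OF dyckD(1)[OF z]]
  assume l: "strictly_above z f"
  have nz: "f c \<noteq> 0" if "round_down f c \<noteq> 0" for c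
    using that delannoyD(6)[OF dyckD(1)[OF round_down_dyck[OF f]]] F(6) by blast
  have less: "z c < f c" if "round_down f c \<noteq> 0" for c
    using strictly_aboveD[OF l nz[OF that]] .
  have le: "z c \<le> round_down f c" if "round_down f c \<noteq> 0" for c
    using less[OF that] dyckD(2)[OF z, of c] by (auto simp: round_down_def)
  have T: "c \<in> odds f \<and> c \<in> peaks (round_down f) \<and> c \<in> valleys z" if "c \<in> touch z (round_down f)" for c
  proof -
    have c: "round_down f c \<noteq> 0" "z c = round_down f c" using that by (auto simp: touch_def)
    then have odd: "odd (f c)" using less[OF c(1)] by (auto simp: round_down_def split: if_splits)
    then have "c \<in> odds f" by (simp add: odds_def)
    moreover have "c \<in> peaks (round_down f)"
      using odds_round_down[OF f] \<open>c \<in> odds f\<close> by (auto simp: high_peaks_def)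
    moreover have "c \<in> valleys z"
    proof -
      note O = delannoy_odd[OF f odd]
      have zc: "z c = f c - 1" using c odd by (simp add: round_down_def)
      have ab: "a' \<le> c - 1" "c + 1 \<le> b'" using O(1,2) nest by auto
      have "z (c - 1) < f (c - 1)" "z (c + 1) < f (c + 1)"
        using strictly_aboveD[OF l] O(7,8) by auto
      then have "z (c - 1) = z c" "z (c + 1) = z c - 2"
        using dyckD(3)[OF z, of "c - 1"] dyckD(3)[OF z, of c] ab zc O(3,4) by auto
      then show ?thesis using Z(6)[of c] Z(6)[of "c + 1"] ab by (simp add: valleys_def)
    qed
    ultimately show ?thesis by blast
  qed
  show "weakly_above z (round_down f) \<and> touch z (round_down f) \<subseteq> odds f"
    unfolding weakly_above_def using le T by blast
next
  assume r: "weakly_above z (round_down f) \<and> touch z (round_down f) \<subseteq> odds f"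
  show "strictly_above z f" unfolding strictly_above_def
  proof (intro allI impI)
    fix c assume "f c \<noteq> 0"
    then have nz: "round_down f c \<noteq> 0"
      using delannoyD(6)[OF dyckD(1)[OF round_down_dyck[OF f]]] delannoyD(6)[OF f] by blast
    then have "z c \<le> round_down f c" "z c = round_down f c \<longrightarrow> odd (f c)"
      using r by (auto simp: weakly_above_def touch_def odds_def)
    then show "z c < f c" by (cases "odd (f c)") (auto simp: round_down_def)
  qed
qed

text \<open>On the other side rounding does no harm: paths that are strictly nested after rounding could
  meet only in the middle of a common diagonal step, and then they would meet at its start as well.\<close>

lemma strictly_above_round_down:
  assumes f: "f \<in> delannoy_paths a u b v" and x: "x \<in> delannoy_paths a' u' b' v'"
    and nest: "a < a'" "b' < b"
  shows "strictly_above f x \<longleftrightarrow> strictly_above (round_down f) x"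
proof
  assume "strictly_above f x"
  then show "strictly_above (round_down f) x"
    by (force simp: strictly_above_def round_down_def)
next
  assume r: "strictly_above (round_down f) x"
  show "strictly_above f x" unfolding strictly_above_def
  proof (intro allI impI)
    fix c assume c: "x c \<noteq> 0"
    show "f c < x c"
    proof (rule ccontr)
      assume "\<not> f c < x c"
      then have odd: "odd (f c)" "x c = f c"
        using strictly_aboveD[OF r c] by (auto simp: round_down_def split: if_splits)
      then have "x (c - 1) = f (c - 1)" "x (c - 1) \<noteq> 0" "even (f (c - 1))"
        using delannoy_odd[OF f odd(1)] delannoy_odd[OF x, of c] by auto
      then show False using strictly_aboveD[OF r, of "c - 1"] by (simp add: round_down_def)
    qed
  qed
qed

text \<open>At its ends the inner path has no peak, so the outer path could touch it there. This is why
  the first step of the inner path is required to be an up step and its last step a down step.\<close>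

lemma touch_round_up:
  assumes f: "f \<in> delannoy_paths a u b v" and x: "x \<in> dyck_paths a' u' b' v'"
    and nest: "a < a'" "b' < b" and ends: "a' < b'" "x (a' + 1) = u' - 2" "x (b' - 1) = v'"
  shows "strictly_above f x \<longleftrightarrow>
    weakly_above (round_up f) x \<and> touch (round_up f) x \<subseteq> odds f"
proof
  note F = delannoyD[OF f] and X = delannoyD[OF dyckD(1)[OF x]]
  assume l: "strictly_above f x"
  have le: "round_up f c \<le> x c" if "x c \<noteq> 0" for c
    using strictly_aboveD[OF l that] by (auto simp: round_up_def)
  have T: "c \<in> odds f \<and> c \<in> peaks x \<and> c \<in> valleys (round_up f)" if "c \<in> touch (round_up f) x" for c
  proof -
    have c: "x c \<noteq> 0" "round_up f c = x c" using that by (auto simp: touch_def)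
    then have odd: "odd (f c)" using strictly_aboveD[OF l c(1)] by (auto simp: round_up_def split: if_splits)
    then have "c \<in> odds f" by (simp add: odds_def)
    moreover have "c \<in> valleys (round_up f)"
      using odds_round_up[OF f] \<open>c \<in> odds f\<close> by auto
    moreover have "c \<in> peaks x"
    proof -
      note O = delannoy_odd[OF f odd]
      have xc: "x c = f c + 1" using c odd by (simp add: round_up_def)
      have cab: "a' \<le> c" "c \<le> b'" using c(1) X(6) by auto
      have "c \<noteq> a'"
        using strictly_aboveD[OF l, of "a' + 1"] X(6)[of "a' + 1"] X(2) ends O(4) xc by auto
      moreover have "c \<noteq> b'"
        using strictly_aboveD[OF l, of "b' - 1"] X(6)[of "b' - 1"] X(3) ends O(3) xc by auto
      ultimately have ab: "a' \<le> c - 1" "c + 1 \<le> b'" using cab by auto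
      have "f (c - 1) < x (c - 1)" "f (c + 1) < x (c + 1)"
        using strictly_aboveD[OF l, of "c - 1"] strictly_aboveD[OF l, of "c + 1"]
          X(6)[of "c - 1"] X(6)[of "c + 1"] ab by auto
      then have "x (c - 1) = x c + 2" "x (c + 1) = x c"
        using dyckD(3)[OF x, of "c - 1"] dyckD(3)[OF x, of c] ab xc O(3,4) by auto
      then show ?thesis using c(1) by (simp add: peaks_def)
    qed
    ultimately show ?thesis by blast
  qed
  show "weakly_above (round_up f) x \<and> touch (round_up f) x \<subseteq> odds f"
    unfolding weakly_above_def using le T by blast
next
  assume r: "weakly_above (round_up f) x \<and> touch (round_up f) x \<subseteq> odds f"
  show "strictly_above f x" unfolding strictly_above_def
  proof (intro allI impI)
    fix c assume nz: "x c \<noteq> 0"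
    then have "round_up f c \<le> x c" "round_up f c = x c \<longrightarrow> odd (f c)"
      using r by (auto simp: weakly_above_def touch_def odds_def)
    then show "f c < x c" using dyckD(2)[OF x, of c] by (cases "odd (f c)") (auto simp: round_up_def)
  qed
qed

lemma strictly_above_round_up:
  assumes f: "f \<in> delannoy_paths a u b v" and z: "z \<in> delannoy_paths a' u' b' v'"
    and nest: "a' < a" "b < b'"
  shows "strictly_above z f \<longleftrightarrow> strictly_above z (round_up f)"
proof
  show "strictly_above z f \<Longrightarrow> strictly_above z (round_up f)"
    unfolding strictly_above_def
  proof (intro allI impI)
    fix c assume l: "\<forall>c. f c \<noteq> 0 \<longrightarrow> z c < f c" and nz: "round_up f c \<noteq> 0"
    have "f c \<noteq> 0" using nz by (auto simp: round_up_def)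
    then have "z c < f c" using l by blast
    then show "z c < round_up f c" by (simp add: round_up_def)
  qed
next
  assume r: "strictly_above z (round_up f)"
  show "strictly_above z f" unfolding strictly_above_def
  proof (intro allI impI)
    fix c assume c: "f c \<noteq> 0"
    then have nz: "round_up f c \<noteq> 0"
      using delannoyD(6)[OF dyckD(1)[OF round_up_dyck[OF f]]] delannoyD(6)[OF f] by blast
    show "z c < f c"
    proof (rule ccontr)
      assume "\<not> z c < f c"
      then have odd: "odd (f c)" "z c = f c"
        using strictly_aboveD[OF r nz] by (auto simp: round_up_def split: if_splits)
      then have "z (c - 1) = f (c - 1)" "f (c - 1) \<noteq> 0" "even (f (c - 1))"
        using delannoy_odd[OF f odd(1)] delannoy_odd[OF z, of c] by auto
      then show False using strictly_aboveD[OF r, of "c - 1"] by (simp add: round_up_def)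
    qed
  qed
qed

end

section \<open>Moving the diagonal steps through the ranks\<close>

lemma prod_indicator:
  "finite S \<Longrightarrow> (\<Prod>i\<in>S. if P i then 1 else 0 :: int) = (if \<forall>i\<in>S. P i then 1 else 0)"
  by (induction S rule: finite_induct) auto

lemma prod_sign_indicator:
  assumes "finite S" "\<And>i. i \<in> S \<Longrightarrow> finite (t i)"
    "\<And>i j. i \<in> S \<Longrightarrow> j \<in> S \<Longrightarrow> i \<noteq> j \<Longrightarrow> t i \<inter> t j = {}"
  shows "(\<Prod>i\<in>S. if P i then (-1) ^ card (t i) else 0 :: int) =
    (if \<forall>i\<in>S. P i then (-1) ^ card (\<Union>i\<in>S. t i) else 0)"
proof -
  have "(-1::int) ^ card (\<Union>i\<in>S. t i) = (\<Prod>i\<in>S. (-1) ^ card (t i))"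
    using assms by (subst card_UN_disjoint) (auto simp: power_sum)
  moreover have "(\<Prod>i\<in>S. if P i then (-1) ^ card (t i) else 0 :: int) =
      (if \<forall>i\<in>S. P i then \<Prod>i\<in>S. (-1) ^ card (t i) else 0)"
  proof (cases "\<forall>i\<in>S. P i")
    case False
    then show ?thesis using assms(1) by (auto intro!: prod_zero)
  qed (auto intro: prod.cong)
  ultimately show ?thesis by simp
qed

text \<open>That the complement of the paths is again a Young diagram enters as \<open>closed\<close>: inside \<open>Y\<close>, a
  southeast shift of a cell of a path is a cell of a path.\<close>

locale ranked_family = rim_family +
  fixes rk :: "nat \<Rightarrow> nat"
  assumes nest_rank: "i < k \<Longrightarrow> j < k \<Longrightarrow> nest i j \<Longrightarrow> rk i < rk j"
    and nest_cover: "i < k \<Longrightarrow> j < k \<Longrightarrow> nest i j \<Longrightarrow>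
      \<exists>l<k. nest l j \<and> rk j = rk l + 1 \<and> (l = i \<or> nest i l)"
    and rank_pos: "j < k \<Longrightarrow> 0 < rk j \<Longrightarrow> \<exists>i<k. nest i j"
    and closed: "i < k \<Longrightarrow> L i c \<noteq> 0 \<Longrightarrow> vertex c (L i c + 2) \<Longrightarrow> \<exists>j<k. L j c = L i c + 2"
    and ends: "i < k \<Longrightarrow> j < k \<Longrightarrow> nest i j \<Longrightarrow>
      a j < b j \<and> L j (a j + 1) = u j - 2 \<and> L j (b j - 1) = v j"
    and peaks_high: "i < k \<Longrightarrow> j < k \<Longrightarrow> nest i j \<Longrightarrow> peaks (L j) \<subseteq> high_peaks (L j)"
begin

definition links :: "(nat \<times> nat) set" where
  "links = {(i, j). i < k \<and> j < k \<and> nest i j \<and> rk j = rk i + 1}"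

lemma linksD: "(i, j) \<in> links \<Longrightarrow> i < k \<and> j < k \<and> nest i j \<and> rk j = rk i + 1"
  by (simp add: links_def)

lemma finite_links: "finite links"
  by (rule finite_subset[of _ "{..<k} \<times> {..<k}"]) (auto simp: links_def)

lemma delannoy_supp_nest:
  assumes "nest i j" "f \<in> delannoy i" "g \<in> delannoy j" "f c \<noteq> 0"
  shows "g c \<noteq> 0"
  using assms delannoyD(6)[OF assms(2)] delannoyD(6)[OF assms(3)] by (auto simp: nest_def)

lemma links_imp_nested_above:
  assumes D: "\<And>i. i < k \<Longrightarrow> i = n \<or> nest i n \<Longrightarrow> D i \<in> delannoy i"
    and lk: "\<And>i j. (i, j) \<in> links \<Longrightarrow> j = n \<or> nest j n \<Longrightarrow> strictly_above (D j) (D i)"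
    and ij: "i < k" "j < k" "nest i j" "j = n \<or> nest j n"
  shows "strictly_above (D j) (D i)"
  using ij
proof (induction "rk j" arbitrary: j rule: less_induct)
  case less
  obtain l where l: "l < k" "nest l j" "rk j = rk l + 1" "l = i \<or> nest i l"
    using nest_cover[OF less(2,3,4)] by blast
  have lj: "strictly_above (D j) (D l)" using lk[of l j] l less by (auto simp: links_def)
  show ?case
  proof (cases "l = i")
    case False
    then have il: "nest i l" using l(4) by blast
    have ln: "nest l n" "nest i n" using l(2) il less(5) nest_trans by blast+
    then have "strictly_above (D l) (D i)" using less(1)[of l] l il less(2) by auto
    then show ?thesis
      using lj delannoy_supp_nest[OF il D[OF less(2)] D[OF l(1)]] ln unfolding strictly_above_def by fastforce
  qed (use lj in simp)
qed

lemma pairwise_disjoint_iff_links: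
  assumes D: "\<And>i. i < k \<Longrightarrow> D i \<in> delannoy i"
  shows "pairwise_disjoint k D \<longleftrightarrow> (\<forall>(i, j)\<in>links. strictly_above (D j) (D i))"
proof
  assume "pairwise_disjoint k D"
  then show "\<forall>(i, j)\<in>links. strictly_above (D j) (D i)"
    using disjoint_iff_nested_below[OF D] by (auto simp: links_def strictly_above_def)
next
  assume "\<forall>(i, j)\<in>links. strictly_above (D j) (D i)"
  then have lk: "strictly_above (D j) (D i)" if "(i, j) \<in> links" for i j using that by blast
  have "strictly_above (D j) (D i)" if "i < k" "j < k" "nest i j" for i j
    by (rule links_imp_nested_above[of j D i j]) (use D lk that in auto)
  then show "pairwise_disjoint k D"
    using disjoint_iff_nested_below[OF D] by (auto simp: strictly_above_def)
qed

text \<open>The shape that is required of \<open>L n\<close> is inherited by every path that is strictly above everything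
  nested in it, even if it is not above \<open>L n\<close>. Below a peak that is not high there is no nested
  path; so the path meets \<open>L n\<close> there, because the cells southeast of \<open>L n\<close> belong to nested
  paths. For the same reason it cannot be below \<open>L n\<close> just before or after, unless a nested
  path passes there, which would then also be present below the peak.\<close>

lemma above_nested_corners:
  assumes n: "n < k" and i0: "i0 < k" "nest i0 n" and y: "y \<in> dyck n"
    and E: "\<And>i. i < k \<Longrightarrow> nest i n \<Longrightarrow> E i \<in> delannoy i"
    and above: "\<And>i. i < k \<Longrightarrow> nest i n \<Longrightarrow> strictly_above y (E i)"
  shows "a n < b n" "y (a n + 1) = u n - 2" "y (b n - 1) = v n" "peaks y \<subseteq> high_peaks y"
proof -
  note Ends = ends[OF i0(1) n i0(2)]
  note D = delannoyD[OF dyckD(1)[OF y]] and DL = delannoyD[OF L_delannoy[OF n]]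
  show ab: "a n < b n" using Ends by blast
  have below: "\<exists>j<k. nest j n \<and> L j c = L n c + 2 \<and> E j c \<noteq> 0 \<and> y c < E j c"
    if c: "a n \<le> c" "c \<le> b n" and vx: "vertex c (L n c + 2)" for c
  proof -
    have L0: "0 < L n c" using DL(8) c by blast
    then obtain j where j: "j < k" "L j c = L n c + 2" using closed[OF n _ vx] by auto
    then have "j \<noteq> n" by auto
    then have jn: "nest j n" using L_nested[OF j(1) n, of c] j(2) L0 by auto
    have "E j c \<noteq> 0"
      using delannoyD(6)[OF L_delannoy[OF j(1)], of c] delannoyD(6)[OF E[OF j(1) jn], of c] j(2) L0 by auto
    then show ?thesis using j jn strictly_aboveD[OF above[OF j(1) jn]] by blast
  qed
  \<comment> \<open>The nested path that occupies the cell below \<open>L n\<close> cannot start or end there, since its ends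
    are not on \<open>y\<close>.\<close>
  have inner: "\<exists>j<k. nest j n \<and> a j < c \<and> c < b j" if c: "a n \<le> c" "c \<le> b n" and eq: "y c = L n c + 2" for c
  proof -
    have "vertex c (L n c + 2)" using D(7)[OF c] eq by simp
    then obtain j where j: "j < k" "nest j n" "L j c = L n c + 2" "E j c \<noteq> 0" "y c < E j c"
      using below[OF c] by blast
    note Lj = delannoyD[OF L_delannoy[OF j(1)]] and Ej = delannoyD[OF E[OF j(1,2)]]
    have "c \<noteq> a j" "c \<noteq> b j" using j(3,5) eq Lj(2,3) Ej(2,3) by auto
    then show ?thesis using j(1,2,4) Ej(6)[of c] by auto
  qed
  show "y (a n + 1) = u n - 2"
    using dyckD(3)[OF y, of "a n"] inner[of "a n + 1"] ab D(2) Ends by (auto simp: nest_def)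
  show "y (b n - 1) = v n"
    using dyckD(3)[OF y, of "b n - 1"] inner[of "b n - 1"] ab D(3) Ends by (auto simp: nest_def)
  show "peaks y \<subseteq> high_peaks y"
  proof
    fix c assume pk: "c \<in> peaks y"
    then have P: "y c \<noteq> 0" "y (c - 1) = y c + 2" "y (c + 1) = y c" by (auto simp: peaks_def)
    have ypos: "0 < y c" using delannoy_pos[OF dyckD(1)[OF y] P(1)] .
    have cab: "a n \<le> c - 1" "c + 1 \<le> b n" using D(6)[of "c - 1"] D(6)[of "c + 1"] P ypos by auto
    have vy: "vertex c (y c)" using D(7) cab by auto
    have evy: "even (y c)" and evL: "even (L n c)" using dyckD(2)[OF y] dyckD(2)[OF L_dyck[OF n]] by auto
    show "c \<in> high_peaks y"
    proof (rule ccontr)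
      assume "c \<notin> high_peaks y"
      then have low: "\<not> vertex c (y c + 2)" using pk by (simp add: high_peaks_def)
      then have "\<not> vertex c (y c + 1)" using vertex_odd[of "y c + 1" c] evy by (simp add: add.commute)
      then have bottom: "x \<le> y c" if "vertex c x" for x
        using rim_max[of c "y c" x] that vy evy by (simp add: rim_def)
      have uncovered: "\<not> (a j < c + 1 \<and> c - 1 < b j)" if "j < k" "nest j n" for j
        using bottom[OF delannoy_vertex[OF E[OF that]]] strictly_aboveD[OF above[OF that], of c]
          delannoyD(6)[OF E[OF that], of c] by fastforce
      have Lc: "L n c = y c"
      proof (rule ccontr)
        assume "L n c \<noteq> y c"
        moreover have "L n c \<le> y c" using bottom DL(7) cab by auto
        ultimately have "L n c + 2 \<le> y c" using evy evL by presburger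
        then have "vertex c (L n c + 2)" using vertex_between[OF _ vy, of "L n c"] DL(7)[of c] cab by auto
        then obtain j where "j < k" "nest j n" "E j c \<noteq> 0" using below[of c] cab by auto
        then show False using uncovered[of j] delannoyD(6)[OF E, of j c] by auto
      qed
      have "L n (c - 1) = y c + 2"
        using dyckD(3)[OF L_dyck[OF n], of "c - 1"] inner[of "c - 1"] cab Lc P(2) uncovered by fastforce
      moreover have "L n (c + 1) = y c"
        using dyckD(3)[OF L_dyck[OF n], of c] inner[of "c + 1"] cab Lc P(3) uncovered by fastforce
      ultimately have "c \<in> peaks (L n)" using Lc P(1) by (simp add: peaks_def)
      then have "vertex c (L n c + 2)" using peaks_high[OF i0(1) n i0(2)] by (auto simp: high_peaks_def)
      then show False using low Lc by simp
    qed
  qed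
qed

lemma strict_links_corners:
  assumes n: "n < k" "0 < rk n" and Dn: "D n \<in> dyck n"
    and D: "\<And>i. i < k \<Longrightarrow> nest i n \<Longrightarrow> D i \<in> delannoy i"
    and lk: "\<And>i j. (i, j) \<in> links \<Longrightarrow> j = n \<or> nest j n \<Longrightarrow> strictly_above (D j) (D i)"
  shows "a n < b n" "D n (a n + 1) = u n - 2" "D n (b n - 1) = v n" "peaks (D n) \<subseteq> high_peaks (D n)"
proof -
  obtain i0 where i0: "i0 < k" "nest i0 n" using rank_pos[OF n] by blast
  have "strictly_above (D n) (D i)" if "i < k" "nest i n" for i
    by (rule links_imp_nested_above[of n D i n, OF _ lk]) (use that n(1) D dyckD(1)[OF Dn] in auto)
  then show "a n < b n" "D n (a n + 1) = u n - 2" "D n (b n - 1) = v n" "peaks (D n) \<subseteq> high_peaks (D n)"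
    using above_nested_corners[OF n(1) i0 Dn D] by blast+
qed

text \<open>Mixed families: the paths in \<open>A\<close> are Delannoy paths, the other ones Dyck paths. A link for
  which the inner path is in \<open>B\<close> is weak: it allows the paths to touch, with a sign for each
  touching point.\<close>

definition mixed_paths :: "nat set \<Rightarrow> nat \<Rightarrow> path set" where
  "mixed_paths A i = (if i \<in> A then delannoy i else dyck i)"

definition mixed_weight :: "nat set \<Rightarrow> nat \<Rightarrow> path \<Rightarrow> int" where
  "mixed_weight A i = (if i \<in> A then weight else dyck_weight)"

definition link_sign :: "nat set \<Rightarrow> nat \<Rightarrow> path \<Rightarrow> path \<Rightarrow> int" where
  "link_sign B i x y =
     (if i \<in> B then if weakly_above y x then (-1) ^ card (touch y x) else 0
      else if strictly_above y x then 1 else 0)"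

definition mixed_sum :: "nat set \<Rightarrow> nat set \<Rightarrow> int" where
  "mixed_sum A B = (\<Sum>D\<in>Pi\<^sub>E {..<k} (mixed_paths A).
     (\<Prod>i<k. mixed_weight A i (D i)) * (\<Prod>(i, j)\<in>links. link_sign B i (D i) (D j)))"

definition children :: "nat \<Rightarrow> nat set" where
  "children n = {i. (i, n) \<in> links}"

definition parents :: "nat \<Rightarrow> nat set" where
  "parents n = {j. (n, j) \<in> links}"

definition rest_weight :: "nat set \<Rightarrow> nat set \<Rightarrow> nat \<Rightarrow> (nat \<Rightarrow> path) \<Rightarrow> int" where
  "rest_weight A B n E = (\<Prod>i\<in>{..<k} - {n}. mixed_weight A i (E i)) *
     (\<Prod>(i, j)\<in>{(i, j) \<in> links. i \<noteq> n \<and> j \<noteq> n}. link_sign B i (E i) (E j))"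

definition local_sum :: "nat set \<Rightarrow> nat set \<Rightarrow> nat \<Rightarrow> (nat \<Rightarrow> path) \<Rightarrow> int" where
  "local_sum A B n E = (\<Sum>f\<in>mixed_paths A n. mixed_weight A n f *
     ((\<Prod>i\<in>children n. link_sign B i (E i) f) * (\<Prod>j\<in>parents n. link_sign B n f (E j))))"

lemma finite_children: "finite (children n)" and finite_parents: "finite (parents n)"
  by (rule finite_subset[of _ "{..<k}"], auto simp: children_def parents_def links_def)+

lemma mixed_sum_eq_local:
  assumes n: "n < k"
  shows "mixed_sum A B = (\<Sum>E\<in>Pi\<^sub>E ({..<k} - {n}) (mixed_paths A). rest_weight A B n E * local_sum A B n E)"
proof -
  let ?R = "{(i, j) \<in> links. i \<noteq> n \<and> j \<noteq> n}"
  let ?C = "(\<lambda>i. (i, n)) ` children n" and ?P = "Pair n ` parents n"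
  have nl: "(n, n) \<notin> links" using nest_irrefl by (auto simp: links_def)
  have split: "links = ?R \<union> (?C \<union> ?P)" by (auto simp: children_def parents_def)
  have dis: "?R \<inter> (?C \<union> ?P) = {}" "?C \<inter> ?P = {}"
    using nl by (auto simp: children_def parents_def)
  have fin: "finite ?R" "finite ?C" "finite ?P"
    using finite_children finite_parents finite_subset[OF _ finite_links, of ?R] by auto
  have "(\<Prod>i<k. mixed_weight A i ((E(n := f)) i)) * (\<Prod>(i, j)\<in>links. link_sign B i ((E(n := f)) i) ((E(n := f)) j)) =
      rest_weight A B n E * (mixed_weight A n f *
       ((\<Prod>i\<in>children n. link_sign B i (E i) f) * (\<Prod>j\<in>parents n. link_sign B n f (E j))))" for E f
  proof -
    have 1: "(\<Prod>i<k. mixed_weight A i ((E(n := f)) i)) =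
        mixed_weight A n f * (\<Prod>i\<in>{..<k} - {n}. mixed_weight A i (E i))"
      using n by (subst prod.remove[of _ n]) (auto intro!: prod.cong)
    have C: "(\<Prod>(i, j)\<in>?C. link_sign B i ((E(n := f)) i) ((E(n := f)) j)) = (\<Prod>i\<in>children n. link_sign B i (E i) f)"
      using nl by (subst prod.reindex) (auto simp: inj_on_def children_def intro!: prod.cong)
    have P: "(\<Prod>(i, j)\<in>?P. link_sign B i ((E(n := f)) i) ((E(n := f)) j)) = (\<Prod>j\<in>parents n. link_sign B n f (E j))"
      using nl by (subst prod.reindex) (auto simp: inj_on_def parents_def intro!: prod.cong)
    have R: "(\<Prod>(i, j)\<in>?R. link_sign B i ((E(n := f)) i) ((E(n := f)) j)) = (\<Prod>(i, j)\<in>?R. link_sign B i (E i) (E j))"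
      by (rule prod.cong) auto
    let ?g = "\<lambda>(i, j). link_sign B i ((E(n := f)) i) ((E(n := f)) j)"
    have "prod ?g links = prod ?g ?R * prod ?g (?C \<union> ?P)"
      by (subst (1) split, rule prod.union_disjoint[OF fin(1) _ dis(1)]) (use fin in simp)
    also have "prod ?g (?C \<union> ?P) = prod ?g ?C * prod ?g ?P"
      by (rule prod.union_disjoint[OF fin(2,3) dis(2)])
    finally have "prod ?g links = (\<Prod>(i, j)\<in>?R. link_sign B i (E i) (E j)) *
       ((\<Prod>i\<in>children n. link_sign B i (E i) f) * (\<Prod>j\<in>parents n. link_sign B n f (E j)))"
      unfolding C P R .
    then show ?thesis unfolding 1 rest_weight_def by (simp add: mult_ac)
  qed
  then show ?thesis
    unfolding mixed_sum_def local_sum_def using n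
    by (subst sum_PiE_coordinate[of n]) (auto simp: sum_distrib_left intro!: sum.cong)
qed

text \<open>Two mixed sums that differ only in the role of one path can be compared with all other paths
  fixed. The strict links among those may then be used.\<close>

lemma mixed_sum_change_one:
  assumes n: "n < k" and A: "\<And>i. i \<noteq> n \<Longrightarrow> i \<in> A \<longleftrightarrow> i \<in> A'"
    and B: "\<And>i j. (i, j) \<in> links \<Longrightarrow> i \<noteq> n \<Longrightarrow> j \<noteq> n \<Longrightarrow> i \<in> B \<longleftrightarrow> i \<in> B'"
    and loc: "\<And>E. (\<And>i. i < k \<Longrightarrow> i \<noteq> n \<Longrightarrow> E i \<in> mixed_paths A i) \<Longrightarrow>
        (\<And>i j. (i, j) \<in> links \<Longrightarrow> i \<noteq> n \<Longrightarrow> j \<noteq> n \<Longrightarrow> i \<notin> B \<Longrightarrow> strictly_above (E j) (E i)) \<Longrightarrow>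
        q * local_sum A B n E = local_sum A' B' n E"
  shows "q * mixed_sum A B = mixed_sum A' B'"
proof -
  have PA: "Pi\<^sub>E ({..<k} - {n}) (mixed_paths A) = Pi\<^sub>E ({..<k} - {n}) (mixed_paths A')"
    using A by (intro PiE_cong) (auto simp: mixed_paths_def)
  have R: "rest_weight A B n E = rest_weight A' B' n E" for E
    unfolding rest_weight_def using A B
    by (intro arg_cong2[of _ _ _ _ "(*)"] prod.cong) (auto simp: mixed_weight_def link_sign_def)
  have "q * (rest_weight A B n E * local_sum A B n E) = rest_weight A' B' n E * local_sum A' B' n E"
    if E: "E \<in> Pi\<^sub>E ({..<k} - {n}) (mixed_paths A)" for E
  proof (cases "rest_weight A B n E = 0")
    case False
    have "strictly_above (E j) (E i)" if "(i, j) \<in> links" "i \<noteq> n" "j \<noteq> n" "i \<notin> B" for i j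
    proof (rule ccontr)
      assume "\<not> strictly_above (E j) (E i)"
      then have "link_sign B i (E i) (E j) = 0" using that(4) by (simp add: link_sign_def)
      then have "(\<Prod>(i, j)\<in>{(i, j) \<in> links. i \<noteq> n \<and> j \<noteq> n}. link_sign B i (E i) (E j)) = 0"
        using that finite_subset[OF _ finite_links, of "{(i, j) \<in> links. i \<noteq> n \<and> j \<noteq> n}"]
        by (intro prod_zero) auto
      then show False using False by (simp add: rest_weight_def)
    qed
    then have "q * local_sum A B n E = local_sum A' B' n E"
      using E by (intro loc) (auto simp: PiE_iff)
    then show ?thesis using R by (simp add: mult.left_commute)
  qed (use R in simp)
  then show ?thesis
    unfolding mixed_sum_eq_local[OF n] sum_distrib_left PA[symmetric] by (intro sum.cong) auto
qed

lemma mixed_paths_delannoy: "f \<in> mixed_paths A i \<Longrightarrow> f \<in> delannoy i"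
  by (auto simp: mixed_paths_def dyckD(1) split: if_splits)

lemma parents_unique:
  assumes n: "n < k" and "i \<in> parents n" "j \<in> parents n"
  shows "i = j"
proof (rule ccontr)
  assume "i \<noteq> j"
  have ij: "i < k" "j < k" "nest n i" "nest n j" "rk i = rk j" using assms by (auto simp: parents_def links_def)
  then have "nest i j \<or> nest j i"
    using laminar[OF ij(1,2) \<open>i \<noteq> j\<close>, of "a n"] a_le_b[OF n] by (auto simp: nest_def)
  then show False using nest_rank ij by fastforce
qed

lemma children_supp_disjoint:
  assumes "i \<in> children n" "j \<in> children n" "i \<noteq> j" "f \<in> delannoy i" "g \<in> delannoy j"
  shows "supp f \<inter> supp g = {}"
proof (rule ccontr)
  assume "supp f \<inter> supp g \<noteq> {}"
  then obtain c where "c \<in> supp f" "c \<in> supp g" by auto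
  then have c: "a i \<le> c" "c \<le> b i" "a j \<le> c" "c \<le> b j"
    using supp_delannoy[OF assms(4)] supp_delannoy[OF assms(5)] by auto
  have ij: "i < k" "j < k" "rk i = rk j" using assms(1,2) by (auto simp: children_def links_def)
  then have "nest i j \<or> nest j i" using laminar[OF ij(1,2) assms(3) c] by blast
  then show False using nest_rank ij by fastforce
qed

lemma sum_over_fibers:
  assumes "\<And>f. f \<in> delannoy n \<Longrightarrow> h f \<in> dyck n"
    and "\<And>f. f \<in> delannoy n \<Longrightarrow> g f = (if P (h f) \<and> T (h f) \<subseteq> odds f then weight f else 0)"
  shows "(\<Sum>f\<in>delannoy n. g f) =
    (\<Sum>y\<in>dyck n. if P y then \<Sum>f | f \<in> delannoy n \<and> h f = y \<and> T y \<subseteq> odds f. weight f else 0)"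
proof -
  have "(\<Sum>f\<in>delannoy n. g f) = (\<Sum>y\<in>dyck n. \<Sum>f | f \<in> delannoy n \<and> h f = y. g f)"
    by (rule sum.group[symmetric]) (use assms(1) finite_delannoy finite_dyck in auto)
  also have "\<dots> = (\<Sum>y\<in>dyck n. if P y then \<Sum>f | f \<in> delannoy n \<and> h f = y \<and> T y \<subseteq> odds f. weight f else 0)"
  proof (rule sum.cong[OF refl])
    fix y
    have "(\<Sum>f | f \<in> delannoy n \<and> h f = y. g f) =
        (\<Sum>f | f \<in> delannoy n \<and> h f = y. if P y \<and> T y \<subseteq> odds f then weight f else 0)"
      by (rule sum.cong[OF refl]) (use assms(2) in auto)
    also have "\<dots> = (if P y then \<Sum>f | f \<in> delannoy n \<and> h f = y \<and> T y \<subseteq> odds f. weight f else 0)"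
    proof (cases "P y")
      case True
      have "{f \<in> {f. f \<in> delannoy n \<and> h f = y}. T y \<subseteq> odds f} =
          {f. f \<in> delannoy n \<and> h f = y \<and> T y \<subseteq> odds f}" by auto
      moreover have "finite {f. f \<in> delannoy n \<and> h f = y}"
        by (rule finite_subset[OF _ finite_delannoy]) auto
      ultimately show ?thesis using True by (simp add: sum.inter_filter[symmetric])
    qed simp
    finally show "(\<Sum>f | f \<in> delannoy n \<and> h f = y. g f) =
        (if P y then \<Sum>f | f \<in> delannoy n \<and> h f = y \<and> T y \<subseteq> odds f. weight f else 0)" .
  qed
  finally show ?thesis .
qed

text \<open>A Delannoy path whose parent is a Dyck path may become a Dyck path by replacing its diagonal
  steps by peaks. The peaks may run into valleys of the parent, so the link becomes weak. The
  weights now count peaks instead of valleys; since the path has one peak more than valleys, this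
  is a factor of 2.\<close>

lemma delannoy_to_dyck:
  assumes n: "n < k" "n \<in> A" "n \<notin> B" "0 < rk n" and par: "parents n \<inter> A = {}"
    and B: "\<And>i. i \<in> B \<Longrightarrow> \<not> nest i n"
  shows "2 * mixed_sum A B = mixed_sum (A - {n}) (insert n B)"
proof (rule mixed_sum_change_one[OF n(1)])
  show "i \<in> A \<longleftrightarrow> i \<in> A - {n}" if "i \<noteq> n" for i using that by simp
  show "i \<in> B \<longleftrightarrow> i \<in> insert n B" if "i \<noteq> n" for i using that by simp
  fix E assume E: "\<And>i. i < k \<Longrightarrow> i \<noteq> n \<Longrightarrow> E i \<in> mixed_paths A i"
    and strict: "\<And>i j. (i, j) \<in> links \<Longrightarrow> i \<noteq> n \<Longrightarrow> j \<noteq> n \<Longrightarrow> i \<notin> B \<Longrightarrow> strictly_above (E j) (E i)"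
  define C where "C y \<longleftrightarrow> (\<forall>i\<in>children n. strictly_above y (E i))" for y
  define W where "W y \<longleftrightarrow> (\<forall>j\<in>parents n. weakly_above (E j) y)" for y
  define T where "T y = (\<Union>j\<in>parents n. touch (E j) y)" for y
  have ch: "i < k" "nest i n" "i \<noteq> n" "i \<notin> B" "E i \<in> delannoy i" if "i \<in> children n" for i
    using that B nest_irrefl mixed_paths_delannoy[OF E] by (auto simp: children_def links_def)
  have pa: "j < k" "nest n j" "j \<noteq> n" "E j \<in> dyck j" if "j \<in> parents n" for j
  proof -
    have "j \<notin> A" using that par by blast
    then show "j < k" "nest n j" "j \<noteq> n" "E j \<in> dyck j"
      using that nest_irrefl E[of j] by (auto simp: parents_def links_def mixed_paths_def)
  qed
  have fT: "finite (touch (E j) y)" if "y \<in> dyck n" for y j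
    using finite_subset[OF _ finite_supp_delannoy[OF dyckD(1)[OF that]], of "touch (E j) y"]
    by (auto simp: touch_def supp_def)
  have dyck_eq: "mixed_paths (A - {n}) n = dyck n" by (simp add: mixed_paths_def)
  have "local_sum A B n E = (\<Sum>f\<in>delannoy n. weight f *
      ((if C f then 1 else 0) * (if \<forall>j\<in>parents n. strictly_above (E j) f then 1 else 0)))"
    unfolding local_sum_def using n ch(4)
    by (auto simp: mixed_paths_def mixed_weight_def link_sign_def C_def prod_indicator finite_parents
        finite_children intro!: sum.cong)
  also have "\<dots> = (\<Sum>y\<in>dyck n. if C y \<and> W y then
      \<Sum>f | f \<in> delannoy n \<and> round_down f = y \<and> T y \<subseteq> odds f. weight f else 0)"
  proof (rule sum_over_fibers)
    fix f assume f: "f \<in> delannoy n"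
    show "round_down f \<in> dyck n" using round_down_dyck[OF f] .
    have "strictly_above f (E i) \<longleftrightarrow> strictly_above (round_down f) (E i)" if "i \<in> children n" for i
      using strictly_above_round_down[OF f ch(5)[OF that]] ch(2)[OF that] by (simp add: nest_def)
    then have "C f \<longleftrightarrow> C (round_down f)" unfolding C_def by blast
    moreover have "strictly_above (E j) f \<longleftrightarrow>
        weakly_above (E j) (round_down f) \<and> touch (E j) (round_down f) \<subseteq> odds f" if "j \<in> parents n" for j
      using touch_round_down[OF f pa(4)[OF that]] pa(2)[OF that] by (simp add: nest_def)
    then have "(\<forall>j\<in>parents n. strictly_above (E j) f) \<longleftrightarrow> W (round_down f) \<and> T (round_down f) \<subseteq> odds f"
      unfolding W_def T_def by blast
    ultimately show "weight f * ((if C f then 1 else 0) * (if \<forall>j\<in>parents n. strictly_above (E j) f then 1 else 0)) =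
      (if (C (round_down f) \<and> W (round_down f)) \<and> T (round_down f) \<subseteq> odds f then weight f else 0)"
      by simp
  qed
  finally have "2 * local_sum A B n E = (\<Sum>y\<in>dyck n. 2 * (if C y \<and> W y then
      \<Sum>f | f \<in> delannoy n \<and> round_down f = y \<and> T y \<subseteq> odds f. weight f else 0))"
    by (simp add: sum_distrib_left)
  also have "\<dots> = (\<Sum>y\<in>dyck n. dyck_weight y * ((if C y then 1 else 0) *
      (if W y then (-1) ^ card (T y) else 0)))"
  proof (rule sum.cong[OF refl])
    fix y assume y: "y \<in> dyck n"
    show "2 * (if C y \<and> W y then \<Sum>f | f \<in> delannoy n \<and> round_down f = y \<and> T y \<subseteq> odds f. weight f else 0) =
      dyck_weight y * ((if C y then 1 else 0) * (if W y then (-1) ^ card (T y) else 0))"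
    proof (cases "C y \<and> W y")
      case True
      have "strictly_above ((E(n := y)) j) ((E(n := y)) i)" if l: "(i, j) \<in> links" "j = n \<or> nest j n" for i j
      proof (cases "j = n")
        case True
        then show ?thesis using \<open>C y \<and> W y\<close> l(1) ch(3)[of i] by (auto simp: C_def children_def)
      next
        case False
        then have "nest i n" using linksD[OF l(1)] l(2) nest_trans by blast
        then have "i \<noteq> n" "i \<notin> B" using nest_irrefl B by auto
        then show ?thesis using strict[OF l(1)] False by simp
      qed
      moreover have "(E(n := y)) i \<in> delannoy i" if "i < k" "nest i n" for i
        using that nest_irrefl mixed_paths_delannoy[OF E] by auto
      ultimately have corners: "a n < b n" "y (a n + 1) = u n - 2" "y (b n - 1) = v n" "peaks y \<subseteq> high_peaks y"
        using strict_links_corners[of n "E(n := y)"] n(1,4) y by simp_all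
      have hp: "high_peaks y = peaks y" using corners(4) by (auto simp: high_peaks_def)
      have pv: "card (peaks y) = card (valleys y) + 1" by (rule card_peaks_valleys[OF y corners(1-3)])
      have le: "card (peaks y) \<le> card (supp y)"
        using card_subset_interval(2)[OF peaks_subset[OF y]] by (simp add: supp_delannoy[OF dyckD(1)[OF y]])
      have "T y \<subseteq> high_peaks y" using True unfolding hp W_def T_def weakly_above_def by blast
      then have "2 * (\<Sum>f | f \<in> delannoy n \<and> round_down f = y \<and> T y \<subseteq> odds f. weight f) =
          (-1) ^ card (T y) * 2 ^ Suc (card (supp y) - card (peaks y))"
        unfolding sum_weight_round_down[OF y] by (simp add: hp)
      also have "Suc (card (supp y) - card (peaks y)) = card (supp y) - card (valleys y)"
        using pv le by simp
      finally show ?thesis using True by (simp add: dyck_weight_def mult.commute)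
    qed auto
  qed
  also have "\<dots> = local_sum (A - {n}) (insert n B) n E"
    unfolding local_sum_def dyck_eq
  proof (rule sum.cong[OF refl])
    fix y assume y: "y \<in> dyck n"
    have "(\<Prod>j\<in>parents n. if weakly_above (E j) y then (-1) ^ card (touch (E j) y) else 0 :: int) =
        (if W y then (-1) ^ card (T y) else 0)"
      unfolding W_def T_def
      by (rule prod_sign_indicator) (use finite_parents fT[OF y] parents_unique[OF n(1)] in auto)
    moreover have "(\<Prod>i\<in>children n. link_sign (insert n B) i (E i) y) = (if C y then 1 else 0)"
      unfolding C_def prod_indicator[OF finite_children, symmetric]
      by (rule prod.cong) (use ch in \<open>auto simp: link_sign_def\<close>)
    ultimately show "dyck_weight y * ((if C y then 1 else 0) * (if W y then (-1) ^ card (T y) else 0)) =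
      mixed_weight (A - {n}) n y * ((\<Prod>i\<in>children n. link_sign (insert n B) i (E i) y) *
        (\<Prod>j\<in>parents n. link_sign (insert n B) n y (E j)))"
      by (simp add: mixed_weight_def link_sign_def)
  qed
  finally show "2 * local_sum A B n E = local_sum (A - {n}) (insert n B) n E" .
qed

text \<open>Conversely, a Dyck path with weak links to all paths directly inside may be expanded into
  Delannoy paths with strict links, by diagonal steps in place of valleys.\<close>

lemma dyck_to_delannoy:
  assumes n: "n < k" "n \<notin> A" "n \<notin> B" and chA: "children n \<inter> A = {}" and chB: "children n \<subseteq> B"
    and B: "\<And>i. i \<in> B \<Longrightarrow> nest i n \<Longrightarrow> i \<in> children n" and rk: "\<And>i. i \<in> children n \<Longrightarrow> 0 < rk i"
  shows "mixed_sum A B = mixed_sum (insert n A) (B - children n)"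
proof -
  have "1 * mixed_sum A B = mixed_sum (insert n A) (B - children n)"
  proof (rule mixed_sum_change_one[OF n(1)])
    show "i \<in> A \<longleftrightarrow> i \<in> insert n A" if "i \<noteq> n" for i using that by simp
    show "i \<in> B \<longleftrightarrow> i \<in> B - children n" if "(i, j) \<in> links" "i \<noteq> n" "j \<noteq> n" for i j
      using that parents_unique[of i j n] linksD[OF that(1)] by (auto simp: children_def parents_def)
    fix E assume E: "\<And>i. i < k \<Longrightarrow> i \<noteq> n \<Longrightarrow> E i \<in> mixed_paths A i"
      and strict: "\<And>i j. (i, j) \<in> links \<Longrightarrow> i \<noteq> n \<Longrightarrow> j \<noteq> n \<Longrightarrow> i \<notin> B \<Longrightarrow> strictly_above (E j) (E i)"
    define S where "S y \<longleftrightarrow> (\<forall>j\<in>parents n. strictly_above (E j) y)" for y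
    define W where "W y \<longleftrightarrow> (\<forall>i\<in>children n. weakly_above y (E i))" for y
    define T where "T y = (\<Union>i\<in>children n. touch y (E i))" for y
    have ch: "i < k" "nest i n" "i \<noteq> n" "E i \<in> dyck i" if "i \<in> children n" for i
      proof -
      have "i \<notin> A" using that chA by blast
      then show "i < k" "nest i n" "i \<noteq> n" "E i \<in> dyck i"
        using that nest_irrefl E[of i] by (auto simp: children_def links_def mixed_paths_def)
    qed
    have pa: "j < k" "nest n j" "j \<noteq> n" "E j \<in> delannoy j" if "j \<in> parents n" for j
      using that nest_irrefl mixed_paths_delannoy[OF E] by (auto simp: parents_def links_def)
    have ends: "a i < b i" "E i (a i + 1) = u i - 2" "E i (b i - 1) = v i" if i: "i \<in> children n" for i
    proof -
      have neq: "l \<noteq> n" if "l = i \<or> nest l i" for l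
        using that ch[OF i] nest_asym by blast
      have lk: "strictly_above (E j) (E l)" if l: "(l, j) \<in> links" "j = i \<or> nest j i" for l j
      proof -
        have li: "nest l i" using linksD[OF l(1)] l(2) nest_trans by blast
        have "l \<notin> B"
        proof
          assume "l \<in> B"
          then have "l \<in> children n" using B nest_trans[OF li ch(2)[OF i]] by blast
          then have "rk l = rk i" using i by (auto simp: children_def links_def)
          then show False using nest_rank[OF _ ch(1)[OF i] li] linksD[OF l(1)] by simp
        qed
        then show ?thesis using strict[OF l(1)] neq l li by auto
      qed
      show "a i < b i" "E i (a i + 1) = u i - 2" "E i (b i - 1) = v i"
        using strict_links_corners(1-3)[of i E, OF ch(1)[OF i] rk[OF i] ch(4)[OF i] _ lk]
          neq mixed_paths_delannoy[OF E] by blast+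
    qed
    have fT: "finite (touch y (E i))" if "i \<in> children n" for y i
      using finite_subset[OF _ finite_supp_delannoy[OF dyckD(1)[OF ch(4)[OF that]]], of "touch y (E i)"]
      by (auto simp: touch_def supp_def)
    have dT: "touch y (E i) \<inter> touch y (E j) = {}" if "i \<in> children n" "j \<in> children n" "i \<noteq> j" for y i j
      using children_supp_disjoint[OF that dyckD(1)[OF ch(4)] dyckD(1)[OF ch(4)]] that
      by (auto simp: touch_def supp_def)
    have dyck_eq: "mixed_paths A n = dyck n" using n by (simp add: mixed_paths_def)
    have "local_sum (insert n A) (B - children n) n E = (\<Sum>f\<in>delannoy n. weight f *
        ((if \<forall>i\<in>children n. strictly_above f (E i) then 1 else 0) * (if S f then 1 else 0)))"
      unfolding local_sum_def using n
      by (auto simp: mixed_paths_def mixed_weight_def link_sign_def S_def prod_indicator finite_parents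
          finite_children intro!: sum.cong)
    also have "\<dots> = (\<Sum>y\<in>dyck n. if S y \<and> W y then
        \<Sum>f | f \<in> delannoy n \<and> round_up f = y \<and> T y \<subseteq> odds f. weight f else 0)"
    proof (rule sum_over_fibers)
      fix f assume f: "f \<in> delannoy n"
      show "round_up f \<in> dyck n" using round_up_dyck[OF f] .
      have "strictly_above (E j) f \<longleftrightarrow> strictly_above (E j) (round_up f)" if "j \<in> parents n" for j
        using strictly_above_round_up[OF f pa(4)[OF that]] pa(2)[OF that] by (simp add: nest_def)
      then have "S f \<longleftrightarrow> S (round_up f)" unfolding S_def by blast
      moreover have "strictly_above f (E i) \<longleftrightarrow> weakly_above (round_up f) (E i) \<and> touch (round_up f) (E i) \<subseteq> odds f"
        if "i \<in> children n" for i
        using touch_round_up[OF f ch(4)[OF that] _ _ ends[OF that]] ch(2)[OF that] by (simp add: nest_def)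
      then have "(\<forall>i\<in>children n. strictly_above f (E i)) \<longleftrightarrow> W (round_up f) \<and> T (round_up f) \<subseteq> odds f"
        unfolding W_def T_def by blast
      ultimately show "weight f * ((if \<forall>i\<in>children n. strictly_above f (E i) then 1 else 0) * (if S f then 1 else 0)) =
        (if (S (round_up f) \<and> W (round_up f)) \<and> T (round_up f) \<subseteq> odds f then weight f else 0)"
        by simp
    qed
    also have "\<dots> = (\<Sum>y\<in>dyck n. dyck_weight y * ((if W y then (-1) ^ card (T y) else 0) * (if S y then 1 else 0)))"
    proof (rule sum.cong[OF refl])
      fix y assume y: "y \<in> dyck n"
      have "T y \<subseteq> valleys y" if "W y" using that unfolding W_def T_def weakly_above_def by blast
      then show "(if S y \<and> W y then \<Sum>f | f \<in> delannoy n \<and> round_up f = y \<and> T y \<subseteq> odds f. weight f else 0) =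
          dyck_weight y * ((if W y then (-1) ^ card (T y) else 0) * (if S y then 1 else 0))"
        by (simp add: sum_weight_round_up[OF y])
    qed
    also have "\<dots> = local_sum A B n E"
      unfolding local_sum_def dyck_eq
    proof (rule sum.cong[OF refl])
      fix y assume y: "y \<in> dyck n"
      have "(\<Prod>i\<in>children n. if weakly_above y (E i) then (-1) ^ card (touch y (E i)) else 0 :: int) =
          (if W y then (-1) ^ card (T y) else 0)"
        unfolding W_def T_def by (rule prod_sign_indicator) (use finite_children fT dT in auto)
      moreover have "(\<Prod>i\<in>children n. if weakly_above y (E i) then (-1) ^ card (touch y (E i)) else 0 :: int) =
          (\<Prod>i\<in>children n. link_sign B i (E i) y)"
        by (rule prod.cong) (use chB in \<open>auto simp: link_sign_def\<close>)
      ultimately show "dyck_weight y * ((if W y then (-1) ^ card (T y) else 0) * (if S y then 1 else 0)) =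
        mixed_weight A n y * ((\<Prod>i\<in>children n. link_sign B i (E i) y) *
          (\<Prod>j\<in>parents n. link_sign B n y (E j)))"
        using n by (simp add: mixed_weight_def link_sign_def S_def prod_indicator finite_parents)
    qed
    finally show "1 * local_sum A B n E = local_sum (insert n A) (B - children n) n E" by simp
  qed
  then show ?thesis by simp
qed

lemma mixed_sum_cong_links:
  assumes "\<And>i j. (i, j) \<in> links \<Longrightarrow> i \<in> B \<longleftrightarrow> i \<in> B'"
  shows "mixed_sum A B = mixed_sum A B'"
proof -
  have "(\<Prod>(i, j)\<in>links. link_sign B i (D i) (D j)) = (\<Prod>(i, j)\<in>links. link_sign B' i (D i) (D j))" for D
  proof (rule prod.cong[OF refl])
    fix p assume "p \<in> links"
    then show "(case p of (i, j) \<Rightarrow> link_sign B i (D i) (D j)) = (case p of (i, j) \<Rightarrow> link_sign B' i (D i) (D j))"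
      using assms[of "fst p" "snd p"] by (simp add: link_sign_def case_prod_beta)
  qed
  then show ?thesis by (simp add: mixed_sum_def)
qed

definition rank_set :: "nat set \<Rightarrow> nat set" where
  "rank_set S = {i. i < k \<and> rk i \<in> S}"

lemma delannoy_to_dyck_rank:
  assumes "F \<subseteq> rank_set {r}" "0 < r" "rank_set {r} \<subseteq> A" "rank_set {Suc r} \<inter> A = {}"
  shows "2 ^ card F * mixed_sum A {} = mixed_sum (A - F) F"
proof -
  have "finite F" by (rule finite_subset[OF assms(1)]) (simp add: rank_set_def)
  then show ?thesis using assms(1)
  proof (induction F rule: finite_induct)
    case empty
    then show ?case by simp
  next
    case (insert n F)
    have n: "n < k" "rk n = r" "n \<in> A" using insert(4) assms(3) by (auto simp: rank_set_def)
    have F: "i < k" "rk i = r" if "i \<in> F" for i using that insert(4) by (auto simp: rank_set_def)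
    have "2 * mixed_sum (A - F) F = mixed_sum (A - F - {n}) (insert n F)"
    proof (rule delannoy_to_dyck)
      show "parents n \<inter> (A - F) = {}"
        using assms(4) n by (auto simp: parents_def links_def rank_set_def)
      show "\<not> nest i n" if "i \<in> F" for i using nest_rank[of i n] F[OF that] n by auto
    qed (use n insert assms(2) in auto)
    moreover have "A - F - {n} = A - insert n F" by auto
    ultimately show ?case using insert by (simp add: mult_ac)
  qed
qed

lemma dyck_to_delannoy_rank:
  assumes "G \<subseteq> rank_set {Suc r}" "0 < r" "rank_set {r} \<inter> A = {}" "rank_set {Suc r} \<inter> A = {}"
  shows "mixed_sum A (rank_set {r}) = mixed_sum (A \<union> G) (rank_set {r} - (\<Union>n\<in>G. children n))"
proof -
  have "finite G" by (rule finite_subset[OF assms(1)]) (simp add: rank_set_def)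
  then show ?thesis using assms(1)
  proof (induction G rule: finite_induct)
    case empty
    then show ?case by simp
  next
    case (insert n G)
    have n: "n < k" "rk n = Suc r" "n \<notin> A" using insert(4) assms(4) by (auto simp: rank_set_def)
    have G: "i < k" "rk i = Suc r" if "i \<in> G" for i using that insert(4) by (auto simp: rank_set_def)
    have ch: "children n \<subseteq> rank_set {r}" using n by (auto simp: children_def links_def rank_set_def)
    let ?B = "rank_set {r} - (\<Union>n\<in>G. children n)"
    have "mixed_sum (A \<union> G) ?B = mixed_sum (insert n (A \<union> G)) (?B - children n)"
    proof (rule dyck_to_delannoy)
      show "n \<notin> A \<union> G" using n insert by auto
      show "n \<notin> ?B" using n by (auto simp: rank_set_def)
      show "children n \<inter> (A \<union> G) = {}"
      proof (rule equals0I)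
        fix i assume i: "i \<in> children n \<inter> (A \<union> G)"
        then have "i \<in> rank_set {r}" using ch by blast
        then have "rk i = r" "i \<notin> A" using assms(3) by (auto simp: rank_set_def)
        then show False using i G(2)[of i] by auto
      qed
      show "children n \<subseteq> ?B"
      proof
        fix i assume i: "i \<in> children n"
        have "i \<notin> children m" if "m \<in> G" for m
          using parents_unique[of i n m] i that insert(2) by (auto simp: children_def parents_def dest: linksD)
        then show "i \<in> ?B" using ch i by auto
      qed
      show "i \<in> children n" if "i \<in> ?B" "nest i n" for i
        using that n by (auto simp: children_def links_def rank_set_def)
      show "0 < rk i" if "i \<in> children n" for i using ch that assms(2) by (auto simp: rank_set_def)
    qed (use n in auto)
    moreover have "?B - children n = rank_set {r} - (\<Union>n\<in>insert n G. children n)" by auto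
    ultimately show ?case using insert by simp
  qed
qed

text \<open>Together, rank \<open>r\<close> hands its diagonal steps to rank \<open>r + 1\<close>, at the price of one factor 2 for
  each path of rank \<open>r\<close>.\<close>

lemma mixed_sum_rank_step:
  assumes S: "r \<in> S" "Suc r \<notin> S" "0 < r"
  shows "2 ^ card (rank_set {r}) * mixed_sum (rank_set S) {} =
    mixed_sum (rank_set (insert (Suc r) (S - {r}))) {}"
proof -
  let ?A = "rank_set S - rank_set {r}"
  have "2 ^ card (rank_set {r}) * mixed_sum (rank_set S) {} = mixed_sum ?A (rank_set {r})"
    by (rule delannoy_to_dyck_rank[OF _ S(3)]) (use S in \<open>auto simp: rank_set_def\<close>)
  also have "\<dots> = mixed_sum (?A \<union> rank_set {Suc r}) (rank_set {r} - (\<Union>n\<in>rank_set {Suc r}. children n))"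
    by (rule dyck_to_delannoy_rank[OF _ S(3)]) (use S in \<open>auto simp: rank_set_def\<close>)
  also have "?A \<union> rank_set {Suc r} = rank_set (insert (Suc r) (S - {r}))"
    by (auto simp: rank_set_def)
  also have "mixed_sum \<dots> (rank_set {r} - (\<Union>n\<in>rank_set {Suc r}. children n)) = mixed_sum \<dots> {}"
  proof (rule mixed_sum_cong_links)
    fix i j assume ij: "(i, j) \<in> links"
    have "i \<in> (\<Union>n\<in>rank_set {Suc r}. children n)" if "i \<in> rank_set {r}"
      using that linksD[OF ij] ij by (auto simp: rank_set_def children_def)
    then show "i \<in> rank_set {r} - (\<Union>n\<in>rank_set {Suc r}. children n) \<longleftrightarrow> i \<in> {}" by blast
  qed
  finally show ?thesis .
qed

text \<open>The diagonal steps of rank \<open>r\<close> pass through all ranks above and leave at the top, where there are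
  no further paths.\<close>

lemma mixed_sum_rank_out:
  assumes R: "\<And>i. i < k \<Longrightarrow> rk i < R" and r: "0 < r" "r \<le> R" and S: "S \<subseteq> {..<r}"
  shows "2 ^ card {i. i < k \<and> r \<le> rk i} * mixed_sum (rank_set (insert r S)) {} = mixed_sum (rank_set S) {}"
  using r S
proof (induction "R - r" arbitrary: r S rule: less_induct)
  case (less r)
  note S = less(4)
  show ?case
  proof (cases "r = R")
    case True
    then have "{i. i < k \<and> r \<le> rk i} = {}" "rank_set (insert r S) = rank_set S"
      using R by (fastforce simp: rank_set_def)+
    then show ?thesis by simp
  next
    case False
    have "{i. i < k \<and> r \<le> rk i} = rank_set {r} \<union> {i. i < k \<and> Suc r \<le> rk i}"
      by (auto simp: rank_set_def)
    then have "card {i. i < k \<and> r \<le> rk i} = card (rank_set {r}) + card {i. i < k \<and> Suc r \<le> rk i}"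
      by (simp add: card_Un_disjoint rank_set_def disjoint_iff)
    then have "2 ^ card {i. i < k \<and> r \<le> rk i} * mixed_sum (rank_set (insert r S)) {} =
        2 ^ card {i. i < k \<and> Suc r \<le> rk i} * (2 ^ card (rank_set {r}) * mixed_sum (rank_set (insert r S)) {})"
      by (simp add: power_add mult_ac)
    also have "2 ^ card (rank_set {r}) * mixed_sum (rank_set (insert r S)) {} =
        mixed_sum (rank_set (insert (Suc r) (insert r S - {r}))) {}"
      by (rule mixed_sum_rank_step) (use S less(2) in auto)
    also have "insert r S - {r} = S" using S by auto
    also have "2 ^ card {i. i < k \<and> Suc r \<le> rk i} * mixed_sum (rank_set (insert (Suc r) S)) {} = mixed_sum (rank_set S) {}"
    proof (rule less(1))
      show "S \<subseteq> {..<Suc r}" using S by fastforce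
    qed (use less(2,3) False in auto)
    finally show ?thesis .
  qed
qed

lemma sum_ranks:
  assumes "\<And>i. i < k \<Longrightarrow> rk i \<le> R"
  shows "(\<Sum>r=1..R. card {i. i < k \<and> r \<le> rk i}) = (\<Sum>i<k. rk i)"
proof -
  have "(\<Sum>r=1..R. card {i. i < k \<and> r \<le> rk i}) = (\<Sum>r=1..R. \<Sum>i<k. if r \<le> rk i then 1 else 0)"
    by (intro sum.cong refl) (simp add: sum.If_cases Int_def lessThan_def)
  also have "\<dots> = (\<Sum>i<k. \<Sum>r=1..R. if r \<le> rk i then 1 else 0)" by (rule sum.swap)
  also have "\<dots> = (\<Sum>i<k. rk i)"
  proof (rule sum.cong[OF refl])
    fix i assume "i \<in> {..<k}"
    then have "{1..R} \<inter> {r. r \<le> rk i} = {1..rk i}" using assms[of i] by auto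
    then show "(\<Sum>r=1..R. if r \<le> rk i then 1 else 0) = rk i" by (simp add: sum.If_cases)
  qed
  finally show ?thesis .
qed

text \<open>Pushing the diagonal steps out of the top, from the highest rank down to rank 1, costs every
  path of rank \<open>r\<close> exactly \<open>r\<close> factors 2. In rank 0 there is nothing below that could be touched.\<close>

lemma mixed_sum_all:
  "2 ^ (\<Sum>i<k. rk i) * mixed_sum {..<k} {} = mixed_sum {} {}"
proof -
  define R where "R = Suc (Max (insert 0 (rk ` {..<k})))"
  have R: "rk i < R" if "i < k" for i
    unfolding R_def less_Suc_eq_le using that by (intro Max_ge) auto
  have out: "2 ^ (\<Sum>r=t+1..R. card {i. i < k \<and> r \<le> rk i}) * mixed_sum (rank_set {..R}) {} = mixed_sum (rank_set {..t}) {}"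
    if "t \<le> R" for t
    using that
  proof (induction t rule: inc_induct)
    case base
    then show ?case by simp
  next
    case (step t)
    have "{..Suc t} = insert (Suc t) {..t}" by auto
    then have "mixed_sum (rank_set {..t}) {} =
        2 ^ card {i. i < k \<and> Suc t \<le> rk i} * mixed_sum (rank_set {..Suc t}) {}"
      using mixed_sum_rank_out[OF R, of "Suc t" "{..t}"] step(2) by (simp add: lessThan_Suc_atMost)
    also have "\<dots> = 2 ^ card {i. i < k \<and> Suc t \<le> rk i} *
        (2 ^ (\<Sum>r=Suc t+1..R. card {i. i < k \<and> r \<le> rk i}) * mixed_sum (rank_set {..R}) {})"
      using step(3) by simp
    also have "\<dots> = 2 ^ (card {i. i < k \<and> Suc t \<le> rk i} + (\<Sum>r=Suc t+1..R. card {i. i < k \<and> r \<le> rk i})) *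
        mixed_sum (rank_set {..R}) {}"
      by (simp only: power_add mult.assoc)
    also have "card {i. i < k \<and> Suc t \<le> rk i} + (\<Sum>r=Suc t+1..R. card {i. i < k \<and> r \<le> rk i}) =
        (\<Sum>r=t+1..R. card {i. i < k \<and> r \<le> rk i})"
      using step(2) by (subst (2) sum.atLeast_Suc_atMost) auto
    finally show ?case by simp
  qed
  have leaves: "mixed_sum {} {} = mixed_sum G {}" if "G \<subseteq> rank_set {0}" for G
  proof -
    have "finite G" by (rule finite_subset[OF that]) (simp add: rank_set_def)
    then show ?thesis using that
    proof (induction G rule: finite_induct)
      case (insert n G)
      have n: "n < k" "children n = {}" using insert(4) by (auto simp: rank_set_def children_def links_def)
      then have "mixed_sum G {} = mixed_sum (insert n G) ({} - children n)"
        by (intro dyck_to_delannoy) (use insert in auto)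
      then show ?case using insert by simp
    qed simp
  qed
  have "2 ^ (\<Sum>r=1..R. card {i. i < k \<and> r \<le> rk i}) * mixed_sum (rank_set {..R}) {} = mixed_sum (rank_set {..0}) {}"
    using out[of 0] by simp
  moreover have "rank_set {..R} = {..<k}" using R by (auto simp: rank_set_def dest: less_imp_le)
  moreover have "(\<Sum>r=1..R. card {i. i < k \<and> r \<le> rk i}) = (\<Sum>i<k. rk i)"
    by (rule sum_ranks) (use R in \<open>auto dest: less_imp_le\<close>)
  moreover have "mixed_sum {} {} = mixed_sum (rank_set {..0}) {}" by (rule leaves) simp
  ultimately show ?thesis by simp
qed

lemma mixed_sum_no_weak_links:
  "mixed_sum A {} = (\<Sum>D\<in>Pi\<^sub>E {..<k} (mixed_paths A).
     if pairwise_disjoint k D then \<Prod>i<k. mixed_weight A i (D i) else 0)"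
  unfolding mixed_sum_def
proof (rule sum.cong[OF refl])
  fix D assume D: "D \<in> Pi\<^sub>E {..<k} (mixed_paths A)"
  have "(\<Prod>(i, j)\<in>links. link_sign {} i (D i) (D j)) =
      (\<Prod>p\<in>links. if strictly_above (D (snd p)) (D (fst p)) then 1 else 0)"
    by (rule prod.cong) (auto simp: link_sign_def)
  also have "\<dots> = (if \<forall>(i, j)\<in>links. strictly_above (D j) (D i) then 1 else 0)"
    unfolding prod_indicator[OF finite_links] by (auto simp: case_prod_beta)
  also have "(\<forall>(i, j)\<in>links. strictly_above (D j) (D i)) \<longleftrightarrow> pairwise_disjoint k D"
    using D by (intro pairwise_disjoint_iff_links[symmetric]) (auto simp: PiE_iff intro: mixed_paths_delannoy)
  finally show "(\<Prod>i<k. mixed_weight A i (D i)) * (\<Prod>(i, j)\<in>links. link_sign {} i (D i) (D j)) =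
      (if pairwise_disjoint k D then \<Prod>i<k. mixed_weight A i (D i) else 0)" by simp
qed

end

section \<open>Translation to lists of cells and to partitions\<close>

lemma young_diagram_cells:
  assumes "is_partition la"
  shows "young_diagram (cells la)"
proof
  define N where "N = Max (insert 0 (set la))"
  have "cells la \<subseteq> {1..int (length la)} \<times> {1..int N}"
  proof
    fix x assume "x \<in> cells la"
    then obtain i j where x: "x = (i, j)" "1 \<le> i" "i \<le> int (length la)" "1 \<le> j" "j \<le> int (la ! nat (i - 1))"
      by (auto simp: cells_def)
    have "la ! nat (i - 1) \<le> N" unfolding N_def using x by (intro Max_ge) auto
    then show "x \<in> {1..int (length la)} \<times> {1..int N}" using x by auto
  qed
  then show "finite (cells la)" by (rule finite_subset) auto
  show "1 \<le> i \<and> 1 \<le> j" if "(i, j) \<in> cells la" for i j using that by (auto simp: cells_def)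
  show "(i', j') \<in> cells la" if "(i, j) \<in> cells la" "1 \<le> i'" "i' \<le> i" "1 \<le> j'" "j' \<le> j" for i j i' j'
  proof -
    have "la ! nat (i - 1) \<le> la ! nat (i' - 1)"
      using assms that sorted_wrt_nth_less[of "(\<ge>)" la "nat (i' - 1)" "nat (i - 1)"]
      by (cases "i' = i") (auto simp: is_partition_def cells_def)
    then show ?thesis using that by (auto simp: cells_def)
  qed
qed

definition cell_content :: "cell \<Rightarrow> int" where
  "cell_content s = snd s - fst s"

definition path_fun :: "cell list \<Rightarrow> path" where
  "path_fun p c = (if cell_content (hd p) \<le> c \<and> c < cell_content (hd p) + int (length p)
     then 2 * fst (p ! nat (c - cell_content (hd p))) else 0)"

lemma dyck_path_content:
  assumes "dyck_path Y p" "i < length p"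
  shows "cell_content (p ! i) = cell_content (hd p) + int i"
  using assms(2)
proof (induction i)
  case 0
  then show ?case by (simp add: hd_conv_nth)
next
  case (Suc i)
  then have "up_step (p ! i) (p ! (i + 1)) \<or> down_step (p ! i) (p ! (i + 1))"
    using assms(1) by (auto simp: dyck_path_def)
  then have "cell_content (p ! (i + 1)) = cell_content (p ! i) + 1"
    by (cases "p ! i"; cases "p ! (i + 1)") (auto simp: up_step_def down_step_def cell_content_def)
  then show ?case using Suc by simp
qed

context young_diagram
begin

definition paths_between :: "cell \<Rightarrow> cell \<Rightarrow> path set" where
  "paths_between s t = dyck_paths (cell_content s) (2 * fst s) (cell_content t) (2 * fst t)"

lemma path_fun_nth:
  assumes "i < length p"
  shows "path_fun p (cell_content (hd p) + int i) = 2 * fst (p ! i)"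
  using assms by (simp add: path_fun_def)

lemma path_fun_dyck:
  assumes p: "dyck_path Y p"
  shows "path_fun p \<in> paths_between (hd p) (last p)"
  unfolding paths_between_def
proof (rule dyckI)
  let ?a = "cell_content (hd p)"
  have ne: "p \<noteq> []" using p by (simp add: dyck_path_def)
  have inY: "p ! i \<in> Y" if "i < length p" for i using p that by (auto simp: dyck_path_def)
  have pos: "0 < fst (p ! i)" if "i < length p" for i
    using inY[OF that] pos_Y by (cases "p ! i") force
  have last: "cell_content (last p) = ?a + int (length p) - 1" "last p = p ! (length p - 1)"
    using dyck_path_content[OF p, of "length p - 1"] ne by (auto simp: last_conv_nth of_nat_diff Suc_le_eq)
  obtain n where n: "length p = Suc n" using ne by (cases p) auto
  show "?a \<le> cell_content (last p)" using last n by simp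
  show "path_fun p ?a = 2 * fst (hd p)" using path_fun_nth[of 0 p] ne by (simp add: hd_conv_nth)
  show "path_fun p (cell_content (last p)) = 2 * fst (last p)"
    using path_fun_nth[of n p] last n by simp
  show "even (path_fun p c)" for c by (simp add: path_fun_def)
  have idx: "\<exists>i<length p. c = ?a + int i" if "?a \<le> c" "c \<le> cell_content (last p)" for c
    using that last n by (intro exI[of _ "nat (c - ?a)"]) auto
  show "path_fun p c \<noteq> 0 \<longleftrightarrow> ?a \<le> c \<and> c \<le> cell_content (last p)" for c
  proof
    assume "path_fun p c \<noteq> 0"
    then show "?a \<le> c \<and> c \<le> cell_content (last p)" using last by (auto simp: path_fun_def split: if_splits)
  next
    assume "?a \<le> c \<and> c \<le> cell_content (last p)"
    then show "path_fun p c \<noteq> 0" using idx[of c] path_fun_nth pos by force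
  qed
  show "vertex c (path_fun p c)" if "?a \<le> c" "c \<le> cell_content (last p)" for c
  proof -
    from idx[OF that] obtain i where i: "i < length p" "c = ?a + int i" by blast
    have "p ! i = (fst (p ! i), fst (p ! i) + c)"
      using dyck_path_content[OF p i(1)] i(2) by (simp add: cell_content_def prod_eq_iff)
    then show ?thesis using inY[OF i(1)] path_fun_nth[OF i(1)] i(2) by (simp add: vertex_even)
  qed
  show "path_fun p (c + 1) = path_fun p c \<or> path_fun p (c + 1) = path_fun p c - 2"
    if c: "?a \<le> c" "c < cell_content (last p)" for c
  proof -
    from idx[of c] c obtain i where i: "i < length p" "c = ?a + int i" by auto
    have i': "i + 1 < length p" using c i last n by auto
    then have "up_step (p ! i) (p ! (i + 1)) \<or> down_step (p ! i) (p ! (i + 1))"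
      using p by (auto simp: dyck_path_def)
    then have "fst (p ! (i + 1)) = fst (p ! i) \<or> fst (p ! (i + 1)) = fst (p ! i) - 1"
      by (cases "p ! i"; cases "p ! (i + 1)") (auto simp: up_step_def down_step_def)
    moreover have "path_fun p (c + 1) = 2 * fst (p ! (i + 1))"
      using path_fun_nth[OF i'] i(2) by (simp add: ac_simps)
    ultimately show ?thesis using path_fun_nth[OF i(1)] i(2) by auto
  qed
qed

lemma set_path_fun:
  assumes p: "dyck_path Y p"
  shows "(x, y) \<in> set p \<longleftrightarrow> 0 < x \<and> path_fun p (y - x) = 2 * x"
proof
  assume "(x, y) \<in> set p"
  then obtain i where i: "i < length p" "p ! i = (x, y)" by (auto simp: in_set_conv_nth)
  have "p ! i \<in> Y" using p i(1) by (auto simp: dyck_path_def)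
  then have "0 < x" using pos_Y[of x y] i(2) by simp
  moreover have "y - x = cell_content (hd p) + int i"
    using dyck_path_content[OF p i(1)] i(2) by (simp add: cell_content_def)
  ultimately show "0 < x \<and> path_fun p (y - x) = 2 * x" using path_fun_nth[OF i(1)] i(2) by simp
next
  assume r: "0 < x \<and> path_fun p (y - x) = 2 * x"
  let ?i = "nat (y - x - cell_content (hd p))"
  have c: "cell_content (hd p) \<le> y - x" "y - x < cell_content (hd p) + int (length p)"
    using r by (auto simp: path_fun_def split: if_splits)
  then have i: "?i < length p" "cell_content (hd p) + int ?i = y - x" by auto
  have "fst (p ! ?i) = x" using path_fun_nth[OF i(1)] i(2) r by simp
  moreover have "cell_content (p ! ?i) = y - x" using dyck_path_content[OF p i(1)] i(2) by simp
  ultimately have "p ! ?i = (x, y)" by (simp add: cell_content_def prod_eq_iff)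
  then show "(x, y) \<in> set p" using i(1) nth_mem by fastforce
qed

lemma path_fun_inj:
  assumes p: "dyck_path Y p" and q: "dyck_path Y q" and eq: "path_fun p = path_fun q"
  shows "p = q"
proof -
  note P = path_fun_dyck[OF p, unfolded paths_between_def] and Q = path_fun_dyck[OF q, unfolded paths_between_def]
  have ne: "p \<noteq> []" "q \<noteq> []" using p q by (auto simp: dyck_path_def)
  note DP = delannoyD[OF dyckD(1)[OF P]] and DQ = delannoyD[OF dyckD(1)[OF Q]]
  have iff: "cell_content (hd p) \<le> c \<and> c \<le> cell_content (last p) \<longleftrightarrow> cell_content (hd q) \<le> c \<and> c \<le> cell_content (last q)" for c
    using DP(6)[of c] DQ(6)[of c] eq by simp
  have hd: "cell_content (hd p) = cell_content (hd q)"
    using iff[of "cell_content (hd p)"] iff[of "cell_content (hd q)"] DP(1) DQ(1) by simp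
  have last: "cell_content (last p) = cell_content (last q)"
    using iff[of "cell_content (last p)"] iff[of "cell_content (last q)"] DP(1) DQ(1) by simp
  have "cell_content (last p) = cell_content (hd p) + int (length p - 1)"
    "cell_content (last q) = cell_content (hd q) + int (length q - 1)"
    using dyck_path_content[OF p, of "length p - 1"] dyck_path_content[OF q, of "length q - 1"] ne
    by (auto simp: last_conv_nth)
  then have "length p - 1 = length q - 1" using hd last by simp
  then have "length p = length q" using ne by (cases p; cases q) auto
  moreover have "p ! i = q ! i" if "i < length p" for i
  proof -
    have "i < length q" using that calculation by simp
    then show ?thesis
      using path_fun_nth[of i p] path_fun_nth[of i q] that eq hd
        dyck_path_content[OF p that] dyck_path_content[OF q, of i] by (simp add: cell_content_def prod_eq_iff)
  qed
  ultimately show ?thesis by (rule nth_equalityI)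
qed

lemma Dyck_surj:
  assumes f: "f \<in> paths_between s t"
  shows "\<exists>p\<in>Dyck Y s t. path_fun p = f"
proof -
  note F = f[unfolded paths_between_def]
  note D = delannoyD[OF dyckD(1)[OF F]]
  define a where "a = cell_content s"
  define n where "n = nat (cell_content t - a)"
  define g where "g i = (f (a + int i) div 2, f (a + int i) div 2 + (a + int i))" for i
  define p where "p = map g [0..<Suc n]"
  have b: "cell_content t = a + int n" using D(1) by (simp add: a_def n_def)
  have ev: "f c = 2 * (f c div 2)" for c using dyckD(2)[OF F, of c] by simp
  have len: "length p = Suc n" by (simp add: p_def)
  have nth: "p ! i = g i" if "i < Suc n" for i using that by (simp add: p_def del: upt_Suc)
  have st: "g 0 = s" "g n = t"
    using D(2,3) b by (auto simp: g_def a_def cell_content_def prod_eq_iff)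
  have hd: "hd p = s" using nth[of 0] st(1) len by (subst hd_conv_nth) auto
  have last: "last p = t" using nth[of n] st(2) len by (subst last_conv_nth) auto
  have "dyck_path Y p" unfolding dyck_path_def
  proof (intro conjI allI impI)
    show "p \<noteq> []" using len by auto
    show "set p \<subseteq> Y"
    proof
      fix x assume "x \<in> set p"
      then obtain i where i: "i < Suc n" "x = g i" using nth len by (metis in_set_conv_nth)
      have "vertex (a + int i) (2 * (f (a + int i) div 2))"
        using D(7)[of "a + int i"] i(1) b ev[of "a + int i"] by (simp add: a_def)
      then show "x \<in> Y" unfolding vertex_even i(2) g_def .
    qed
    fix i assume i: "i + 1 < length p"
    have "f (a + int i + 1) = f (a + int i) \<or> f (a + int i + 1) = f (a + int i) - 2"
      using dyckD(3)[OF F, of "a + int i"] i len b by (simp add: a_def)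
    then have "f (a + int i + 1) div 2 = f (a + int i) div 2 \<or> f (a + int i + 1) div 2 = f (a + int i) div 2 - 1"
      by auto
    then show "up_step (p ! i) (p ! (i + 1)) \<or> down_step (p ! i) (p ! (i + 1))"
      using i len nth[of i] nth[of "i + 1"]
      by (auto simp: g_def up_step_def down_step_def algebra_simps)
  qed
  moreover have "path_fun p = f"
  proof
    fix c
    show "path_fun p c = f c"
    proof (cases "a \<le> c \<and> c \<le> cell_content t")
      case True
      then have i: "nat (c - a) < Suc n" "a + int (nat (c - a)) = c" using b by auto
      then have "path_fun p c = 2 * (f c div 2)"
        using path_fun_nth[of "nat (c - a)" p] hd len nth[OF i(1)] by (simp add: g_def a_def)
      then show ?thesis using ev by simp
    next
      case False
      then show ?thesis using D(6)[of c] hd len b by (auto simp: path_fun_def a_def)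
    qed
  qed
  ultimately show ?thesis using hd last by (auto simp: Dyck_def)
qed

lemma Dyck_path_fun:
  assumes "p \<in> Dyck Y s t"
  shows "path_fun p \<in> paths_between s t"
  using assms path_fun_dyck[of p] by (auto simp: Dyck_def)

lemma paths_between_max:
  assumes f: "f \<in> dyck_paths a u b v" and g: "g \<in> dyck_paths a u b v"
  shows "(\<lambda>c. max (f c) (g c)) \<in> dyck_paths a u b v"
proof (rule dyckI)
  note F = delannoyD[OF dyckD(1)[OF f]] and G = delannoyD[OF dyckD(1)[OF g]]
  show "a \<le> b" "max (f a) (g a) = u" "max (f b) (g b) = v" using F(1-3) G(2,3) by auto
  show "even (max (f c) (g c))" for c using dyckD(2)[OF f] dyckD(2)[OF g] by (auto simp: max_def)
  show "max (f c) (g c) \<noteq> 0 \<longleftrightarrow> a \<le> c \<and> c \<le> b" for c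
    using F(6)[of c] G(6)[of c] F(8)[of c] G(8)[of c] by (auto simp: max_def)
  show "vertex c (max (f c) (g c))" if "a \<le> c" "c \<le> b" for c
    using F(7)[OF that] G(7)[OF that] by (simp add: max_def)
  show "max (f (c + 1)) (g (c + 1)) = max (f c) (g c) \<or> max (f (c + 1)) (g (c + 1)) = max (f c) (g c) - 2"
    if "a \<le> c" "c < b" for c
  proof -
    have "even (f c)" "even (g c)" using dyckD(2) f g by blast+
    then have "f c = g c \<or> f c + 2 \<le> g c \<or> g c + 2 \<le> f c" by presburger
    then show ?thesis using dyckD(3)[OF f that] dyckD(3)[OF g that] by auto
  qed
qed

lemma lowest_path_exists:
  assumes "f0 \<in> dyck_paths a u b v"
  shows "\<exists>f\<in>dyck_paths a u b v. \<forall>g\<in>dyck_paths a u b v. \<forall>c. g c \<le> f c"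
proof -
  let ?P = "dyck_paths a u b v" and ?d = "\<lambda>f. \<Sum>c=a..b. f c :: int"
  have fin: "finite (?d ` ?P)" using finite_dyck by simp
  have "Max (?d ` ?P) \<in> ?d ` ?P" by (rule Max_in[OF fin]) (use assms in auto)
  then obtain f where f: "f \<in> ?P" "?d f = Max (?d ` ?P)" by auto
  have "g c \<le> f c" if g: "g \<in> ?P" for g c
  proof (rule ccontr)
    assume less: "\<not> g c \<le> f c"
    let ?m = "\<lambda>c. max (f c) (g c)"
    have m: "?m \<in> ?P" by (rule paths_between_max[OF f(1) g])
    have c: "c \<in> {a..b}"
      using less delannoyD(6)[OF dyckD(1)[OF f(1)], of c] delannoyD(6)[OF dyckD(1)[OF g], of c] by auto
    have "?d f < ?d ?m" by (rule sum_strict_mono_ex1) (use less in \<open>auto intro!: bexI[OF _ c]\<close>)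
    moreover have "?d ?m \<le> Max (?d ` ?P)" using m by (intro Max_ge[OF fin]) auto
    ultimately show False using f(2) by simp
  qed
  then show ?thesis using f(1) by blast
qed

lemma lower_cell_iff:
  assumes p: "p \<in> Dyck Y s t" and q: "q \<in> Dyck Y s t"
  shows "(\<forall>x\<in>set q. \<exists>k\<ge>0. x + (k, k) \<in> set p) \<longleftrightarrow> (\<forall>c. path_fun q c \<le> path_fun p c)"
proof -
  have dp: "dyck_path Y p" and dq: "dyck_path Y q" using p q by (auto simp: Dyck_def)
  note P = Dyck_path_fun[OF p, unfolded paths_between_def] and Q = Dyck_path_fun[OF q, unfolded paths_between_def]
  note DP = delannoyD[OF dyckD(1)[OF P]] and DQ = delannoyD[OF dyckD(1)[OF Q]]
  show ?thesis
  proof (intro iffI allI ballI)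
    fix c assume l: "\<forall>x\<in>set q. \<exists>k\<ge>0. x + (k, k) \<in> set p"
    show "path_fun q c \<le> path_fun p c"
    proof (cases "path_fun q c = 0")
      case True
      then show ?thesis using delannoy_nonneg[OF dyckD(1)[OF P]] by simp
    next
      case False
      then have pos: "0 < path_fun q c" using delannoy_pos[OF dyckD(1)[OF Q]] by blast
      obtain r where r: "path_fun q c = 2 * r" using dyckD(2)[OF Q, of c] by (elim evenE)
      have "(r, r + c) \<in> set q" using set_path_fun[OF dq, of r "r + c"] r pos by simp
      then obtain k where "k \<ge> 0" "(r, r + c) + (k, k) \<in> set p" using l by blast
      then show ?thesis using set_path_fun[OF dp, of "r + k" "r + c + k"] r by simp
    qed
  next
    fix x assume r: "\<forall>c. path_fun q c \<le> path_fun p c" and x: "x \<in> set q"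
    obtain i j where ij: "x = (i, j)" by force
    have q': "0 < i" "path_fun q (j - i) = 2 * i" using set_path_fun[OF dq, of i j] x ij by auto
    obtain h where h: "path_fun p (j - i) = 2 * h" using dyckD(2)[OF P, of "j - i"] by (elim evenE)
    have hi: "i \<le> h" using r[rule_format, of "j - i"] h q' by simp
    then have "(h, h + (j - i)) \<in> set p" using set_path_fun[OF dp, of h "h + (j - i)"] h q'(1) by simp
    then have "x + (h - i, h - i) \<in> set p" by (simp add: ij algebra_simps)
    then show "\<exists>k\<ge>0. x + (k, k) \<in> set p" using hi by (intro exI[of _ "h - i"]) simp
  qed
qed

lemma lowest_path_Dyck:
  assumes "Dyck Y s t \<noteq> {}"
  shows "lowest_path Y s t \<in> Dyck Y s t"
    and "g \<in> paths_between s t \<Longrightarrow> g c \<le> path_fun (lowest_path Y s t) c"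
proof -
  let ?low = "\<lambda>p. p \<in> Dyck Y s t \<and> (\<forall>q\<in>Dyck Y s t. \<forall>x\<in>set q. \<exists>k\<ge>0. x + (k, k) \<in> set p)"
  obtain p0 where "p0 \<in> Dyck Y s t" using assms by blast
  then have "path_fun p0 \<in> paths_between s t" by (rule Dyck_path_fun)
  then obtain f where f: "f \<in> paths_between s t" "\<And>g c. g \<in> paths_between s t \<Longrightarrow> g c \<le> f c"
    unfolding paths_between_def using lowest_path_exists by meson
  obtain p where p: "p \<in> Dyck Y s t" "path_fun p = f" using Dyck_surj[OF f(1)] by blast
  have low: "?low p"
    using p lower_cell_iff[OF p(1)] f(2) Dyck_path_fun by simp
  have "p' = p" if "?low p'" for p'
  proof -
    have p': "p' \<in> Dyck Y s t" using that by blast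
    have "path_fun p c \<le> path_fun p' c" "path_fun p' c \<le> path_fun p c" for c
      using lower_cell_iff[OF p' p(1)] lower_cell_iff[OF p(1) p'] that low p(1) p' by blast+
    then have "path_fun p' = path_fun p" by (intro ext order.antisym)
    then show ?thesis using path_fun_inj p(1) p' by (auto simp: Dyck_def)
  qed
  then have "lowest_path Y s t = p"
    unfolding lowest_path_def using low by (intro the_equality) blast+
  then show "lowest_path Y s t \<in> Dyck Y s t"
    "g \<in> paths_between s t \<Longrightarrow> g c \<le> path_fun (lowest_path Y s t) c"
    using p f(2) by auto
qed

text \<open>The lowest path has no high peak, so it is the lowest family that consists of a single path.\<close>

lemma num_pleasant_lowest_eq:
  assumes s: "southmost_in_column Y s" and t: "eastmost_in_row Y t"
  shows "int (num_pleasant_lowest Y s t) = (\<Sum>f\<in>paths_between s t. dyck_weight f)"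
proof (cases "Dyck Y s t = {}")
  case True
  then have "paths_between s t = {}" using Dyck_surj by blast
  then show ?thesis using True by (simp add: num_pleasant_lowest_def)
next
  case False
  define p where "p = lowest_path Y s t"
  have p: "p \<in> Dyck Y s t" "\<And>g c. g \<in> paths_between s t \<Longrightarrow> g c \<le> path_fun p c"
    using lowest_path_Dyck[OF False] by (auto simp: p_def)
  have f: "path_fun p \<in> paths_between s t" using Dyck_path_fun[OF p(1)] .
  interpret F: rim_family Y "Suc 0" "\<lambda>_. cell_content s" "\<lambda>_. 2 * fst s" "\<lambda>_. cell_content t" "\<lambda>_. 2 * fst t" "\<lambda>_. path_fun p"
  proof
    show "path_fun p \<in> dyck_paths (cell_content s) (2 * fst s) (cell_content t) (2 * fst t)"
      using f by (simp add: paths_between_def)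
    show "pairwise_disjoint (Suc 0) (\<lambda>_. path_fun p)" by (simp add: pairwise_disjoint_def)
    show "(2 * fst s div 2 + 1, 2 * fst s div 2 + cell_content s) \<notin> Y"
      using s by (auto simp: southmost_in_column_def cell_content_def)
    show "(2 * fst t div 2, 2 * fst t div 2 + cell_content t + 1) \<notin> Y"
      using t by (auto simp: eastmost_in_row_def cell_content_def)
  qed
  define D where "D = (\<lambda>i\<in>{..<Suc 0}. path_fun p)"
  have D: "D \<in> F.families"
    using f by (auto simp: D_def F.families_def paths_between_def pairwise_disjoint_def)
  have "c \<notin> high_peaks (path_fun p)" for c
  proof
    assume "c \<in> high_peaks (path_fun p)"
    then have "(path_fun p)(c := path_fun p c + 2) \<in> paths_between s t"
      using lower_peak_dyck f by (simp add: paths_between_def)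
    then show False using p(2)[of _ c] by force
  qed
  then have low: "F.lowest D" by (simp add: F.lowest_def D_def)
  have dp: "dyck_path Y p" using p(1) by (simp add: Dyck_def)
  have cells: "F.path_cells D = set p"
    using set_path_fun[OF dp] by (auto simp: F.path_cells_def D_def)
  have "int (num_pleasant Y (Y - set p)) = (\<Sum>E\<in>F.families. \<Prod>i<Suc 0. dyck_weight (E i))"
    using F.num_pleasant_eq_families[OF D low] cells by simp
  also have "F.families = (\<Pi>\<^sub>E i\<in>{..<Suc 0}. paths_between s t)"
    by (auto simp: F.families_def paths_between_def pairwise_disjoint_def)
  also have "(\<Sum>E\<in>(\<Pi>\<^sub>E i\<in>{..<Suc 0}. paths_between s t). \<Prod>i<Suc 0. dyck_weight (E i)) =
      (\<Sum>f\<in>paths_between s t. dyck_weight f)"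
  proof -
    have none: "{..<Suc 0} - {0} = {}" by auto
    have "(\<Sum>E\<in>(\<Pi>\<^sub>E i\<in>{..<Suc 0}. paths_between s t). \<Prod>i<Suc 0. dyck_weight (E i)) =
        (\<Sum>E\<in>(\<Pi>\<^sub>E i\<in>{..<Suc 0} - {0}. paths_between s t). \<Sum>f\<in>paths_between s t.
           \<Prod>i<Suc 0. dyck_weight ((E(0 := f)) i))"
      by (rule sum_PiE_coordinate) simp
    then show ?thesis unfolding none by simp
  qed
  finally show ?thesis using False by (simp add: num_pleasant_lowest_def p_def)
qed

end

context rim_family
begin

lemma ends_distinct:
  assumes "i < k" "j < k" "i \<noteq> j"
  shows "a i \<noteq> a j" "b i \<noteq> b j"
  using laminar[OF assms, of "a i"] laminar[OF assms, of "b i"] a_le_b assms(1,2)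
  by (auto simp: nest_def)

text \<open>Disjoint paths can connect the starts with the ends only in the given way: the intervals of
  contents form a noncrossing matching, and there is only one. A shortest interval that is
  matched differently would have to contain a shorter one.\<close>

lemma disjoint_imp_identity:
  assumes \<sigma>: "\<sigma> permutes {..<k}"
    and D: "\<And>i. i < k \<Longrightarrow> D i \<in> delannoy_paths (a i) (u i) (b (\<sigma> i)) (v (\<sigma> i))"
    and dj: "pairwise_disjoint k D" and "i < k"
  shows "\<sigma> i = i"
  using \<open>i < k\<close>
proof (induction "nat (b i - a i)" arbitrary: i rule: less_induct)
  case less
  have \<sigma>k: "\<sigma> l < k" if "l < k" for l using permutes_in_image[OF \<sigma>, of l] that by auto
  show ?case
  proof (rule ccontr)
    assume neq: "\<sigma> i \<noteq> i"
    obtain j where j: "j < k" "\<sigma> j = i"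
      using permutes_surj[OF \<sigma>] permutes_not_in[OF \<sigma>] less(2) by (metis lessThan_iff surjD)
    have ji: "j \<noteq> i" using j neq by auto
    have Dj: "D j \<in> delannoy_paths (a j) (u j) (b i) (v i)" using D[OF j(1)] j(2) by simp
    have fixed: "\<sigma> l = l" if "l < k" "nest l i" for l
      using less(1)[OF nest_length[OF that] that(1)] .
    consider "a i < a j" | "a j < a i" using ends_distinct(1)[OF less(2) j(1)] ji by linarith
    then show False
    proof cases
      case 1
      then have "nest j i"
        using laminar[OF j(1) less(2) ji, of "a j"] delannoyD(1)[OF Dj] a_le_b[OF j(1)] by (auto simp: nest_def)
      then show False using fixed[OF j(1)] j(2) ji by simp
    next
      case 2
      have "disjoint_paths (D j) (D i)" using dj j(1) less(2) ji by (auto simp: pairwise_disjoint_def)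
      then have lt: "b (\<sigma> i) < b i"
        using disjoint_rim_paths_nested(1)[OF Dj D[OF less(2)] _ rim_start[OF less(2)] rim_end[OF less(2)] 2]
          a_le_b[OF less(2)] by simp
      let ?l = "\<sigma> i"
      have l: "?l < k" using \<sigma>k[OF less(2)] .
      have "a i \<le> b ?l" using delannoyD(1)[OF D[OF less(2)]] .
      then have "nest ?l i"
        using laminar[OF l less(2) neq, of "b ?l"] a_le_b[OF l] lt by (auto simp: nest_def)
      then have "\<sigma> ?l = ?l" using fixed[OF l] by simp
      then show False using permutes_inj[OF \<sigma>] neq by (simp add: inj_eq)
    qed
  qed
qed

lemma det_eq_disjoint_delannoy:
  "det (mat k k (\<lambda>(i, j). \<Sum>f\<in>delannoy_paths (a i) (u i) (b j) (v j). weight f)) =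
    (\<Sum>D\<in>(\<Pi>\<^sub>E i\<in>{..<k}. delannoy i). if pairwise_disjoint k D then \<Prod>i<k. weight (D i) else 0)"
proof -
  define S where "S c x = {y. half_step x y \<and> vertex (c + 1) y}" for c x
  let ?q = "\<lambda>x::int. if even x then 2 else -1 :: int"
  have layered: "delannoy_paths (a i) (u i) (b j) (v j) = layered_paths S (a i) (u i) (b j) (v j)"
    if "i < k" "j < k" for i j
    unfolding S_def using rim_start[OF that(1)] rim_end[OF that(2)]
    by (intro delannoy_eq_layered) (auto simp: rim_def)
  have S0: "0 \<notin> S c x" for c x using vertex_pos by (auto simp: S_def)
  have Sfin: "finite (S c x)" for c x
    by (rule finite_subset[of _ "{x, x - 1, x - 2}"]) (auto simp: S_def half_step_def)
  have u0: "u i \<noteq> 0" if "i < k" for i using rim_start[OF that] vertex_pos by (force simp: rim_def)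
  interpret layered_graph S b v ?q k by standard (fact S0 Sfin)+
  let ?I = "\<lambda>\<sigma>. \<Sum>D\<in>(\<Pi>\<^sub>E i\<in>{..<k}. delannoy_paths (a i) (u i) (b (\<sigma> i)) (v (\<sigma> i))).
      if pairwise_disjoint k D then \<Prod>i<k. weight (D i) else 0"
  have "mat k k (\<lambda>(i, j). \<Sum>f\<in>delannoy_paths (a i) (u i) (b j) (v j). weight f) =
      mat k k (\<lambda>(i, j). \<Sum>f\<in>layered_paths S (a i) (u i) (b j) (v j). path_weight ?q f)"
    by (rule eq_matI) (auto simp: layered weight_def)
  then have "det (mat k k (\<lambda>(i, j). \<Sum>f\<in>delannoy_paths (a i) (u i) (b j) (v j). weight f)) =
      (\<Sum>\<sigma> | \<sigma> permutes {..<k}. signof \<sigma> *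
        (\<Sum>D\<in>(\<Pi>\<^sub>E i\<in>{..<k}. layered_paths S (a i) (u i) (b (\<sigma> i)) (v (\<sigma> i))).
           if pairwise_disjoint k D then \<Prod>i<k. path_weight ?q (D i) else 0))"
    using lindstrom_gessel_viennot[of u a] u0 by simp
  also have "\<dots> = (\<Sum>\<sigma> | \<sigma> permutes {..<k}. signof \<sigma> * ?I \<sigma>)"
  proof (rule sum.cong[OF refl])
    fix \<sigma> assume "\<sigma> \<in> {\<sigma>. \<sigma> permutes {..<k}}"
    then have "\<sigma> i < k" if "i < k" for i using that permutes_in_image[of \<sigma> "{..<k}" i] by auto
    then have "(\<Pi>\<^sub>E i\<in>{..<k}. layered_paths S (a i) (u i) (b (\<sigma> i)) (v (\<sigma> i))) =
        (\<Pi>\<^sub>E i\<in>{..<k}. delannoy_paths (a i) (u i) (b (\<sigma> i)) (v (\<sigma> i)))"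
      by (intro PiE_cong) (auto simp: layered)
    then show "signof \<sigma> * (\<Sum>D\<in>(\<Pi>\<^sub>E i\<in>{..<k}. layered_paths S (a i) (u i) (b (\<sigma> i)) (v (\<sigma> i))).
           if pairwise_disjoint k D then \<Prod>i<k. path_weight ?q (D i) else 0) = signof \<sigma> * ?I \<sigma>"
      unfolding weight_def by simp
  qed
  also have "\<dots> = (\<Sum>\<sigma>\<in>{id}. signof \<sigma> * ?I \<sigma>)"
  proof (rule sum.mono_neutral_right)
    show "finite {\<sigma>. \<sigma> permutes {..<k}}" by (rule finite_permutations) simp
    show "{id} \<subseteq> {\<sigma>. \<sigma> permutes {..<k}}" by (simp add: permutes_id)
    show "\<forall>\<sigma>\<in>{\<sigma>. \<sigma> permutes {..<k}} - {id}. signof \<sigma> * ?I \<sigma> = 0"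
    proof
      fix \<sigma> assume "\<sigma> \<in> {\<sigma>. \<sigma> permutes {..<k}} - {id}"
      then have \<sigma>: "\<sigma> permutes {..<k}" "\<sigma> \<noteq> id" by auto
      have "\<not> pairwise_disjoint k D"
        if D: "D \<in> (\<Pi>\<^sub>E i\<in>{..<k}. delannoy_paths (a i) (u i) (b (\<sigma> i)) (v (\<sigma> i)))" for D
      proof
        assume dj: "pairwise_disjoint k D"
        have "\<sigma> i = i" for i
        proof (cases "i < k")
          case True
          show ?thesis by (rule disjoint_imp_identity[OF \<sigma>(1) _ dj True]) (use D in auto)
        next
          case False
          then show ?thesis using permutes_not_in[OF \<sigma>(1)] by simp
        qed
        then show False using \<sigma>(2) by auto
      qed
      then have "?I \<sigma> = 0" by (intro sum.neutral) auto
      then show "signof \<sigma> * ?I \<sigma> = 0" by simp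
    qed
  qed
  finally show ?thesis by simp
qed

end

section \<open>The determinant formula\<close>

lemma rank_function_unique:
  fixes len :: "'a \<Rightarrow> nat"
  assumes r: "rank_function A lt r" "rank_function A lt r'"
    and cover: "\<And>x y. x \<in> A \<Longrightarrow> y \<in> A \<Longrightarrow> lt x y \<Longrightarrow> \<exists>z. covered_by A lt z y"
    and len: "\<And>x y. x \<in> A \<Longrightarrow> y \<in> A \<Longrightarrow> lt x y \<Longrightarrow> len x < len y" and "x \<in> A"
  shows "r x = r' x"
  using \<open>x \<in> A\<close>
proof (induction "len x" arbitrary: x rule: less_induct)
  case less
  show ?case
  proof (cases "minimal_in A lt x")
    case True
    then show ?thesis using r by (simp add: rank_function_def)
  next
    case False
    then obtain z where "covered_by A lt z x" using less(2) cover by (auto simp: minimal_in_def)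
    then show ?thesis
      using r less(1)[of z] len[of z x] by (auto simp: rank_function_def covered_by_def)
  qed
qed

theorem corollary6p3:
  fixes la mu :: "nat list" and Ls :: "cell list list"
  assumes "is_partition la" and "is_partition mu" and "cells mu \<subseteq> cells la"
    and "kreiman_decomposition (cells la) (cells mu) Ls"
    and "ranked (set Ls) strictly_below"
    and "\<And>p q. \<lbrakk>p \<in> set Ls; q \<in> set Ls; strictly_below p q\<rbrakk> \<Longrightarrow>
           first_step_up q \<and> last_step_down q \<and> (\<forall>u. is_peak q u \<longrightarrow> is_high_peak (cells la) q u)"
  shows "int (num_pleasant (cells la) (cells mu)) =
    2 ^ (\<Sum>i<length Ls. poset_rank (set Ls) strictly_below (Ls ! i)) *
    det (mat (length Ls) (length Ls)
      (\<lambda>(i, j). int (num_pleasant_lowest (cells la) (hd (Ls ! i)) (last (Ls ! j)))))"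
proof -
  define Y where "Y = cells la"
  define M where "M = cells mu"
  define k where "k = length Ls"
  define lt where "lt = strictly_below"
  define s where "s i = hd (Ls ! i)" for i
  define t where "t i = last (Ls ! i)" for i
  interpret young_diagram Y unfolding Y_def using young_diagram_cells[OF assms(1)] .
  interpret M: young_diagram M unfolding M_def using young_diagram_cells[OF assms(2)] .
  have MY: "M \<subseteq> Y" using assms(3) by (simp add: M_def Y_def)
  have kd: "kreiman_decomposition Y M Ls" using assms(4) by (simp add: Y_def M_def)
  have path: "dyck_path Y (Ls ! i)" "southmost_in_column Y (s i)" "eastmost_in_row Y (t i)" if "i < k" for i
    using kd that by (auto simp: kreiman_decomposition_def k_def s_def t_def)
  have path_disj: "set (Ls ! i) \<inter> set (Ls ! j) = {}" if "i < k" "j < k" "i \<noteq> j" for i j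
    using kd that by (auto simp: kreiman_decomposition_def k_def)
  have union: "(\<Union>i<k. set (Ls ! i)) = Y - M"
  proof -
    have "set Ls = (\<lambda>i. Ls ! i) ` {..<k}" by (auto simp: set_conv_nth k_def)
    moreover have "\<Union> (set ` set Ls) = Y - M" using kd unfolding kreiman_decomposition_def by blast
    ultimately show ?thesis by simp
  qed
  define L where "L i = path_fun (Ls ! i)" for i
  have L: "L i \<in> paths_between (s i) (t i)" if "i < k" for i
    unfolding L_def s_def t_def by (rule path_fun_dyck[OF path(1)[OF that]])
  have mem: "(x, y) \<in> set (Ls ! i) \<longleftrightarrow> 0 < x \<and> L i (y - x) = 2 * x" if "i < k" for i x y
    unfolding L_def by (rule set_path_fun[OF path(1)[OF that]])
  interpret F: rim_family Y k "\<lambda>i. cell_content (s i)" "\<lambda>i. 2 * fst (s i)" "\<lambda>i. cell_content (t i)" "\<lambda>i. 2 * fst (t i)" L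
  proof
    show Ld: "L i \<in> dyck_paths (cell_content (s i)) (2 * fst (s i)) (cell_content (t i)) (2 * fst (t i))" if "i < k" for i
      using L[OF that] by (simp add: paths_between_def)
    show "pairwise_disjoint k L" unfolding pairwise_disjoint_def disjoint_paths_def
    proof (intro allI impI)
      fix i j c assume *: "i < k" "j < k" "i \<noteq> j" "L i c = L j c"
      show "L i c = 0"
      proof (rule ccontr)
        assume nz: "L i c \<noteq> 0"
        obtain r where r: "L i c = 2 * r" using dyckD(2)[OF Ld[OF *(1)], of c] by (elim evenE)
        have "0 < r" using delannoy_pos[OF dyckD(1)[OF Ld[OF *(1)]] nz] r by simp
        then have "(r, r + c) \<in> set (Ls ! i)" "(r, r + c) \<in> set (Ls ! j)"
          using mem[OF *(1)] mem[OF *(2)] r *(4) by auto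
        then show False using path_disj[OF *(1-3)] by blast
      qed
    qed
    show "(2 * fst (s i) div 2 + 1, 2 * fst (s i) div 2 + cell_content (s i)) \<notin> Y" if "i < k" for i
      using path(2)[OF that] by (auto simp: southmost_in_column_def cell_content_def)
    show "(2 * fst (t i) div 2, 2 * fst (t i) div 2 + cell_content (t i) + 1) \<notin> Y" if "i < k" for i
      using path(3)[OF that] by (auto simp: eastmost_in_row_def cell_content_def)
  qed
  define D where "D = restrict L {..<k}"
  have D: "D \<in> F.families"
    using F.L_dyck F.L_disjoint by (auto simp: D_def F.families_def pairwise_disjoint_def)
  have cells_D: "F.path_cells D = Y - M"
  proof -
    have "(x, y) \<in> F.path_cells D \<longleftrightarrow> (\<exists>i<k. (x, y) \<in> set (Ls ! i))" for x y
      using mem by (auto simp: F.path_cells_def D_def)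
    then show ?thesis unfolding union[symmetric] by auto
  qed
  \<comment> \<open>Since \<open>M\<close> is a diagram, a cell southeast of a cell outside of \<open>M\<close> is not in \<open>M\<close> either.\<close>
  have closed: "\<exists>j<k. L j c = L i c + 2" if i: "i < k" "L i c \<noteq> 0" "vertex c (L i c + 2)" for i c
  proof -
    obtain r where r: "L i c = 2 * r" using dyckD(2)[OF F.L_dyck[OF i(1)], of c] by (elim evenE)
    have r0: "0 < r" using delannoy_pos[OF F.L_delannoy[OF i(1)] i(2)] r by simp
    then have "(r, r + c) \<in> Y - M"
      using mem[OF i(1), of r "r + c"] r union i(1) by auto
    moreover have "1 \<le> r" "1 \<le> r + c" using pos_Y calculation by blast+
    ultimately have "(r + 1, r + 1 + c) \<notin> M" using M.down_Y[of "r + 1" "r + 1 + c" r "r + c"] by auto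
    moreover have "(r + 1, r + 1 + c) \<in> Y" using i(3) r vertex_even[of c "r + 1"] by (simp add: algebra_simps)
    ultimately obtain j where "j < k" "(r + 1, r + 1 + c) \<in> set (Ls ! j)" using union by blast
    then show ?thesis using mem[of j "r + 1" "r + 1 + c"] r by auto
  qed
  have lt_iff: "lt (Ls ! i) (Ls ! j) \<longleftrightarrow> F.nest i j" if ij: "i < k" "j < k" for i j
  proof
    assume below: "lt (Ls ! i) (Ls ! j)"
    have ne: "Ls ! i \<noteq> []" using path(1)[OF ij(1)] by (simp add: dyck_path_def)
    then have hd: "s i \<in> set (Ls ! i)" by (simp add: s_def)
    have "i \<noteq> j" using below ne by (auto simp: lt_def strictly_below_def)
    obtain x y where xy: "s i = (x, y)" by force
    obtain m where m: "0 \<le> m" "(x - m, y - m) \<in> set (Ls ! j)"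
      using below hd xy by (force simp: lt_def strictly_below_def weakly_below_def)
    have 1: "0 < x" "L i (y - x) = 2 * x" using mem[OF ij(1)] hd xy by auto
    have 2: "0 < x - m" "L j (y - x) = 2 * (x - m)" using mem[OF ij(2)] m(2) by auto
    show "F.nest i j" using F.L_nested[OF ij \<open>i \<noteq> j\<close>, of "y - x"] 1 2 m(1) by auto
  next
    assume nest: "F.nest i j"
    have neq: "i \<noteq> j" using nest F.nest_irrefl by auto
    have "\<exists>m\<ge>0. x - (m, m) \<in> set (Ls ! j)" if x: "x \<in> set (Ls ! i)" for x
    proof -
      obtain p q where pq: "x = (p, q)" by force
      have i: "0 < p" "L i (q - p) = 2 * p" using mem[OF ij(1)] x pq by auto
      have "L j (q - p) \<noteq> 0"
        using i nest delannoyD(6)[OF F.L_delannoy[OF ij(1)], of "q - p"]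
          delannoyD(6)[OF F.L_delannoy[OF ij(2)], of "q - p"] by (auto simp: F.nest_def)
      then have pos: "0 < L j (q - p)" using delannoy_pos[OF F.L_delannoy[OF ij(2)]] by blast
      have less: "L j (q - p) < L i (q - p)"
        using F.L_nested[OF ij neq, of "q - p"] i pos nest F.nest_asym by auto
      obtain h where h: "L j (q - p) = 2 * h" using dyckD(2)[OF F.L_dyck[OF ij(2)], of "q - p"] by (elim evenE)
      have "(h, h + (q - p)) \<in> set (Ls ! j)" using mem[OF ij(2), of h "h + (q - p)"] h pos by simp
      then have "x - (p - h, p - h) \<in> set (Ls ! j)" by (simp add: pq algebra_simps)
      then show ?thesis using less h i by (intro exI[of _ "p - h"]) simp
    qed
    then show "lt (Ls ! i) (Ls ! j)"
      using path_disj[OF ij neq] by (auto simp: lt_def strictly_below_def weakly_below_def)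
  qed
  \<comment> \<open>Of the paths between two nested ones, a longest one is covered by the outer one.\<close>
  have cover: "\<exists>l<k. covered_by (set Ls) lt (Ls ! l) (Ls ! j) \<and> F.nest l j \<and> (l = i \<or> F.nest i l)"
    if ij: "i < k" "j < k" "F.nest i j" for i j
  proof -
    let ?P = "{l. l < k \<and> F.nest l j \<and> (l = i \<or> F.nest i l)}"
    let ?len = "\<lambda>l. nat (cell_content (t l) - cell_content (s l))"
    have fin: "finite (?len ` ?P)" by simp
    have "Max (?len ` ?P) \<in> ?len ` ?P" by (rule Max_in[OF fin]) (use ij in auto)
    then obtain l where l: "l \<in> ?P" "?len l = Max (?len ` ?P)" by (metis (no_types, lifting) imageE)
    have "\<not> (\<exists>z\<in>set Ls. lt (Ls ! l) z \<and> lt z (Ls ! j))"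
    proof
      assume "\<exists>z\<in>set Ls. lt (Ls ! l) z \<and> lt z (Ls ! j)"
      then obtain m where m: "m < k" "lt (Ls ! l) (Ls ! m)" "lt (Ls ! m) (Ls ! j)"
        by (auto simp: set_conv_nth k_def)
      then have n: "F.nest l m" "F.nest m j" using lt_iff l(1) ij(2) by auto
      then have "m \<in> ?P" using l(1) m(1) F.nest_trans by blast
      then have "?len m \<le> ?len l" unfolding l(2) by (intro Max_ge[OF fin]) auto
      then show False using F.nest_length[OF _ n(1)] l(1) by auto
    qed
    then have "covered_by (set Ls) lt (Ls ! l) (Ls ! j)"
      using l(1) ij lt_iff by (auto simp: covered_by_def k_def)
    then show ?thesis using l(1) by blast
  qed
  obtain r where r: "rank_function (set Ls) lt r" using assms(5) by (auto simp: ranked_def lt_def)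
  define rk where "rk i = r (Ls ! i)" for i
  have idx: "\<exists>i<k. x = Ls ! i" if "x \<in> set Ls" for x using that by (auto simp: set_conv_nth k_def)
  have rank: "poset_rank (set Ls) lt (Ls ! i) = rk i" if i: "i < k" for i
    unfolding poset_rank_def
  proof (rule the_equality)
    show "\<exists>r. rank_function (set Ls) lt r \<and> r (Ls ! i) = rk i" using r by (auto simp: rk_def)
    fix n assume "\<exists>r. rank_function (set Ls) lt r \<and> r (Ls ! i) = n"
    then obtain r' where r': "rank_function (set Ls) lt r'" "r' (Ls ! i) = n" by blast
    define len where "len x = length x" for x :: "cell list"
    have len_eq: "int (length (Ls ! l)) = cell_content (t l) - cell_content (s l) + 1" if "l < k" for l
    proof -
      have "Ls ! l \<noteq> []" using path(1)[OF that] by (simp add: dyck_path_def)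
      then show ?thesis
        using dyck_path_content[OF path(1)[OF that], of "length (Ls ! l) - 1"]
        by (simp add: s_def t_def last_conv_nth of_nat_diff Suc_le_eq)
    qed
    have "r' (Ls ! i) = r (Ls ! i)"
    proof (rule rank_function_unique[OF r'(1) r, of len])
      fix x y assume xy: "x \<in> set Ls" "y \<in> set Ls" "lt x y"
      then obtain i j where ij: "i < k" "j < k" "x = Ls ! i" "y = Ls ! j" using idx by blast
      then have nest: "F.nest i j" using lt_iff xy(3) by blast
      show "\<exists>z. covered_by (set Ls) lt z y" using cover[OF ij(1,2) nest] ij(4) by blast
      show "len x < len y" using nest len_eq[OF ij(1)] len_eq[OF ij(2)] ij
        by (auto simp: F.nest_def len_def)
    qed (use i in \<open>auto simp: k_def\<close>)
    then show "n = rk i" using r'(2) by (simp add: rk_def)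
  qed
  have corner: "c \<in> peaks (L j) \<Longrightarrow> vertex c (L j c + 2)" "cell_content (s j) < cell_content (t j)"
    "L j (cell_content (s j) + 1) = 2 * fst (s j) - 2" "L j (cell_content (t j) - 1) = 2 * fst (t j)"
    if ij: "i < k" "j < k" "F.nest i j" for i j c
  proof -
    let ?p = "Ls ! j"
    have H: "first_step_up ?p" "last_step_down ?p" "\<And>u. is_peak ?p u \<Longrightarrow> is_high_peak Y ?p u"
      using assms(6)[of "Ls ! i" ?p] lt_iff[OF ij(1,2)] ij by (auto simp: lt_def k_def Y_def)
    have dp: "dyck_path Y ?p" using path(1)[OF ij(2)] .
    have two: "2 \<le> length ?p" using H(1) by (simp add: first_step_up_def)
    have ne: "?p \<noteq> []" using two by auto
    have val: "L j (cell_content (s j) + int l) = 2 * fst (?p ! l)" if "l < length ?p" for l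
      unfolding L_def s_def by (rule path_fun_nth[OF that])
    have tl: "cell_content (t j) = cell_content (s j) + int (length ?p - 1)"
      using dyck_path_content[OF dp, of "length ?p - 1"] ne by (simp add: s_def t_def last_conv_nth)
    show "cell_content (s j) < cell_content (t j)" using tl two by simp
    have "fst (?p ! 1) = fst (?p ! 0) - 1"
      using H(1) by (cases "?p ! 0"; cases "?p ! 1") (auto simp: first_step_up_def up_step_def)
    then show "L j (cell_content (s j) + 1) = 2 * fst (s j) - 2"
      using val[of 1] two ne by (simp add: s_def hd_conv_nth)
    have "fst (?p ! (length ?p - 2)) = fst (?p ! (length ?p - 1))"
      using H(2) by (cases "?p ! (length ?p - 2)"; cases "?p ! (length ?p - 1)")
        (auto simp: last_step_down_def down_step_def)
    moreover have "cell_content (t j) - 1 = cell_content (s j) + int (length ?p - 2)" using tl two by simp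
    then have "L j (cell_content (t j) - 1) = 2 * fst (?p ! (length ?p - 2))"
      using val[of "length ?p - 2"] two by (simp only:)
    ultimately show "L j (cell_content (t j) - 1) = 2 * fst (t j)"
      using ne by (simp add: t_def last_conv_nth)
    assume c: "c \<in> peaks (L j)"
    then have P: "L j c \<noteq> 0" "L j (c - 1) = L j c + 2" "L j (c + 1) = L j c" by (auto simp: peaks_def)
    have pos: "0 < L j c" using delannoy_pos[OF F.L_delannoy[OF ij(2)] P(1)] .
    have sup: "cell_content (s j) \<le> c - 1" "c + 1 \<le> cell_content (t j)"
      using delannoyD(6)[OF F.L_delannoy[OF ij(2)], of "c - 1"]
        delannoyD(6)[OF F.L_delannoy[OF ij(2)], of "c + 1"] P pos by auto
    define l where "l = nat (c - cell_content (s j))"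
    have l: "1 \<le> l" "l + 1 < length ?p" "c = cell_content (s j) + int l" using sup tl two by (auto simp: l_def)
    have steps: "fst (?p ! (l - 1)) = fst (?p ! l) + 1" "fst (?p ! (l + 1)) = fst (?p ! l)"
      using val[of "l - 1"] val[of l] val[of "l + 1"] P l by (auto simp: of_nat_diff algebra_simps)
    have diag: "cell_content (?p ! (l - 1)) + 1 = cell_content (?p ! l)" "cell_content (?p ! (l + 1)) = cell_content (?p ! l) + 1"
      using dyck_path_content[OF dp, of "l - 1"] dyck_path_content[OF dp, of l]
        dyck_path_content[OF dp, of "l + 1"] l by (auto simp: of_nat_diff)
    have "up_step (?p ! (l - 1)) (?p ! l)" "down_step (?p ! l) (?p ! (l + 1))"
      using steps diag unfolding up_step_def down_step_def cell_content_def by (auto simp: prod_eq_iff)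
    then have "is_peak ?p (?p ! l)" using l unfolding is_peak_def by blast
    then have "?p ! l + (1, 1) \<in> Y" using H(3) by (auto simp: is_high_peak_def)
    moreover have "?p ! l = (fst (?p ! l), fst (?p ! l) + c)"
      using dyck_path_content[OF dp, of l] l by (simp add: s_def cell_content_def prod_eq_iff)
    ultimately have "(fst (?p ! l) + 1, fst (?p ! l) + 1 + c) \<in> Y"
      by (metis (no_types, lifting) add.commute add.left_commute add_Pair)
    then have "vertex c (2 * (fst (?p ! l) + 1))" by (simp only: vertex_even)
    then show "vertex c (L j c + 2)" using val[of l] l by (simp add: algebra_simps)
  qed
  interpret R: ranked_family Y k "\<lambda>i. cell_content (s i)" "\<lambda>i. 2 * fst (s i)" "\<lambda>i. cell_content (t i)" "\<lambda>i. 2 * fst (t i)" L rk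
  proof
    show cov: "\<exists>l<k. F.nest l j \<and> rk j = rk l + 1 \<and> (l = i \<or> F.nest i l)"
      if "i < k" "j < k" "F.nest i j" for i j
      using cover[OF that] r by (auto simp: rank_function_def rk_def)
    show "rk i < rk j" if "i < k" "j < k" "F.nest i j" for i j
      using that
    proof (induction "nat (cell_content (t j) - cell_content (s j))" arbitrary: j rule: less_induct)
      case less
      obtain l where l: "l < k" "F.nest l j" "rk j = rk l + 1" "l = i \<or> F.nest i l"
        using cov[OF less(2-4)] by blast
      then show ?case using less(1)[OF F.nest_length[OF l(1,2)] less(2) l(1)] by auto
    qed
    show "\<exists>i<k. F.nest i j" if j: "j < k" "0 < rk j" for j
    proof (rule ccontr)
      assume none: "\<not> (\<exists>i<k. F.nest i j)"
      have "minimal_in (set Ls) lt (Ls ! j)"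
        unfolding minimal_in_def using none lt_iff j(1) idx by (metis k_def nth_mem)
      then show False using r j(2) by (simp add: rank_function_def rk_def)
    qed
    show "\<exists>j<k. L j c = L i c + 2" if "i < k" "L i c \<noteq> 0" "vertex c (L i c + 2)" for i c
      using closed[OF that] .
    show "cell_content (s j) < cell_content (t j) \<and> L j (cell_content (s j) + 1) = 2 * fst (s j) - 2 \<and>
        L j (cell_content (t j) - 1) = 2 * fst (t j)" if "i < k" "j < k" "F.nest i j" for i j
      using corner(2-4)[OF that] by blast
    show "peaks (L j) \<subseteq> high_peaks (L j)" if "i < k" "j < k" "F.nest i j" for i j
      using corner(1)[OF that] by (auto simp: high_peaks_def)
  qed
  have low: "F.lowest D"
    unfolding F.lowest_def
  proof (intro allI impI ballI)
    fix i c assume i: "i < k" and "c \<in> high_peaks (D i)"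
    then have "L i c \<noteq> 0" "vertex c (L i c + 2)" by (auto simp: D_def high_peaks_def peaks_def)
    then show "\<exists>j<k. D j c = D i c + 2" using closed[OF i] i by (auto simp: D_def)
  qed
  have "Y - (Y - M) = M" using MY by auto
  then have "int (num_pleasant Y M) = (\<Sum>E\<in>F.families. \<Prod>i<k. dyck_weight (E i))"
    using F.num_pleasant_eq_families[OF D low] cells_D by simp
  also have "\<dots> = R.mixed_sum {} {}"
  proof -
    have "R.mixed_paths {} = F.dyck" "R.mixed_weight {} = (\<lambda>_. dyck_weight)"
      by (auto simp: R.mixed_paths_def R.mixed_weight_def)
    moreover have "F.families = {E \<in> Pi\<^sub>E {..<k} F.dyck. pairwise_disjoint k E}"
      by (simp add: F.families_def)
    moreover have "finite (Pi\<^sub>E {..<k} F.dyck)" by (rule finite_PiE) (auto intro: finite_dyck)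
    ultimately show ?thesis
      unfolding R.mixed_sum_no_weak_links by (simp add: sum.inter_filter cong: if_cong)
  qed
  also have "\<dots> = 2 ^ (\<Sum>i<k. rk i) * R.mixed_sum {..<k} {}"
    by (rule R.mixed_sum_all[symmetric])
  also have "R.mixed_sum {..<k} {} = (\<Sum>D\<in>(\<Pi>\<^sub>E i\<in>{..<k}. F.delannoy i).
      if pairwise_disjoint k D then \<Prod>i<k. weight (D i) else 0)"
    unfolding R.mixed_sum_no_weak_links
    by (rule sum.cong) (auto simp: R.mixed_paths_def R.mixed_weight_def intro!: PiE_cong)
  also have "\<dots> = det (mat k k (\<lambda>(i, j). \<Sum>f\<in>delannoy_paths (cell_content (s i)) (2 * fst (s i))
      (cell_content (t j)) (2 * fst (t j)). weight f))"
    by (rule F.det_eq_disjoint_delannoy[symmetric])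
  also have "mat k k (\<lambda>(i, j). \<Sum>f\<in>delannoy_paths (cell_content (s i)) (2 * fst (s i))
      (cell_content (t j)) (2 * fst (t j)). weight f) =
      mat k k (\<lambda>(i, j). int (num_pleasant_lowest Y (s i) (t j)))"
    using path by (intro eq_matI) (auto simp: num_pleasant_lowest_eq paths_between_def sum_dyck_weight)
  also have "(\<Sum>i<k. rk i) = (\<Sum>i<k. poset_rank (set Ls) lt (Ls ! i))"
    using rank by simp
  finally show ?thesis by (simp add: Y_def M_def k_def lt_def s_def t_def)
qed

end
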